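(* Let $\mathcal{A}$ be an almost disjoint family of countable sets. Then the following are equivalent: (1) $\mathcal{A}$ is locally small; (2) $K_{\mathcal{A}}$ is monolithic; (3) $C(K_{\mathcal{A}})$ has the controlled separable complementation property; (4) $C(K_{\mathcal{A}})$ is Lindelöf in the weak topology; (5) the dual unit ball $B_{C(K_{\mathcal{A}})^*}$ is monolithic in the weak$^*$ topology.
   Context: A family $\mathcal{A}$ of infinite sets is almost disjoint if $A\cap B$ is finite for all distinct $A,B\in\mathcal{A}$; "countable sets" means that all its members are countably infinite. Put $X=\bigcup\mathcal{A}$. The compact Hausdorff space $K_{\mathcal{A}}$ has underlying set $X\cup\{l_A: A\in\mathcal{A}\}\cup\{\infty\}$ (the points $l_A$ and $\infty$ being new and distinct); each point of $X$ is isolated, basic neighborhoods of $l_A$ are $\{l_A\}\cup(A\setminus F)$ with $F$ finite, and basic neighborhoods of $\infty$ are $K_{\mathcal{A}}\setminus\bigcup_{i<n}(\{l_{A_i}\}\cup A_i)$ with $A_0,\dots,A_{n-1}\in\mathcal{A}$. $C(K)$ is the Banach space of real-valued continuous functions on $K$ with the supremum norm. $\mathcal{A}$ is locally small if for every countable $B\subseteq\bigcup\mathcal{A}$ the set $\{A\in\mathcal{A}: A\cap B\text{ is infinite}\}$ is at most countable. A compact space is monolithic if each of its separable subsets is second countable. A projection on a Banach space $E$ is a bounded linear operator $P:E\to E$ with $P^2=P$. $E$ has the controlled separable complementation property (controlled SCP) if for every separable subspace $F\subseteq E$ and every (norm-)separable subspace $G\subseteq E^*$ there is a projection $P:E\to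 E$ with $F\subseteq\operatorname{im}P$, $G\subseteq\operatorname{im}P^*$ and $\operatorname{im}P$ separable. *)

theory Defs
  imports "HOL-Analysis.Analysis" "HOL-Library.Function_Algebras"
begin

section \<open>Almost disjoint families\<close>

definition almost_disjoint :: "'a set set \<Rightarrow> bool" where
  "almost_disjoint \<A> \<longleftrightarrow>
     (\<forall>A\<in>\<A>. infinite A) \<and> pairwise (\<lambda>A B. finite (A \<inter> B)) \<A>"

definition locally_small :: "'a set set \<Rightarrow> bool" where
  "locally_small \<A> \<longleftrightarrow>
     (\<forall>B. B \<subseteq> \<Union>\<A> \<and> countable B \<longrightarrow> countable {A\<in>\<A>. infinite (A \<inter> B)})"

section \<open>The space $K_{\mathcal{A}}$\<close>

text \<open>\<open>Ell A\<close> is the point $l_A$.\<close>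

datatype 'a kpoint = Pt 'a | Ell "'a set" | Infty

definition K_points :: "'a set set \<Rightarrow> 'a kpoint set" where
  "K_points \<A> = Pt ` (\<Union>\<A>) \<union> Ell ` \<A> \<union> {Infty}"

definition K_open :: "'a set set \<Rightarrow> 'a kpoint set \<Rightarrow> bool" where
  "K_open \<A> U \<longleftrightarrow> U \<subseteq> K_points \<A> \<and>
     (\<forall>A\<in>\<A>. Ell A \<in> U \<longrightarrow>
        (\<exists>F. finite F \<and> insert (Ell A) (Pt ` (A - F)) \<subseteq> U)) \<and>
     (Infty \<in> U \<longrightarrow>
        (\<exists>\<F>. finite \<F> \<and> \<F> \<subseteq> \<A> \<and>
           K_points \<A> - (\<Union>A\<in>\<F>. insert (Ell A) (Pt ` A)) \<subseteq> U))"

definition K_space :: "'a set set \<Rightarrow> 'a kpoint topology" where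
  "K_space \<A> = topology (K_open \<A>)"

lemma istopology_K_open: "istopology (K_open \<A>)"
  unfolding istopology_def
proof (intro conjI allI impI)
  fix S T assume S: "K_open \<A> S" and T: "K_open \<A> T"
  show "K_open \<A> (S \<inter> T)"
    unfolding K_open_def
  proof (intro conjI ballI impI)
    show "S \<inter> T \<subseteq> K_points \<A>"
      using S by (auto simp: K_open_def)
  next
    fix A assume A: "A \<in> \<A>" "Ell A \<in> S \<inter> T"
    obtain F where F: "finite F" "insert (Ell A) (Pt ` (A - F)) \<subseteq> S"
      using S A unfolding K_open_def by blast
    obtain G where G: "finite G" "insert (Ell A) (Pt ` (A - G)) \<subseteq> T"
      using T A unfolding K_open_def by blast
    show "\<exists>F. finite F \<and> insert (Ell A) (Pt ` (A - F)) \<subseteq> S \<inter> T"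
      using F G by (intro exI[of _ "F \<union> G"]) auto
  next
    assume I: "Infty \<in> S \<inter> T"
    obtain F where F: "finite F" "F \<subseteq> \<A>"
        "K_points \<A> - (\<Union>A\<in>F. insert (Ell A) (Pt ` A)) \<subseteq> S"
      using S I unfolding K_open_def by blast
    obtain G where G: "finite G" "G \<subseteq> \<A>"
        "K_points \<A> - (\<Union>A\<in>G. insert (Ell A) (Pt ` A)) \<subseteq> T"
      using T I unfolding K_open_def by blast
    show "\<exists>\<F>. finite \<F> \<and> \<F> \<subseteq> \<A> \<and>
        K_points \<A> - (\<Union>A\<in>\<F>. insert (Ell A) (Pt ` A)) \<subseteq> S \<inter> T"
      using F G by (intro exI[of _ "F \<union> G"]) auto
  qed
next
  fix \<K> assume *: "\<forall>S\<in>\<K>. K_open \<A> S"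
  show "K_open \<A> (\<Union>\<K>)"
    unfolding K_open_def
  proof (intro conjI ballI impI)
    show "\<Union>\<K> \<subseteq> K_points \<A>"
      using * by (auto simp: K_open_def)
  next
    fix A assume A: "A \<in> \<A>" "Ell A \<in> \<Union>\<K>"
    then obtain S where S: "S \<in> \<K>" "Ell A \<in> S" by blast
    then have "K_open \<A> S" using * by simp
    with A S(2) obtain F where F: "finite F" "insert (Ell A) (Pt ` (A - F)) \<subseteq> S"
      unfolding K_open_def by meson
    have "insert (Ell A) (Pt ` (A - F)) \<subseteq> \<Union>\<K>"
      by (rule order_trans[OF F(2) Union_upper[OF S(1)]])
    with F(1) show "\<exists>F. finite F \<and> insert (Ell A) (Pt ` (A - F)) \<subseteq> \<Union>\<K>"
      by (intro exI conjI)
  next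
    assume "Infty \<in> \<Union>\<K>"
    then obtain S where S: "S \<in> \<K>" "Infty \<in> S" by (rule UnionE)
    then have "K_open \<A> S" using * by simp
    with S(2) obtain F where F: "finite F" "F \<subseteq> \<A>"
        "K_points \<A> - (\<Union>A\<in>F. insert (Ell A) (Pt ` A)) \<subseteq> S"
      unfolding K_open_def by meson
    have "K_points \<A> - (\<Union>A\<in>F. insert (Ell A) (Pt ` A)) \<subseteq> \<Union>\<K>"
      by (rule order_trans[OF F(3) Union_upper[OF S(1)]])
    with F(1,2) show "\<exists>\<F>. finite \<F> \<and> \<F> \<subseteq> \<A> \<and>
        K_points \<A> - (\<Union>A\<in>\<F>. insert (Ell A) (Pt ` A)) \<subseteq> \<Union>\<K>"
      by (intro exI conjI)
  qed
qed

lemma openin_K_space: "openin (K_space \<A>) U \<longleftrightarrow> K_open \<A> U"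
  by (simp add: K_space_def istopology_K_open topology_inverse')

lemma topspace_K_space: "topspace (K_space \<A>) = K_points \<A>"
proof -
  have "K_open \<A> (K_points \<A>)"
    unfolding K_open_def
  proof (intro conjI ballI impI)
    fix A assume "A \<in> \<A>"
    then show "\<exists>F. finite F \<and> insert (Ell A) (Pt ` (A - F)) \<subseteq> K_points \<A>"
      by (intro exI[of _ "{}"]) (auto simp: K_points_def)
  next
    show "\<exists>\<F>. finite \<F> \<and> \<F> \<subseteq> \<A> \<and>
        K_points \<A> - (\<Union>A\<in>\<F>. insert (Ell A) (Pt ` A)) \<subseteq> K_points \<A>"
      by (intro exI[of _ "{}"]) simp
  qed simp
  then have "openin (K_space \<A>) (K_points \<A>)"
    by (simp add: openin_K_space)
  moreover have "U \<subseteq> K_points \<A>" if "openin (K_space \<A>) U" for U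
    using that by (simp add: openin_K_space K_open_def)
  ultimately show ?thesis
    by (meson openin_subset openin_topspace subset_antisym)
qed

section \<open>Monolithic spaces\<close>

definition monolithic :: "'a topology \<Rightarrow> bool" where
  "monolithic X \<longleftrightarrow>
     (\<forall>S. S \<subseteq> topspace X \<and> separable_space (subtopology X S)
        \<longrightarrow> second_countable (subtopology X S))"

section \<open>Normed spaces given by a carrier\<close>

text \<open>
  $C(K_{\mathcal{A}})$ depends on the family, so it is not a type.  A normed space is
  a linear subspace \<open>E\<close> of a real vector space together with a function \<open>N\<close> which is a
  norm on \<open>E\<close>.  Functionals on \<open>E\<close> are total functions that vanish outside \<open>E\<close>, so that
  the dual is again such a space, with pointwise operations.
\<close>

instantiation "fun" :: (type, real_vector) real_vector
begin

definition scaleR_fun :: "real \<Rightarrow> ('a \<Rightarrow> 'b) \<Rightarrow> 'a \<Rightarrow> 'b" where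
  "scaleR_fun c f = (\<lambda>x. c *\<^sub>R f x)"

instance
  by standard (auto simp: scaleR_fun_def fun_eq_iff algebra_simps)

end

definition bounded_linear_map ::
    "'e::real_vector set \<Rightarrow> ('e \<Rightarrow> real) \<Rightarrow> 'f::real_vector set \<Rightarrow> ('f \<Rightarrow> real) \<Rightarrow> ('e \<Rightarrow> 'f) \<Rightarrow> bool" where
  "bounded_linear_map E N E' N' T \<longleftrightarrow>
     (\<forall>x\<in>E. T x \<in> E') \<and>
     (\<forall>x\<in>E. \<forall>y\<in>E. T (x + y) = T x + T y) \<and>
     (\<forall>c. \<forall>x\<in>E. T (c *\<^sub>R x) = c *\<^sub>R T x) \<and>
     (\<exists>B. \<forall>x\<in>E. N' (T x) \<le> B * N x)"

definition dual :: "'e::real_vector set \<Rightarrow> ('e \<Rightarrow> real) \<Rightarrow> ('e \<Rightarrow> real) set" where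
  "dual E N = {\<phi>. bounded_linear_map E N UNIV norm \<phi> \<and> (\<forall>x. x \<notin> E \<longrightarrow> \<phi> x = 0)}"

definition dual_norm :: "'e::real_vector set \<Rightarrow> ('e \<Rightarrow> real) \<Rightarrow> ('e \<Rightarrow> real) \<Rightarrow> real" where
  "dual_norm E N \<phi> = (SUP x\<in>{x\<in>E. N x \<le> 1}. \<bar>\<phi> x\<bar>)"

text \<open>\<open>Metric_space\<close> requires a distance that is nonnegative and symmetric also off the carrier.\<close>

definition norm_topology :: "'e::real_vector set \<Rightarrow> ('e \<Rightarrow> real) \<Rightarrow> 'e topology" where
  "norm_topology E N =
     Metric_space.mtopology E (\<lambda>x y. if x \<in> E \<and> y \<in> E then N (x - y) else 0)"

definition weak_topology :: "'e::real_vector set \<Rightarrow> ('e \<Rightarrow> real) \<Rightarrow> 'e topology" where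
  "weak_topology E N =
     topology_generated_by {{x\<in>E. \<phi> x \<in> U} | \<phi> U. \<phi> \<in> dual E N \<and> open U}"

definition weak_star_topology ::
    "'e::real_vector set \<Rightarrow> ('e \<Rightarrow> real) \<Rightarrow> ('e \<Rightarrow> real) topology" where
  "weak_star_topology E N =
     topology_generated_by {{\<phi>\<in>dual E N. \<phi> x \<in> U} | x U. x \<in> E \<and> open U}"

definition dual_unit_ball :: "'e::real_vector set \<Rightarrow> ('e \<Rightarrow> real) \<Rightarrow> ('e \<Rightarrow> real) set" where
  "dual_unit_ball E N = {\<phi>\<in>dual E N. dual_norm E N \<phi> \<le> 1}"

definition is_projection :: "'e::real_vector set \<Rightarrow> ('e \<Rightarrow> real) \<Rightarrow> ('e \<Rightarrow> 'e) \<Rightarrow> bool" where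
  "is_projection E N P \<longleftrightarrow> bounded_linear_map E N E N P \<and> (\<forall>x\<in>E. P (P x) = P x)"

definition adjoint_map :: "'e::real_vector set \<Rightarrow> ('e \<Rightarrow> 'e) \<Rightarrow> ('e \<Rightarrow> real) \<Rightarrow> 'e \<Rightarrow> real" where
  "adjoint_map E P \<phi> = (\<lambda>x. if x \<in> E then \<phi> (P x) else 0)"

definition controlled_SCP :: "'e::real_vector set \<Rightarrow> ('e \<Rightarrow> real) \<Rightarrow> bool" where
  "controlled_SCP E N \<longleftrightarrow>
     (\<forall>F G. subspace F \<and> F \<subseteq> E \<and> separable_space (subtopology (norm_topology E N) F) \<and>
            subspace G \<and> G \<subseteq> dual E N \<and>
            separable_space (subtopology (norm_topology (dual E N) (dual_norm E N)) G)
        \<longrightarrow> (\<exists>P. is_projection E N P \<and> F \<subseteq> P ` E \<and>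
                 G \<subseteq> adjoint_map E P ` dual E N \<and>
                 separable_space (subtopology (norm_topology E N) (P ` E))))"

section \<open>The space $C(K)$\<close>

text \<open>For compact nonempty \<open>K\<close>.  Functions are extended by 0 outside \<open>topspace K\<close>.\<close>

definition C_space :: "'p topology \<Rightarrow> ('p \<Rightarrow> real) set" where
  "C_space K = {f. continuous_map K euclideanreal f \<and> (\<forall>x. x \<notin> topspace K \<longrightarrow> f x = 0)}"

definition sup_norm :: "'p topology \<Rightarrow> ('p \<Rightarrow> real) \<Rightarrow> real" where
  "sup_norm K f = (SUP x\<in>topspace K. \<bar>f x\<bar>)"

end

theory Submission
  imports Defs
begin

text \<open>
  Write \<open>E\<close> for the space of continuous functions on \<open>K\<close>, and \<open>hat A\<close> for the clopen set
  consisting of \<open>A\<close> and the point $l_A$. Near $\infty$ a continuous function is almost constant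
  off finitely many of the countable sets \<open>hat A\<close>. So every \<open>f \<in> E\<close> differs from $f(\infty)$ at
  only countably many points, and this has a consequence for a functional \<open>\<phi>\<close>: choose functions
  $f_n$ in the unit ball that vanish at $\infty$ and on which \<open>\<phi>\<close> tends to its supremum over
  such functions. If \<open>g\<close> vanishes at $\infty$ and on the countable union of the supports, small
  multiples of \<open>\<plusminus>g\<close> can be added to every $f_n$ without leaving the ball, hence \<open>\<phi> g = 0\<close>. Every
  functional therefore depends only on the values at countably many points
  (\<open>dual_countably_determined\<close>); the proofs below use this in place of the identification of the
  dual with $\ell_1(K)$.

  Four of the conditions are joined in a cycle. Let the family be locally small and let \<open>Y\<close> be
  a countable set of isolated points. Then \<open>Y\<close>, the countably many $l_A$ with \<open>A \<inter> Y\<close> infinite,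
  and $\infty$ form a countable closed set \<open>S\<close> onto which \<open>K\<close> retracts (\<open>countable_retract\<close>).
  Composition with the retraction is a norm-one projection of \<open>E\<close> with separable image, and it
  fixes prescribed countable subsets of \<open>E\<close> and of the dual as soon as \<open>Y\<close> absorbs their supports.
  This is the controlled separable complementation property. In any normed space that property
  makes the dual ball monolithic: if a projection \<open>P\<close> with separable image satisfies
  $\varphi = \varphi \circ P$ for all \<open>\<phi>\<close> in a countable set, the equation persists on the weak-star
  closure, where the topology is then determined by the values on a countable set. Since \<open>K\<close>
  embeds in the dual ball by point evaluations, \<open>K\<close> is monolithic too; and if \<open>K\<close> is monolithic
  and \<open>B\<close> is countable, the points $l_A$ with \<open>A \<inter> B\<close> infinite form a discrete subset of a
  separable, hence second countable, set, so there are only countably many of them.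

  If uncountably many \<open>A\<close> meet a countable set \<open>B\<close> in an infinite set, functions of the form
  $1_{\mathrm{hat}\,A} + c_A$, with $c_A$ a slowly decreasing null function on \<open>B\<close>, form an
  uncountable subset of \<open>E\<close> without accumulation point, so \<open>E\<close> is not weakly Lindelof.

  The remaining implication goes through simple functions, the continuous functions with
  finitely many values, all rational. They are dense, and the point is that they are
  Lindelof for the topology of agreement on countable sets (\<open>simple_countable_agreement\<close>). The
  reason is a closing-off argument along an increasing sequence of countable sets
  $U_0, U_1, \dots$ where $U_{n+1}$ receives all $l_A$ with \<open>A\<close> accumulating in $U_n$: a simple
  function distinguishes only finitely many $l_A$ from $\infty$, and each of these can be missing from
  $U_n$ while \<open>A\<close> accumulates there for at most one \<open>n\<close>. So at some stage the simple function can
  be cut off outside $U_n$ without losing continuity, and only countably many simple functions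
  live on $U_n$. A construction by successive approximation, with error $2^{-n}$ at level \<open>n\<close>,
  transfers the Lindelof property to the weak topology. It uses once more that functionals see
  only countably many points.
\<close>

section \<open>Initial topologies\<close>

text \<open>
  The weak topology is the case where the index \<open>i\<close> is a functional evaluated at \<open>z\<close>, the weak-star
  topology the case where \<open>i\<close> is a vector at which the functional \<open>z\<close> is evaluated.
\<close>

lemma openin_initial_nhd:
  fixes ev :: "'i \<Rightarrow> 'z \<Rightarrow> real"
  assumes "openin (topology_generated_by {{z\<in>Z. ev i z \<in> U} | i U. i \<in> I \<and> open U}) W"
    and "g \<in> W"
  obtains J \<delta> where "finite J" "J \<subseteq> I" "\<delta> > 0"
    "\<And>f. f \<in> Z \<Longrightarrow> \<forall>i\<in>J. \<bar>ev i f - ev i g\<bar> < \<delta> \<Longrightarrow> f \<in> W"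
proof -
  have "\<forall>g\<in>W. \<exists>J \<delta>. finite J \<and> J \<subseteq> I \<and> \<delta> > 0 \<and>
      (\<forall>f\<in>Z. (\<forall>i\<in>J. \<bar>ev i f - ev i g\<bar> < \<delta>) \<longrightarrow> f \<in> W)"
    using assms(1) unfolding openin_topology_generated_by_iff
  proof (induction rule: generate_topology_on.induct)
    case Empty
    show ?case by simp
  next
    case (Int a b)
    show ?case
    proof
      fix g assume g: "g \<in> a \<inter> b"
      obtain J \<delta> where 1: "finite J" "J \<subseteq> I" "\<delta> > 0"
          "\<forall>f\<in>Z. (\<forall>i\<in>J. \<bar>ev i f - ev i g\<bar> < \<delta>) \<longrightarrow> f \<in> a"
        using bspec[OF Int.IH(1) IntD1[OF g]] by (elim exE conjE) (rule that)
      obtain J' \<delta>' where 2: "finite J'" "J' \<subseteq> I" "\<delta>' > 0"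
          "\<forall>f\<in>Z. (\<forall>i\<in>J'. \<bar>ev i f - ev i g\<bar> < \<delta>') \<longrightarrow> f \<in> b"
        using bspec[OF Int.IH(2) IntD2[OF g]] by (elim exE conjE) (rule that)
      show "\<exists>J \<delta>. finite J \<and> J \<subseteq> I \<and> \<delta> > 0 \<and>
          (\<forall>f\<in>Z. (\<forall>i\<in>J. \<bar>ev i f - ev i g\<bar> < \<delta>) \<longrightarrow> f \<in> a \<inter> b)"
        proof (intro exI conjI ballI impI)
        show "finite (J \<union> J')" "J \<union> J' \<subseteq> I" "min \<delta> \<delta>' > 0"
          using 1 2 by auto
        fix f assume "f \<in> Z" "\<forall>i\<in>J \<union> J'. \<bar>ev i f - ev i g\<bar> < min \<delta> \<delta>'"
        with 1(4) 2(4) show "f \<in> a \<inter> b" by simp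
      qed
    qed
  next
    case (UN K)
    show ?case
    proof
      fix g assume "g \<in> \<Union>K"
      then obtain k where k: "k \<in> K" "g \<in> k" by blast
      obtain J \<delta> where 1: "finite J" "J \<subseteq> I" "\<delta> > 0"
          "\<forall>f\<in>Z. (\<forall>i\<in>J. \<bar>ev i f - ev i g\<bar> < \<delta>) \<longrightarrow> f \<in> k"
        using bspec[OF UN.IH[OF k(1)] k(2)] by (elim exE conjE) (rule that)
      show "\<exists>J \<delta>. finite J \<and> J \<subseteq> I \<and> \<delta> > 0 \<and>
          (\<forall>f\<in>Z. (\<forall>i\<in>J. \<bar>ev i f - ev i g\<bar> < \<delta>) \<longrightarrow> f \<in> \<Union>K)"
        using 1 k(1) by (intro exI[of _ J] exI[of _ \<delta>]) auto
    qed
  next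
    case (Basis s)
    then obtain i U where s: "s = {z\<in>Z. ev i z \<in> U}" "i \<in> I" "open U"
      by blast
    show ?case
    proof
      fix g assume "g \<in> s"
      then obtain \<delta> where \<delta>: "\<delta> > 0" "\<And>y. dist y (ev i g) < \<delta> \<Longrightarrow> y \<in> U"
        using s unfolding open_dist by auto
      show "\<exists>J \<delta>. finite J \<and> J \<subseteq> I \<and> \<delta> > 0 \<and>
          (\<forall>f\<in>Z. (\<forall>i\<in>J. \<bar>ev i f - ev i g\<bar> < \<delta>) \<longrightarrow> f \<in> s)"
        using s \<delta> by (intro exI[of _ "{i}"] exI[of _ \<delta>]) (auto simp: dist_real_def)
    qed
  qed
  from bspec[OF this assms(2)] show ?thesis
    by (elim exE conjE) (rule that, auto)
qed

lemma openin_initial: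
  assumes "i \<in> I" "open U"
  shows "openin (topology_generated_by {{z\<in>Z. ev i z \<in> U} | i U. i \<in> I \<and> open U}) {z\<in>Z. ev i z \<in> U}"
  by (rule topology_generated_by_Basis) (use assms in blast)

lemma topspace_initial:
  assumes "i \<in> I"
  shows "topspace (topology_generated_by {{z\<in>Z. ev i z \<in> U} | i U. i \<in> I \<and> open U}) = Z"
proof -
  have "{z\<in>Z. ev i z \<in> UNIV} \<in> {{z\<in>Z. ev i z \<in> U} | i U. i \<in> I \<and> open U}"
    using assms by blast
  then show ?thesis
    unfolding topology_generated_by_topspace by (intro subset_antisym) auto
qed

section \<open>Points of accumulation in Lindelof spaces\<close>

text \<open>
  Otherwise the open sets that meet \<open>Z\<close> in a countable set cover the space, and a countable
  subcover makes \<open>Z\<close> countable.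
\<close>

lemma Lindelof_uncountable_accumulation:
  assumes "Lindelof_space X" "Z \<subseteq> topspace X" "uncountable Z"
  obtains g where "g \<in> topspace X" "\<And>U. openin X U \<Longrightarrow> g \<in> U \<Longrightarrow> uncountable (U \<inter> Z)"
proof -
  have "\<exists>g\<in>topspace X. \<forall>U. openin X U \<and> g \<in> U \<longrightarrow> uncountable (U \<inter> Z)"
  proof (rule ccontr)
    assume no: "\<not> ?thesis"
    define \<U> where "\<U> = {U. openin X U \<and> countable (U \<inter> Z)}"
    have "\<exists>U\<in>\<U>. g \<in> U" if "g \<in> topspace X" for g
      using no that unfolding \<U>_def by blast
    then have "topspace X \<subseteq> \<Union>\<U>" by blast
    moreover have "\<Union>\<U> \<subseteq> topspace X"
      by (auto simp: \<U>_def dest: openin_subset)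
    ultimately have "\<Union>\<U> = topspace X" by blast
    moreover have "openin X U" if "U \<in> \<U>" for U
      using that by (simp add: \<U>_def)
    ultimately have "\<exists>\<V>. countable \<V> \<and> \<V> \<subseteq> \<U> \<and> \<Union>\<V> = topspace X"
      by (intro Lindelof_spaceD[OF assms(1)])
    then obtain \<V> where \<V>: "countable \<V>" "\<V> \<subseteq> \<U>" "\<Union>\<V> = topspace X"
      by (elim exE conjE) (rule that)
    have "Z = (\<Union>U\<in>\<V>. U \<inter> Z)"
      using \<V>(3) assms(2) by blast
    moreover have "countable (\<Union>U\<in>\<V>. U \<inter> Z)"
      using \<V>(1,2) unfolding \<U>_def by (intro countable_UN) auto
    ultimately show False using assms(3) by simp
  qed
  with that show ?thesis by blast
qed

section \<open>Rational spans\<close>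

definition rat_span :: "'e::real_vector set \<Rightarrow> 'e set" where
  "rat_span D = sum_list ` lists ((\<lambda>(c, d). c *\<^sub>R d) ` (\<rat> \<times> D))"

lemma countable_rat_span: "countable D \<Longrightarrow> countable (rat_span D)"
  unfolding rat_span_def by (intro countable_image countable_lists countable_SIGMA countable_rat)

lemma rat_span_0: "0 \<in> rat_span D"
  unfolding rat_span_def by (intro image_eqI[of _ _ "[]"]) auto

lemma rat_span_base: "c \<in> \<rat> \<Longrightarrow> d \<in> D \<Longrightarrow> c *\<^sub>R d \<in> rat_span D"
  unfolding rat_span_def by (intro image_eqI[of _ _ "[c *\<^sub>R d]"]) auto

lemma rat_span_add:
  assumes "p \<in> rat_span D" "q \<in> rat_span D"
  shows "p + q \<in> rat_span D"
proof -
  from assms obtain xs ys where "p = sum_list xs" "q = sum_list ys"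
    "xs \<in> lists ((\<lambda>(c, d). c *\<^sub>R d) ` (\<rat> \<times> D))" "ys \<in> lists ((\<lambda>(c, d). c *\<^sub>R d) ` (\<rat> \<times> D))"
    unfolding rat_span_def by blast
  then show ?thesis
    unfolding rat_span_def by (intro image_eqI[of _ _ "xs @ ys"]) (simp_all add: append_in_lists_conv)
qed

lemma rat_span_sum:
  assumes "\<And>i. i \<in> I \<Longrightarrow> g i \<in> rat_span D"
  shows "sum g I \<in> rat_span D"
  using assms by (induction I rule: infinite_finite_induct) (auto simp: rat_span_0 rat_span_add)

lemma rat_span_scale:
  assumes "c \<in> \<rat>" "q \<in> rat_span D"
  shows "c *\<^sub>R q \<in> rat_span D"
proof -
  from assms(2) obtain xs where xs: "q = sum_list xs"
      "xs \<in> lists ((\<lambda>(c, d). c *\<^sub>R d) ` (\<rat> \<times> D))"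
    unfolding rat_span_def by blast
  have "c *\<^sub>R sum_list xs \<in> rat_span D"
    using xs(2)
  proof (induction xs)
    case Nil
    then show ?case by (simp add: rat_span_0)
  next
    case (Cons z xs)
    then obtain a d where "a \<in> \<rat>" "d \<in> D" "z = a *\<^sub>R d" by auto
    then have "c *\<^sub>R z \<in> rat_span D"
      using rat_span_base[of "c * a" d D] assms(1) by simp
    with Cons show ?case by (simp add: scaleR_right_distrib rat_span_add)
  qed
  then show ?thesis by (simp add: xs(1))
qed

lemma rat_span_subset_span: "rat_span D \<subseteq> span D"
proof -
  have "sum_list xs \<in> span D" if "xs \<in> lists ((\<lambda>(c::real, d). c *\<^sub>R d) ` (\<rat> \<times> D))" for xs
    using that by (induction xs) (auto intro: span_add span_scale span_base span_zero)
  then show ?thesis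
    unfolding rat_span_def by blast
qed

section \<open>Normed spaces given by a carrier\<close>

locale normed_carrier =
  fixes E :: "'e::real_vector set" and N :: "'e \<Rightarrow> real"
  assumes subspace_E: "subspace E"
    and N_ge_0: "x \<in> E \<Longrightarrow> 0 \<le> N x"
    and N_eq_0: "x \<in> E \<Longrightarrow> N x = 0 \<longleftrightarrow> x = 0"
    and N_scale: "x \<in> E \<Longrightarrow> N (c *\<^sub>R x) = \<bar>c\<bar> * N x"
    and N_add: "x \<in> E \<Longrightarrow> y \<in> E \<Longrightarrow> N (x + y) \<le> N x + N y"
begin

lemma E_closed [simp]:
  "0 \<in> E" "x \<in> E \<Longrightarrow> y \<in> E \<Longrightarrow> x + y \<in> E" "x \<in> E \<Longrightarrow> y \<in> E \<Longrightarrow> x - y \<in> E"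
  "x \<in> E \<Longrightarrow> c *\<^sub>R x \<in> E"
  using subspace_E by (auto simp: subspace_0 subspace_add subspace_diff subspace_scale)

lemma N_0 [simp]: "N 0 = 0"
  using N_eq_0 by simp

lemma N_minus_commute: "x \<in> E \<Longrightarrow> y \<in> E \<Longrightarrow> N (x - y) = N (y - x)"
  using N_scale[of "x - y" "-1"] by simp

lemma N_triangle: "x \<in> E \<Longrightarrow> y \<in> E \<Longrightarrow> z \<in> E \<Longrightarrow> N (x - z) \<le> N (x - y) + N (y - z)"
  using N_add[of "x - y" "y - z"] by simp

sublocale metric: Metric_space E "\<lambda>x y. if x \<in> E \<and> y \<in> E then N (x - y) else 0"
  by standard (auto simp: N_ge_0 N_minus_commute N_eq_0 N_triangle)

lemma separable_norm_topology_iff: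
  assumes "S \<subseteq> E"
  shows "separable_space (subtopology (norm_topology E N) S) \<longleftrightarrow>
    (\<exists>D. countable D \<and> D \<subseteq> S \<and> (\<forall>x\<in>S. \<forall>e>0. \<exists>d\<in>D. N (x - d) < e))"
proof -
  have dense_iff: "subtopology (norm_topology E N) S closure_of D = S \<longleftrightarrow>
      (\<forall>x\<in>S. \<forall>e>0. \<exists>d\<in>D. N (x - d) < e)" if "D \<subseteq> S" for D
  proof -
    have closure: "subtopology (norm_topology E N) S closure_of D =
        S \<inter> {x \<in> E. \<forall>r>0. \<exists>y\<in>D. y \<in> metric.mball x r}"
      using that by (simp add: norm_topology_def closure_of_subtopology Int_absorb1
          metric.metric_closure_of)
    have ball: "d \<in> metric.mball x e \<longleftrightarrow> N (x - d) < e" if "x \<in> S" "d \<in> D" for d x e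
      using assms that \<open>D \<subseteq> S\<close> by (auto simp: metric.in_mball)
    have "subtopology (norm_topology E N) S closure_of D = S \<longleftrightarrow>
        (\<forall>x\<in>S. \<forall>e>0. \<exists>d\<in>D. d \<in> metric.mball x e)"
      unfolding closure using assms by blast
    also have "\<dots> \<longleftrightarrow> (\<forall>x\<in>S. \<forall>e>0. \<exists>d\<in>D. N (x - d) < e)"
      by (intro ball_cong bex_cong all_cong1 imp_cong refl ball)
    finally show ?thesis .
  qed
  have topspace: "topspace (subtopology (norm_topology E N) S) = S"
    using assms by (auto simp: norm_topology_def)
  show ?thesis
    unfolding separable_space_def topspace
    by (rule ex_cong1) (simp add: dense_iff cong: conj_cong)
qed

text \<open>
  Rational combinations are dense: the vectors that they approximate form a subspace. The scalar
  case needs two errors, one for the vector and one for replacing a real factor by a rational one.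
\<close>

lemma separable_span:
  assumes "countable D" "D \<subseteq> E"
  shows "separable_space (subtopology (norm_topology E N) (span D))"
proof -
  define Q where "Q = rat_span D"
  note Q_add = rat_span_add[of _ D, folded Q_def] and Q_scale = rat_span_scale[of _ _ D, folded Q_def]
    and Q_0 = rat_span_0[of D, folded Q_def] and Q_span = rat_span_subset_span[of D, folded Q_def]
  have D_Q: "D \<subseteq> Q"
    using rat_span_base[of 1 _ D] by (auto simp: Q_def)
  have span_E: "span D \<subseteq> E"
    using assms(2) subspace_E by (rule span_minimal)
  have "countable Q"
    unfolding Q_def using assms(1) by (rule countable_rat_span)
  define R where "R = {x\<in>E. \<forall>e>0. \<exists>q\<in>Q. N (x - q) < e}"
  have "subspace R"
    unfolding subspace_def
  proof (intro conjI ballI allI)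
    show "0 \<in> R"
      unfolding R_def using Q_0 by force
  next
    fix x y assume xy: "x \<in> R" "y \<in> R"
    then have E: "x \<in> E" "y \<in> E" by (auto simp: R_def)
    have "\<exists>q\<in>Q. N (x + y - q) < e" if "e > 0" for e
    proof -
      have "e / 2 > 0" using \<open>e > 0\<close> by simp
      obtain p where p: "p \<in> Q" "N (x - p) < e / 2"
        using xy(1) \<open>e / 2 > 0\<close> unfolding R_def by blast
      obtain q where q: "q \<in> Q" "N (y - q) < e / 2"
        using xy(2) \<open>e / 2 > 0\<close> unfolding R_def by blast
      note pq = p(1) q(1) p(2) q(2)
      then have "p \<in> E" "q \<in> E" using Q_span span_E by blast+
      then have "N ((x - p) + (y - q)) < e"
        using N_add[of "x - p" "y - q"] pq E by auto
      then show ?thesis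
        using Q_add pq by (intro bexI[of _ "p + q"]) (simp_all add: algebra_simps)
    qed
    then show "x + y \<in> R" using E by (simp add: R_def)
  next
    fix c x assume x: "x \<in> R"
    then have E: "x \<in> E" by (simp add: R_def)
    have "\<exists>q\<in>Q. N (c *\<^sub>R x - q) < e" if "e > 0" for e
    proof -
      have "e / 2 / (\<bar>c\<bar> + 1) > 0" using \<open>e > 0\<close> by simp
      then obtain q where q: "q \<in> Q" "N (x - q) < e / 2 / (\<bar>c\<bar> + 1)"
        using x unfolding R_def by blast
      then have qE: "q \<in> E" using Q_span span_E by blast
      obtain r where r: "r \<in> \<rat>" "c < r" "r < c + e / 2 / (N q + 1)"
        using Rats_dense_in_real[of c "c + e / 2 / (N q + 1)"] \<open>e > 0\<close> N_ge_0[OF qE] by auto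
      have "N (c *\<^sub>R x - r *\<^sub>R q) \<le> N (c *\<^sub>R x - c *\<^sub>R q) + N (c *\<^sub>R q - r *\<^sub>R q)"
        using E qE by (intro N_triangle) auto
      also have "\<dots> = \<bar>c\<bar> * N (x - q) + \<bar>c - r\<bar> * N q"
        using E qE by (simp flip: scaleR_right_diff_distrib scaleR_left_diff_distrib add: N_scale)
      also have "\<dots> < e / 2 + e / 2"
      proof (rule add_strict_mono)
        have "\<bar>c\<bar> * N (x - q) \<le> \<bar>c\<bar> * (e / 2 / (\<bar>c\<bar> + 1))"
          using q by (intro mult_left_mono) auto
        also have "\<dots> < e / 2"
          using \<open>e > 0\<close> by (simp add: field_simps)
        finally show "\<bar>c\<bar> * N (x - q) < e / 2" .
        have "\<bar>c - r\<bar> * N q \<le> (e / 2 / (N q + 1)) * N q"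
          using r N_ge_0[OF qE] by (intro mult_right_mono) auto
        also have "\<dots> < e / 2"
          using \<open>e > 0\<close> N_ge_0[OF qE] by (simp add: field_simps)
        finally show "\<bar>c - r\<bar> * N q < e / 2" .
      qed
      finally show ?thesis
        using Q_scale[OF r(1) q(1)] by auto
    qed
    then show "c *\<^sub>R x \<in> R" using E by (simp add: R_def)
  qed
  moreover have "D \<subseteq> R"
    using D_Q assms(2) by (force simp: R_def)
  ultimately have "span D \<subseteq> R"
    by (simp add: span_minimal)
  then show ?thesis
    unfolding separable_norm_topology_iff[OF span_E]
    using \<open>countable Q\<close> Q_span unfolding R_def by blast
qed

subsection \<open>The dual\<close>

lemma dual_linear:
  assumes "\<phi> \<in> dual E N"
  shows "x \<in> E \<Longrightarrow> y \<in> E \<Longrightarrow> \<phi> (x + y) = \<phi> x + \<phi> y"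
    and "x \<in> E \<Longrightarrow> \<phi> (c *\<^sub>R x) = c * \<phi> x"
    and "x \<in> E \<Longrightarrow> y \<in> E \<Longrightarrow> \<phi> (x - y) = \<phi> x - \<phi> y"
    and "\<phi> 0 = 0"
    and "x \<notin> E \<Longrightarrow> \<phi> x = 0"
proof -
  show *: "\<phi> (x + y) = \<phi> x + \<phi> y" if "x \<in> E" "y \<in> E" for x y
    using assms that by (auto simp: dual_def bounded_linear_map_def)
  show **: "\<phi> (c *\<^sub>R x) = c * \<phi> x" if "x \<in> E" for c x
    using assms that by (auto simp: dual_def bounded_linear_map_def)
  show "\<phi> (x - y) = \<phi> x - \<phi> y" if "x \<in> E" "y \<in> E"
    using *[of x "-1 *\<^sub>R y"] **[of y "-1"] that E_closed(4)[of y "-1"] by simp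
  show "\<phi> 0 = 0"
    using **[of 0 0] by simp
  show "x \<notin> E \<Longrightarrow> \<phi> x = 0"
    using assms by (auto simp: dual_def)
qed

lemma dualI:
  assumes "\<And>x y. x \<in> E \<Longrightarrow> y \<in> E \<Longrightarrow> \<phi> (x + y) = \<phi> x + \<phi> y"
    and "\<And>c x. x \<in> E \<Longrightarrow> \<phi> (c *\<^sub>R x) = c * \<phi> x"
    and "\<And>x. x \<in> E \<Longrightarrow> \<bar>\<phi> x\<bar> \<le> B * N x"
    and "\<And>x. x \<notin> E \<Longrightarrow> \<phi> x = 0"
  shows "\<phi> \<in> dual E N"
  using assms by (auto simp: dual_def bounded_linear_map_def intro: exI[of _ B])

lemma dual_norm_bdd:
  assumes "\<phi> \<in> dual E N"
  shows "bdd_above ((\<lambda>x. \<bar>\<phi> x\<bar>) ` {x\<in>E. N x \<le> 1})"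
proof -
  obtain B where B: "\<And>x. x \<in> E \<Longrightarrow> \<bar>\<phi> x\<bar> \<le> B * N x"
    using assms unfolding dual_def bounded_linear_map_def real_norm_def by blast
  have "\<bar>\<phi> x\<bar> \<le> \<bar>B\<bar>" if "x \<in> E" "N x \<le> 1" for x
  proof -
    have "B * N x \<le> \<bar>B\<bar> * 1"
      using that N_ge_0[of x] by (intro mult_mono) auto
    then show ?thesis
      using B[OF that(1)] by simp
  qed
  then show ?thesis by (auto intro!: bdd_aboveI2)
qed

lemma dual_norm_le:
  assumes "\<And>x. x \<in> E \<Longrightarrow> N x \<le> 1 \<Longrightarrow> \<bar>\<phi> x\<bar> \<le> c"
  shows "dual_norm E N \<phi> \<le> c"
  unfolding dual_norm_def using assms by (intro cSUP_least) (auto intro: exI[of _ 0])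

lemma abs_le_dual_norm:
  assumes "\<phi> \<in> dual E N" "x \<in> E" "N x \<le> 1"
  shows "\<bar>\<phi> x\<bar> \<le> dual_norm E N \<phi>"
  unfolding dual_norm_def using assms by (intro cSUP_upper[OF _ dual_norm_bdd]) auto

lemma dual_norm_ge_0: "\<phi> \<in> dual E N \<Longrightarrow> 0 \<le> dual_norm E N \<phi>"
  using abs_le_dual_norm[of \<phi> 0] by simp

lemma dual_norm_bound:
  assumes "\<phi> \<in> dual E N" "x \<in> E"
  shows "\<bar>\<phi> x\<bar> \<le> dual_norm E N \<phi> * N x"
proof (cases "x = 0")
  case True
  then show ?thesis using dual_linear(4)[OF assms(1)] by simp
next
  case False
  then have pos: "N x > 0"
    using N_ge_0[OF assms(2)] N_eq_0[OF assms(2)] by linarith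
  have "\<bar>\<phi> ((1 / N x) *\<^sub>R x)\<bar> \<le> dual_norm E N \<phi>"
    using assms pos by (intro abs_le_dual_norm) (auto simp: N_scale)
  then show ?thesis
    using pos by (simp add: dual_linear(2)[OF assms] abs_mult field_simps)
qed

lemma subspace_dual: "subspace (dual E N)"
  unfolding subspace_def
proof (intro conjI ballI allI)
  show "0 \<in> dual E N"
    by (rule dualI[of _ 0]) auto
next
  fix \<phi> \<psi> assume *: "\<phi> \<in> dual E N" "\<psi> \<in> dual E N"
  show "\<phi> + \<psi> \<in> dual E N"
  proof (rule dualI[of _ "dual_norm E N \<phi> + dual_norm E N \<psi>"])
    show "\<bar>(\<phi> + \<psi>) x\<bar> \<le> (dual_norm E N \<phi> + dual_norm E N \<psi>) * N x" if "x \<in> E" for x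
      using dual_norm_bound[OF *(1) that] dual_norm_bound[OF *(2) that]
      by (simp add: algebra_simps)
  qed (use * in \<open>auto simp: dual_linear algebra_simps\<close>)
next
  fix c \<phi> assume *: "\<phi> \<in> dual E N"
  show "c *\<^sub>R \<phi> \<in> dual E N"
  proof (rule dualI[of _ "\<bar>c\<bar> * dual_norm E N \<phi>"])
    show "\<bar>(c *\<^sub>R \<phi>) x\<bar> \<le> \<bar>c\<bar> * dual_norm E N \<phi> * N x" if "x \<in> E" for x
      using mult_left_mono[OF dual_norm_bound[OF * that], of "\<bar>c\<bar>"]
      by (simp add: scaleR_fun_def abs_mult mult.assoc)
  qed (use * in \<open>auto simp: dual_linear algebra_simps scaleR_fun_def\<close>)
qed

text \<open>
  With this, all facts about \<open>normed_carrier\<close>, in particular those on separability, also apply to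
  the dual with its own norm.
\<close>

lemma normed_carrier_dual: "normed_carrier (dual E N) (dual_norm E N)"
proof
  show "subspace (dual E N)" by (rule subspace_dual)
next
  fix \<phi> assume *: "\<phi> \<in> dual E N"
  show "0 \<le> dual_norm E N \<phi>"
    using * by (rule dual_norm_ge_0)
  show "dual_norm E N \<phi> = 0 \<longleftrightarrow> \<phi> = 0"
  proof
    assume 0: "dual_norm E N \<phi> = 0"
    show "\<phi> = 0"
    proof
      fix x show "\<phi> x = 0 x"
        using dual_norm_bound[OF *, of x] dual_linear(5)[OF *, of x] 0 by (cases "x \<in> E") auto
    qed
  next
    assume "\<phi> = 0"
    then have "dual_norm E N \<phi> \<le> 0"
      by (intro dual_norm_le) simp
    with dual_norm_ge_0[OF *] show "dual_norm E N \<phi> = 0" by simp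
  qed
next
  have le: "dual_norm E N (c *\<^sub>R \<phi>) \<le> \<bar>c\<bar> * dual_norm E N \<phi>" if "\<phi> \<in> dual E N" for c \<phi>
    using abs_le_dual_norm[OF that]
    by (intro dual_norm_le) (auto simp: scaleR_fun_def abs_mult intro!: mult_left_mono)
  fix c \<phi> assume *: "\<phi> \<in> dual E N"
  show "dual_norm E N (c *\<^sub>R \<phi>) = \<bar>c\<bar> * dual_norm E N \<phi>"
  proof (cases "c = 0")
    case True
    then show ?thesis
      using le[OF *, of c] dual_norm_ge_0[of "c *\<^sub>R \<phi>"] subspace_scale[OF subspace_dual *, of c] by auto
  next
    case False
    have "dual_norm E N ((1/c) *\<^sub>R (c *\<^sub>R \<phi>)) \<le> \<bar>1/c\<bar> * dual_norm E N (c *\<^sub>R \<phi>)"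
      using * by (intro le subspace_scale[OF subspace_dual])
    then have "\<bar>c\<bar> * dual_norm E N \<phi> \<le> dual_norm E N (c *\<^sub>R \<phi>)"
      using False by (simp add: field_simps)
    with le[OF *, of c] show ?thesis by simp
  qed
next
  fix \<phi> \<psi> assume *: "\<phi> \<in> dual E N" "\<psi> \<in> dual E N"
  show "dual_norm E N (\<phi> + \<psi>) \<le> dual_norm E N \<phi> + dual_norm E N \<psi>"
  proof (rule dual_norm_le)
    fix x assume "x \<in> E" "N x \<le> 1"
    then show "\<bar>(\<phi> + \<psi>) x\<bar> \<le> dual_norm E N \<phi> + dual_norm E N \<psi>"
      using abs_le_dual_norm[OF *(1), of x] abs_le_dual_norm[OF *(2), of x] by simp
  qed
qed

lemma topspace_weak_star: "topspace (weak_star_topology E N) = dual E N"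
  unfolding weak_star_topology_def by (rule topspace_initial[OF E_closed(1)])

lemma topspace_weak: "topspace (weak_topology E N) = E"
  unfolding weak_topology_def
  using topspace_initial[OF subspace_0[OF subspace_dual], where ev = "\<lambda>\<phi> x. \<phi> x" and Z = E] by simp

lemma openin_weak_star:
  "x \<in> E \<Longrightarrow> open U \<Longrightarrow> openin (weak_star_topology E N) {\<phi>\<in>dual E N. \<phi> x \<in> U}"
  unfolding weak_star_topology_def by (rule openin_initial)

lemma openin_weak:
  "\<phi> \<in> dual E N \<Longrightarrow> open U \<Longrightarrow> openin (weak_topology E N) {x\<in>E. \<phi> x \<in> U}"
  unfolding weak_topology_def by (rule openin_initial[where ev = "\<lambda>\<phi> x. \<phi> x"])

lemma weak_star_nhd:
  assumes "openin (weak_star_topology E N) W" "\<phi> \<in> W"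
  obtains J \<delta> where "finite J" "J \<subseteq> E" "\<delta> > 0"
    "\<And>\<psi>. \<psi> \<in> dual E N \<Longrightarrow> \<forall>x\<in>J. \<bar>\<psi> x - \<phi> x\<bar> < \<delta> \<Longrightarrow> \<psi> \<in> W"
  by (rule openin_initial_nhd[where ev = "\<lambda>x \<phi>. \<phi> x", OF assms[unfolded weak_star_topology_def]])
    (rule that)

lemma weak_nhd:
  assumes "openin (weak_topology E N) W" "x \<in> W"
  obtains \<Phi> \<delta> where "finite \<Phi>" "\<Phi> \<subseteq> dual E N" "\<delta> > 0"
    "\<And>y. y \<in> E \<Longrightarrow> \<forall>\<phi>\<in>\<Phi>. \<bar>\<phi> y - \<phi> x\<bar> < \<delta> \<Longrightarrow> y \<in> W"
  by (rule openin_initial_nhd[where ev = "\<lambda>\<phi> x. \<phi> x", OF assms[unfolded weak_topology_def]])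
    (rule that)

subsection \<open>Controlled separable complementation and the dual ball\<close>

text \<open>
  For a projection, every functional in the image of the adjoint is fixed by it, because
  $\psi(P(Px)) = \psi(Px)$. The span of a countable set of functionals is norm-separable, so one
  projection with separable image fixes them all.
\<close>

lemma controlled_SCP_fixing:
  assumes "controlled_SCP E N" "countable D" "D \<subseteq> dual E N"
  obtains P where "is_projection E N P" "separable_space (subtopology (norm_topology E N) (P ` E))"
    "\<And>\<phi> x. \<phi> \<in> D \<Longrightarrow> x \<in> E \<Longrightarrow> \<phi> (P x) = \<phi> x"
proof -
  interpret dual: normed_carrier "dual E N" "dual_norm E N"
    by (rule normed_carrier_dual)
  have "subspace {0::'e}" "{0::'e} \<subseteq> E" "separable_space (subtopology (norm_topology E N) {0::'e})"
    using separable_span[of "{}"] by (auto simp: subspace_0)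
  moreover have "subspace (span D)" "span D \<subseteq> dual E N"
      "separable_space (subtopology (norm_topology (dual E N) (dual_norm E N)) (span D))"
    using assms(2,3) dual.separable_span span_minimal[OF assms(3) subspace_dual] by simp_all
  ultimately obtain P where P: "is_projection E N P" "span D \<subseteq> adjoint_map E P ` dual E N"
      "separable_space (subtopology (norm_topology E N) (P ` E))"
    using assms(1) unfolding controlled_SCP_def by blast
  have "\<phi> (P x) = \<phi> x" if "\<phi> \<in> D" "x \<in> E" for \<phi> x
  proof -
    obtain \<psi> where "\<phi> = adjoint_map E P \<psi>"
      using P(2) \<open>\<phi> \<in> D\<close> span_base[of \<phi> D] by blast
    then show ?thesis
      using P(1) \<open>x \<in> E\<close> by (auto simp: adjoint_map_def is_projection_def bounded_linear_map_def)
  qed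
  with P that show ?thesis by blast
qed

text \<open>
  For \<open>S\<close> with a countable weak-star dense subset, a projection \<open>P\<close> as in the preceding lemma
  satisfies $\varphi(Px) = \varphi(x)$ for all \<open>\<phi> \<in> S\<close>, since this equation defines a weak-star closed
  set. As all functionals in the ball are 1-Lipschitz, their values at \<open>x\<close> are controlled by those
  on a countable dense subset \<open>H\<close> of the image of \<open>P\<close>; the resulting countably many cells
  generate the topology of \<open>S\<close>.
\<close>

theorem controlled_SCP_imp_monolithic_dual_ball:
  assumes "controlled_SCP E N"
  shows "monolithic (subtopology (weak_star_topology E N) (dual_unit_ball E N))"
  unfolding monolithic_def
proof (intro allI impI, elim conjE)
  let ?B = "dual_unit_ball E N" and ?W = "weak_star_topology E N"
  fix S assume "S \<subseteq> topspace (subtopology ?W ?B)"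
    and sep: "separable_space (subtopology (subtopology ?W ?B) S)"
  then have SB: "S \<subseteq> ?B" by auto
  then have SD: "S \<subseteq> dual E N" by (auto simp: dual_unit_ball_def)
  have W: "subtopology (subtopology ?W ?B) S = subtopology ?W S"
    using SB by (simp add: subtopology_subtopology Int_absorb1)
  have topS: "topspace (subtopology ?W S) = S"
    using SD by (auto simp: topspace_weak_star)
  obtain D where D: "countable D" "D \<subseteq> S" "subtopology ?W S closure_of D = S"
    using sep unfolding W separable_space_def topS by blast
  obtain P where P: "is_projection E N P" "separable_space (subtopology (norm_topology E N) (P ` E))"
    and PD: "\<And>\<phi> x. \<phi> \<in> D \<Longrightarrow> x \<in> E \<Longrightarrow> \<phi> (P x) = \<phi> x"
    using controlled_SCP_fixing[OF assms D(1)] D(2) SD by blast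
  have PE: "P x \<in> E" if "x \<in> E" for x
    using P(1) that by (auto simp: is_projection_def bounded_linear_map_def)
  have PS: "\<phi> (P x) = \<phi> x" if "\<phi> \<in> S" "x \<in> E" for \<phi> x
  proof (rule ccontr)
    assume "\<phi> (P x) \<noteq> \<phi> x"
    from hausdorff[OF this] obtain U V
      where UV: "open U" "open V" "\<phi> (P x) \<in> U" "\<phi> x \<in> V" "U \<inter> V = {}"
      by (elim exE conjE) (rule that)
    have "openin ?W ({\<psi>\<in>dual E N. \<psi> (P x) \<in> U} \<inter> {\<psi>\<in>dual E N. \<psi> x \<in> V})" (is "openin ?W ?G")
      using UV that PE by (intro openin_Int openin_weak_star) auto
    then have "openin (subtopology ?W S) (S \<inter> ?G)"
      by (rule openin_subtopology_Int2)
    moreover have "\<phi> \<in> S \<inter> ?G" using UV that SD by auto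
    moreover have "\<phi> \<in> subtopology ?W S closure_of D"
      using D(3) that by blast
    ultimately have "\<exists>\<psi>. \<psi> \<in> D \<and> \<psi> \<in> S \<inter> ?G"
      by (simp only: in_closure_of)
    then obtain \<psi> where "\<psi> \<in> D" "\<psi> \<in> ?G"
      by (elim exE conjE IntE) (rule that, assumption, rule IntI)
    then have "\<psi> x \<in> U \<inter> V"
      using PD[of \<psi> x] \<open>x \<in> E\<close> by simp
    then show False using UV(5) by simp
  qed
  have "P ` E \<subseteq> E" using PE by blast
  from P(2)[unfolded separable_norm_topology_iff[OF this]] obtain H
    where H: "countable H" "H \<subseteq> P ` E" "\<forall>y\<in>P ` E. \<forall>e>0. \<exists>h\<in>H. N (y - h) < e"
    by (elim exE conjE) (rule that)
  have HE: "H \<subseteq> E" using H(2) PE by blast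
  define cell where "cell h a b = {\<psi>\<in>S. \<psi> h \<in> {a<..<b}}" for h and a b :: real
  define \<C> where "\<C> = (\<lambda>(h, a, b). cell h a b) ` (H \<times> \<rat> \<times> \<rat>)"
  define \<B> where "\<B> = (\<lambda>\<F>. S \<inter> \<Inter>\<F>) ` {\<F>. finite \<F> \<and> \<F> \<subseteq> \<C>}"
  have cell_open: "openin (subtopology ?W S) (cell h a b)" if "h \<in> H" for h a b
  proof -
    have "cell h a b = S \<inter> {\<psi>\<in>dual E N. \<psi> h \<in> {a<..<b}}"
      using SD by (auto simp: cell_def)
    also have "openin (subtopology ?W S) \<dots>"
      using that HE by (intro openin_subtopology_Int2 openin_weak_star) auto
    finally show ?thesis .
  qed
  have "countable \<B>"
    unfolding \<B>_def \<C>_def using H(1)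
    by (intro countable_image countable_Collect_finite_subset countable_SIGMA countable_rat)
  moreover have "openin (subtopology ?W S) V" if V: "V \<in> \<B>" for V
  proof -
    obtain \<F> where \<F>: "V = S \<inter> \<Inter>\<F>" "finite \<F>" "\<F> \<subseteq> \<C>"
      using V unfolding \<B>_def by blast
    have S_open: "openin (subtopology ?W S) S"
      using openin_topspace[of "subtopology ?W S"] topS by simp
    show ?thesis
    proof (cases "\<F> = {}")
      case True
      then show ?thesis using \<F>(1) S_open by simp
    next
      case False
      have "openin (subtopology ?W S) (\<Inter>\<F>)"
        using \<F> False cell_open by (intro openin_Inter) (auto simp: \<C>_def)
      with S_open show ?thesis unfolding \<F>(1) by (rule openin_Int)
    qed
  qed
  moreover have "\<exists>V\<in>\<B>. \<phi> \<in> V \<and> V \<subseteq> U" if U: "openin (subtopology ?W S) U" "\<phi> \<in> U" for U \<phi>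
  proof -
    obtain T where T: "openin ?W T" "U = T \<inter> S"
      using U(1) unfolding openin_subtopology by blast
    have \<phi>: "\<phi> \<in> T" "\<phi> \<in> S" using U(2) T(2) by auto
    obtain J \<delta> where J: "finite J" "J \<subseteq> E" "\<delta> > 0"
      and nhd: "\<And>\<psi>. \<psi> \<in> dual E N \<Longrightarrow> \<forall>x\<in>J. \<bar>\<psi> x - \<phi> x\<bar> < \<delta> \<Longrightarrow> \<psi> \<in> T"
      by (rule weak_star_nhd[OF T(1) \<phi>(1)]) (rule that)
    have "\<exists>c. c \<in> \<C> \<and> \<phi> \<in> c \<and> (\<forall>\<psi>\<in>c. \<bar>\<psi> x - \<phi> x\<bar> < \<delta>)" if "x \<in> J" for x
    proof -
      have xE: "x \<in> E" using that J by blast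
      obtain h where h: "h \<in> H" "N (P x - h) < \<delta> / 4"
        using bspec[OF H(3) imageI[OF xE]] J(3) by (meson divide_pos_pos zero_less_numeral)
      have near: "\<bar>\<psi> x - \<psi> h\<bar> < \<delta> / 4" if "\<psi> \<in> S" for \<psi>
      proof -
        have \<psi>: "\<psi> \<in> dual E N" "dual_norm E N \<psi> \<le> 1"
          using that SB by (auto simp: dual_unit_ball_def)
        have hE: "h \<in> E" using h HE by blast
        have "\<bar>\<psi> (P x - h)\<bar> \<le> dual_norm E N \<psi> * N (P x - h)"
          using \<psi> PE[OF xE] hE by (intro dual_norm_bound) auto
        also have "\<dots> \<le> 1 * N (P x - h)"
          using \<psi> PE[OF xE] hE N_ge_0 by (intro mult_right_mono) auto
        finally show ?thesis
          using h PS[OF that xE] dual_linear(3)[OF \<psi>(1) PE[OF xE] hE] by simp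
      qed
      obtain a b where ab: "a \<in> \<rat>" "b \<in> \<rat>" "\<phi> h - \<delta> / 4 < a" "a < \<phi> h" "\<phi> h < b" "b < \<phi> h + \<delta> / 4"
        using Rats_dense_in_real[of "\<phi> h - \<delta> / 4" "\<phi> h"] Rats_dense_in_real[of "\<phi> h" "\<phi> h + \<delta> / 4"]
          J(3) by auto
      have "\<bar>\<psi> x - \<phi> x\<bar> < \<delta>" if "\<psi> \<in> cell h a b" for \<psi>
      proof -
        have "\<psi> \<in> S" "a < \<psi> h" "\<psi> h < b" using that by (auto simp: cell_def)
        then show ?thesis
          using near[of \<psi>] near[OF \<phi>(2)] ab by linarith
      qed
      moreover have "cell h a b \<in> \<C>" "\<phi> \<in> cell h a b"
        using h ab \<phi> by (auto simp: \<C>_def cell_def)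
      ultimately show ?thesis by blast
    qed
    then obtain c where c: "\<And>x. x \<in> J \<Longrightarrow> c x \<in> \<C> \<and> \<phi> \<in> c x \<and> (\<forall>\<psi>\<in>c x. \<bar>\<psi> x - \<phi> x\<bar> < \<delta>)"
      by metis
    have "S \<inter> \<Inter>(c ` J) \<in> \<B>"
      unfolding \<B>_def using c J(1) by blast
    moreover have "\<phi> \<in> S \<inter> \<Inter>(c ` J)" using c \<phi> by blast
    moreover have "S \<inter> \<Inter>(c ` J) \<subseteq> U"
    proof
      fix \<psi> assume \<psi>: "\<psi> \<in> S \<inter> \<Inter>(c ` J)"
      then have "\<psi> \<in> T"
        using c SD by (intro nhd) auto
      with \<psi> show "\<psi> \<in> U" using T(2) by simp
    qed
    ultimately show ?thesis by blast
  qed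
  ultimately show "second_countable (subtopology (subtopology ?W ?B) S)"
    unfolding W second_countable_def by blast
qed

end

section \<open>Continuous functions on $K_{\mathcal{A}}$\<close>

definition hat :: "'a set \<Rightarrow> 'a kpoint set" where
  "hat A = insert (Ell A) (Pt ` A)"

lemma hat_simps [simp]:
  "Pt x \<in> hat A \<longleftrightarrow> x \<in> A" "Ell B \<in> hat A \<longleftrightarrow> B = A" "Infty \<notin> hat A"
  by (auto simp: hat_def)

lemma scaleR_fun_apply [simp]: "(c *\<^sub>R f) x = c *\<^sub>R f x"
  by (simp add: scaleR_fun_def)

lemma countable_Pt_preimage:
  assumes "countable T"
  shows "countable {x. Pt x \<in> T}"
proof (rule countable_image_inj_on)
  show "countable (Pt ` {x. Pt x \<in> T})"
    using assms by (rule countable_subset[rotated]) auto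
qed (simp add: inj_on_def)

lemma countable_Ell_preimage:
  assumes "countable T"
  shows "countable {A. Ell A \<in> T}"
proof (rule countable_image_inj_on)
  show "countable (Ell ` {A. Ell A \<in> T})"
    using assms by (rule countable_subset[rotated]) auto
qed (simp add: inj_on_def)

lemma finite_inj_nat_below:
  fixes e :: "'b \<Rightarrow> nat"
  assumes "inj_on e B"
  shows "finite {y\<in>B. e y < n}"
proof (rule finite_imageD)
  show "finite (e ` {y\<in>B. e y < n})"
    by (rule finite_subset[of _ "{..<n}"]) auto
  show "inj_on e {y\<in>B. e y < n}"
    using assms by (rule inj_on_subset) auto
qed

locale ad_family =
  fixes \<A> :: "'a set set"
  assumes almost_disjoint: "almost_disjoint \<A>"
    and countable_members: "\<forall>A\<in>\<A>. countable A"
begin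

abbreviation "K \<equiv> K_space \<A>"
abbreviation "E \<equiv> C_space K"
abbreviation "N \<equiv> sup_norm K"

lemma finite_Int: "A \<in> \<A> \<Longrightarrow> B \<in> \<A> \<Longrightarrow> A \<noteq> B \<Longrightarrow> finite (A \<inter> B)"
  using almost_disjoint by (auto simp: almost_disjoint_def pairwise_def)

lemma infinite_member: "A \<in> \<A> \<Longrightarrow> infinite A"
  using almost_disjoint by (auto simp: almost_disjoint_def)

lemma countable_hat: "A \<in> \<A> \<Longrightarrow> countable (hat A)"
  using countable_members by (simp add: hat_def)

lemma K_points_simps [simp]:
  "Pt x \<in> K_points \<A> \<longleftrightarrow> x \<in> \<Union>\<A>" "Ell A \<in> K_points \<A> \<longleftrightarrow> A \<in> \<A>" "Infty \<in> K_points \<A>"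
  by (auto simp: K_points_def)

lemma hat_subset: "A \<in> \<A> \<Longrightarrow> hat A \<subseteq> K_points \<A>"
  by (auto simp: hat_def)

text \<open>
  In this form the condition at $l_A$ is about the finite set of exceptions, which is what all
  finiteness arguments below produce.
\<close>

lemma openin_K_iff:
  "openin K U \<longleftrightarrow> U \<subseteq> K_points \<A> \<and>
     (\<forall>A\<in>\<A>. Ell A \<in> U \<longrightarrow> finite {x\<in>A. Pt x \<notin> U}) \<and>
     (Infty \<in> U \<longrightarrow> (\<exists>\<F>. finite \<F> \<and> \<F> \<subseteq> \<A> \<and> K_points \<A> - \<Union>(hat ` \<F>) \<subseteq> U))"
proof -
  have ell: "(\<exists>F. finite F \<and> insert (Ell A) (Pt ` (A - F)) \<subseteq> U) \<longleftrightarrow> finite {x\<in>A. Pt x \<notin> U}"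
    if "Ell A \<in> U" for A
  proof
    assume "\<exists>F. finite F \<and> insert (Ell A) (Pt ` (A - F)) \<subseteq> U"
    then obtain F where "finite F" "insert (Ell A) (Pt ` (A - F)) \<subseteq> U" by blast
    then show "finite {x\<in>A. Pt x \<notin> U}"
      by (elim finite_subset[rotated]) auto
  next
    assume "finite {x\<in>A. Pt x \<notin> U}"
    then show "\<exists>F. finite F \<and> insert (Ell A) (Pt ` (A - F)) \<subseteq> U"
      using that by (intro exI[of _ "{x\<in>A. Pt x \<notin> U}"]) auto
  qed
  show ?thesis
    unfolding openin_K_space K_open_def hat_def
    by (intro conj_cong refl ball_cong imp_cong ell)
qed

text \<open>
  Continuity in terms of the three kinds of points: nothing at the isolated points, convergence
  along \<open>A\<close> at $l_A$, and at $\infty$ uniform closeness off finitely many sets \<open>hat A\<close>.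
\<close>

lemma C_space_iff:
  "f \<in> E \<longleftrightarrow> (\<forall>p. p \<notin> K_points \<A> \<longrightarrow> f p = 0) \<and>
     (\<forall>A\<in>\<A>. \<forall>e>0. finite {x\<in>A. e \<le> \<bar>f (Pt x) - f (Ell A)\<bar>}) \<and>
     (\<forall>e>0. \<exists>\<F>. finite \<F> \<and> \<F> \<subseteq> \<A> \<and>
        (\<forall>p\<in>K_points \<A> - \<Union>(hat ` \<F>). \<bar>f p - f Infty\<bar> < e))"
  (is "_ \<longleftrightarrow> ?out \<and> ?ell \<and> ?inf")
proof
  assume f: "f \<in> E"
  have op: "openin K {p\<in>K_points \<A>. f p \<in> ball c e}" for c e
    using f openin_continuous_map_preimage[of K euclideanreal f "ball c e"]
    by (simp add: C_space_def topspace_K_space)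
  have ?out
    using f by (simp add: C_space_def topspace_K_space)
  moreover have ?ell
  proof (intro ballI allI impI)
    fix A and e :: real assume A: "A \<in> \<A>" "e > 0"
    have "finite {x\<in>A. Pt x \<notin> {p\<in>K_points \<A>. f p \<in> ball (f (Ell A)) e}}"
      using op[of "f (Ell A)" e] A unfolding openin_K_iff by auto
    then show "finite {x\<in>A. e \<le> \<bar>f (Pt x) - f (Ell A)\<bar>}"
      by (rule finite_subset[rotated]) (auto simp: dist_real_def)
  qed
  moreover have ?inf
  proof (intro allI impI)
    fix e :: real assume e: "e > 0"
    then obtain \<F> where "finite \<F>" "\<F> \<subseteq> \<A>"
        "K_points \<A> - \<Union>(hat ` \<F>) \<subseteq> {p\<in>K_points \<A>. f p \<in> ball (f Infty) e}"
      using op[of "f Infty" e] unfolding openin_K_iff by auto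
    then show "\<exists>\<F>. finite \<F> \<and> \<F> \<subseteq> \<A> \<and> (\<forall>p\<in>K_points \<A> - \<Union>(hat ` \<F>). \<bar>f p - f Infty\<bar> < e)"
      by (intro exI[of _ \<F>]) (auto simp: dist_real_def abs_minus_commute)
  qed
  ultimately show "?out \<and> ?ell \<and> ?inf" by blast
next
  assume *: "?out \<and> ?ell \<and> ?inf"
  have "openin K {p\<in>K_points \<A>. f p \<in> U}" if "open U" for U
    unfolding openin_K_iff
  proof (intro conjI ballI impI)
    fix A assume A: "A \<in> \<A>" "Ell A \<in> {p\<in>K_points \<A>. f p \<in> U}"
    then obtain e where e: "e > 0" "ball (f (Ell A)) e \<subseteq> U"
      using \<open>open U\<close> by (auto simp: open_contains_ball)
    have "finite {x\<in>A. e \<le> \<bar>f (Pt x) - f (Ell A)\<bar>}"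
      using * A e by blast
    moreover have "{x\<in>A. Pt x \<notin> {p\<in>K_points \<A>. f p \<in> U}} \<subseteq> {x\<in>A. e \<le> \<bar>f (Pt x) - f (Ell A)\<bar>}"
    proof (intro subsetI CollectI conjI)
      fix x assume x: "x \<in> {x\<in>A. Pt x \<notin> {p\<in>K_points \<A>. f p \<in> U}}"
      then have "f (Pt x) \<notin> ball (f (Ell A)) e" using A e by auto
      then show "e \<le> \<bar>f (Pt x) - f (Ell A)\<bar>" by (simp add: dist_real_def)
      show "x \<in> A" using x by simp
    qed
    ultimately show "finite {x\<in>A. Pt x \<notin> {p\<in>K_points \<A>. f p \<in> U}}"
      by (rule finite_subset[rotated])
  next
    assume "Infty \<in> {p\<in>K_points \<A>. f p \<in> U}"
    then obtain e where e: "e > 0" "ball (f Infty) e \<subseteq> U"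
      using \<open>open U\<close> by (auto simp: open_contains_ball)
    with * obtain \<F> where \<F>: "finite \<F>" "\<F> \<subseteq> \<A>"
        "\<forall>p\<in>K_points \<A> - \<Union>(hat ` \<F>). \<bar>f p - f Infty\<bar> < e"
      by blast
    have "K_points \<A> - \<Union>(hat ` \<F>) \<subseteq> {p\<in>K_points \<A>. f p \<in> U}"
    proof
      fix p assume p: "p \<in> K_points \<A> - \<Union>(hat ` \<F>)"
      then have "f p \<in> ball (f Infty) e"
        using bspec[OF \<F>(3) p] by (simp only: mem_ball dist_real_def abs_minus_commute)
      with p e show "p \<in> {p\<in>K_points \<A>. f p \<in> U}" by auto
    qed
    with \<F> show "\<exists>\<F>. finite \<F> \<and> \<F> \<subseteq> \<A> \<and> K_points \<A> - \<Union>(hat ` \<F>) \<subseteq> {p\<in>K_points \<A>. f p \<in> U}"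
      by blast
  qed auto
  with * show "f \<in> E"
    by (simp add: C_space_def continuous_map_def topspace_K_space)
qed

lemma
  assumes "f \<in> E"
  shows E_outside: "p \<notin> K_points \<A> \<Longrightarrow> f p = 0"
    and E_at_Ell: "A \<in> \<A> \<Longrightarrow> e > 0 \<Longrightarrow> finite {x\<in>A. e \<le> \<bar>f (Pt x) - f (Ell A)\<bar>}"
    and E_at_Infty: "e > 0 \<Longrightarrow> \<exists>\<F>. finite \<F> \<and> \<F> \<subseteq> \<A> \<and>
        (\<forall>p\<in>K_points \<A> - \<Union>(hat ` \<F>). \<bar>f p - f Infty\<bar> < e)"
  using assms unfolding C_space_iff by blast+

text \<open>
  For each \<open>n\<close> the set where \<open>f\<close> differs from $f(\infty)$ by at least $1/(n+1)$ is covered by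
  finitely many of the countable sets \<open>hat A\<close>.
\<close>

lemma countable_support:
  assumes "f \<in> E"
  shows "countable {p\<in>K_points \<A>. f p \<noteq> f Infty}"
proof -
  have "\<exists>\<F>. finite \<F> \<and> \<F> \<subseteq> \<A> \<and>
      (\<forall>p\<in>K_points \<A> - \<Union>(hat ` \<F>). \<bar>f p - f Infty\<bar> < 1 / real (Suc n))" for n
    by (rule E_at_Infty[OF assms]) simp
  then obtain \<F> where \<F>: "\<And>n. finite (\<F> n)" "\<And>n. \<F> n \<subseteq> \<A>"
    "\<And>n p. p \<in> K_points \<A> - \<Union>(hat ` \<F> n) \<Longrightarrow> \<bar>f p - f Infty\<bar> < 1 / real (Suc n)"
    by metis
  have "{p\<in>K_points \<A>. f p \<noteq> f Infty} \<subseteq> (\<Union>n. \<Union>(hat ` \<F> n))"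
  proof
    fix p assume p: "p \<in> {p\<in>K_points \<A>. f p \<noteq> f Infty}"
    then obtain n where "1 / real (Suc n) < \<bar>f p - f Infty\<bar>"
      using nat_approx_posE[of "\<bar>f p - f Infty\<bar>"] by auto
    with \<F>(3)[of p n] p show "p \<in> (\<Union>n. \<Union>(hat ` \<F> n))" by fastforce
  qed
  moreover have "countable (\<Union>n. \<Union>(hat ` \<F> n))"
  proof (intro countable_UN countableI_type)
    fix n i assume "i \<in> \<F> n"
    then show "countable (hat i)" using \<F>(2) countable_hat by blast
  qed (use \<F>(1) in \<open>simp add: countable_finite\<close>)
  ultimately show ?thesis
    by (rule countable_subset)
qed

text \<open>
  This is compactness of \<open>K\<close> in elementary form: off finitely many sets \<open>hat A\<close> the function is
  within 1 of $f(\infty)$, and on each of those it is within 1 of $f(l_A)$ except at finitely many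
  points.
\<close>

lemma E_bounded:
  assumes "f \<in> E"
  shows "\<exists>B. \<forall>p. \<bar>f p\<bar> \<le> B"
proof -
  obtain \<F> where \<F>: "finite \<F>" "\<F> \<subseteq> \<A>"
      "\<And>p. p \<in> K_points \<A> - \<Union>(hat ` \<F>) \<Longrightarrow> \<bar>f p - f Infty\<bar> < 1"
    using E_at_Infty[OF assms, of 1] by auto
  define bad where "bad A = f ` (insert (Ell A) (Pt ` {x\<in>A. 1 \<le> \<bar>f (Pt x) - f (Ell A)\<bar>}))" for A
  define B0 where "B0 = Max (abs ` insert (f Infty) (insert 0 (\<Union>A\<in>\<F>. bad A)))"
  have "finite (bad A)" if "A \<in> \<F>" for A
    using E_at_Ell[OF assms, of A 1] \<F>(2) that unfolding bad_def
    by (intro finite_imageI finite.insertI) auto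
  then have fin: "finite (abs ` insert (f Infty) (insert 0 (\<Union>A\<in>\<F>. bad A)))"
    using \<F>(1) by blast
  have le: "\<bar>y\<bar> \<le> B0" if "y \<in> insert (f Infty) (insert 0 (\<Union>A\<in>\<F>. bad A))" for y
    unfolding B0_def by (rule Max_ge[OF fin imageI[OF that]])
  have B0: "\<bar>f Infty\<bar> \<le> B0" "0 \<le> B0" "\<And>y A. A \<in> \<F> \<Longrightarrow> y \<in> bad A \<Longrightarrow> \<bar>y\<bar> \<le> B0"
    using le[of "f Infty"] le[of 0] le by auto
  have "\<bar>f p\<bar> \<le> B0 + 1" for p
  proof (cases "p \<in> K_points \<A>")
    case False
    then show ?thesis using E_outside[OF assms] B0(2) by simp
  next
    case True
    show ?thesis
    proof (cases "p \<in> \<Union>(hat ` \<F>)")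
      case False
      then show ?thesis using \<F>(3)[of p] True B0(1) by auto
    next
      case True
      then obtain A where A: "A \<in> \<F>" "p \<in> hat A" by blast
      have ell: "\<bar>f (Ell A)\<bar> \<le> B0"
        using B0(3)[OF A(1)] by (simp add: bad_def)
      from A(2) consider "p = Ell A" | x where "x \<in> A" "p = Pt x"
        by (auto simp: hat_def)
      then show ?thesis
      proof cases
        case 1
        then show ?thesis using ell by simp
      next
        case 2
        show ?thesis
        proof (cases "1 \<le> \<bar>f (Pt x) - f (Ell A)\<bar>")
          case True
          then have "f p \<in> bad A" using 2 by (auto simp: bad_def)
          then show ?thesis using B0(3)[OF A(1)] by fastforce
        next
          case False
          then show ?thesis using 2 ell by auto
        qed
      qed
    qed
  qed
  then show ?thesis by blast
qed

lemma N_le_iff: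
  assumes "f \<in> E"
  shows "N f \<le> c \<longleftrightarrow> (\<forall>p. \<bar>f p\<bar> \<le> c)"
proof -
  obtain B where B: "\<forall>p. \<bar>f p\<bar> \<le> B" using E_bounded[OF assms] by blast
  then have bdd: "bdd_above ((\<lambda>p. \<bar>f p\<bar>) ` K_points \<A>)"
    by (auto intro!: bdd_aboveI2)
  have "N f \<le> c \<longleftrightarrow> (\<forall>p\<in>K_points \<A>. \<bar>f p\<bar> \<le> c)"
    unfolding sup_norm_def topspace_K_space
    by (rule cSUP_le_iff[OF _ bdd]) (use K_points_simps(3) in blast)
  also have "\<dots> \<longleftrightarrow> (\<forall>p. \<bar>f p\<bar> \<le> c)"
  proof (intro iffI ballI allI)
    fix p assume *: "\<forall>p\<in>K_points \<A>. \<bar>f p\<bar> \<le> c"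
    then have "0 \<le> c" using K_points_simps(3) abs_ge_zero order_trans by blast
    with * show "\<bar>f p\<bar> \<le> c"
      using E_outside[OF assms, of p] by (cases "p \<in> K_points \<A>") auto
  qed blast
  finally show ?thesis .
qed

lemma abs_le_N: "f \<in> E \<Longrightarrow> \<bar>f p\<bar> \<le> N f"
  using N_le_iff by blast

lemma E_const: "(\<lambda>p. if p \<in> K_points \<A> then c else 0) \<in> E"
proof -
  have "{x\<in>A. e \<le> \<bar>(if Pt x \<in> K_points \<A> then c else 0) - (if Ell A \<in> K_points \<A> then c else 0)\<bar>} = {}"
    if "A \<in> \<A>" "e > 0" for A e
    using that by auto
  then have "finite {x\<in>A. e \<le> \<bar>(if Pt x \<in> K_points \<A> then c else 0) - (if Ell A \<in> K_points \<A> then c else 0)\<bar>}"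
    if "A \<in> \<A>" "e > 0" for A e
    using that by (metis (no_types, lifting) finite.emptyI)
  then show ?thesis
    unfolding C_space_iff by (intro conjI allI ballI impI) (auto intro!: exI[of _ "{}"])
qed

sublocale normed_carrier E N
proof
  have add: "f + g \<in> E" if "f \<in> E" "g \<in> E" for f g
    using that continuous_map_add[of K f g] by (simp add: C_space_def plus_fun_def)
  have scale: "c *\<^sub>R f \<in> E" if "f \<in> E" for f c
    using that continuous_map_real_mult_left[of K f c] by (simp add: C_space_def scaleR_fun_def)
  show "subspace E"
    unfolding subspace_def using add scale E_const[of 0] by (simp add: zero_fun_def)
  have le: "N (c *\<^sub>R f) \<le> \<bar>c\<bar> * N f" if "f \<in> E" for f c
    using abs_le_N[OF that] scale[OF that]
    by (auto simp: N_le_iff scaleR_fun_def abs_mult intro!: mult_left_mono)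
  fix f assume f: "f \<in> E"
  show ge: "0 \<le> N f"
    using abs_le_N[OF f, of Infty] by linarith
  show eq: "N f = 0 \<longleftrightarrow> f = 0"
  proof
    assume "N f = 0"
    then have "\<bar>f p\<bar> \<le> 0" for p using abs_le_N[OF f, of p] by simp
    then show "f = 0" by (intro ext) simp
  next
    assume "f = 0"
    then have "N f \<le> 0" using f by (simp add: N_le_iff)
    with ge show "N f = 0" by simp
  qed
  show "N (c *\<^sub>R f) = \<bar>c\<bar> * N f" for c
  proof (cases "c = 0")
    case True
    then have "N (c *\<^sub>R f) \<le> 0" using le[OF f, of c] by simp
    moreover have "0 \<le> N (c *\<^sub>R f)"
      using abs_le_N[OF scale[OF f], of c Infty] by linarith
    ultimately show ?thesis using True by simp
  next
    case False
    have "N ((1/c) *\<^sub>R (c *\<^sub>R f)) \<le> \<bar>1/c\<bar> * N (c *\<^sub>R f)"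
      by (intro le scale f)
    then have "\<bar>c\<bar> * N f \<le> N (c *\<^sub>R f)"
      using False by (simp add: field_simps)
    with le[OF f, of c] show ?thesis by simp
  qed
  fix g assume g: "g \<in> E"
  show "N (f + g) \<le> N f + N g"
    using abs_le_N[OF f] abs_le_N[OF g] add[OF f g]
    by (simp add: N_le_iff) (meson abs_triangle_ineq add_mono order_trans)
qed

lemma uniform_limit_in_E:
  assumes "\<And>e. e > 0 \<Longrightarrow> \<exists>f\<in>E. \<forall>p. \<bar>g p - f p\<bar> < e"
  shows "g \<in> E"
  unfolding C_space_iff
proof (intro conjI ballI allI impI)
  fix p assume p: "p \<notin> K_points \<A>"
  have "\<bar>g p\<bar> < e" if "e > 0" for e
  proof -
    obtain f where "f \<in> E" "\<bar>g p - f p\<bar> < e" using assms[OF \<open>e > 0\<close>] by blast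
    then show ?thesis using E_outside[OF \<open>f \<in> E\<close> p] by simp
  qed
  from this[of "\<bar>g p\<bar>"] show "g p = 0" by auto
next
  fix A and e :: real assume A: "A \<in> \<A>" and e: "e > 0"
  then have "e / 3 > 0" by simp
  then obtain f where f: "f \<in> E" "\<And>p. \<bar>g p - f p\<bar> < e / 3"
    using assms by blast
  have "e / 3 \<le> \<bar>f (Pt x) - f (Ell A)\<bar>" if "e \<le> \<bar>g (Pt x) - g (Ell A)\<bar>" for x
    using f(2)[of "Pt x"] f(2)[of "Ell A"] that by linarith
  then have "{x\<in>A. e \<le> \<bar>g (Pt x) - g (Ell A)\<bar>} \<subseteq> {x\<in>A. e / 3 \<le> \<bar>f (Pt x) - f (Ell A)\<bar>}"
    by blast
  then show "finite {x\<in>A. e \<le> \<bar>g (Pt x) - g (Ell A)\<bar>}"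
    using E_at_Ell[OF f(1) A \<open>e / 3 > 0\<close>] by (rule finite_subset)
next
  fix e :: real assume "e > 0"
  then have "e / 3 > 0" by simp
  then obtain f where f: "f \<in> E" "\<And>p. \<bar>g p - f p\<bar> < e / 3"
    using assms by blast
  obtain \<F> where \<F>: "finite \<F>" "\<F> \<subseteq> \<A>"
      "\<And>p. p \<in> K_points \<A> - \<Union>(hat ` \<F>) \<Longrightarrow> \<bar>f p - f Infty\<bar> < e / 3"
    using E_at_Infty[OF f(1) \<open>e / 3 > 0\<close>] by auto
  have "\<bar>g p - g Infty\<bar> < e" if "p \<in> K_points \<A> - \<Union>(hat ` \<F>)" for p
    using f(2)[of p] f(2)[of Infty] \<F>(3)[OF that] by linarith
  with \<F> show "\<exists>\<F>. finite \<F> \<and> \<F> \<subseteq> \<A> \<and> (\<forall>p\<in>K_points \<A> - \<Union>(hat ` \<F>). \<bar>g p - g Infty\<bar> < e)"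
    by blast
qed

subsection \<open>Clopen sets\<close>

lemma indicator_in_E:
  assumes "openin K V" "openin K (K_points \<A> - V)"
  shows "indicator V \<in> E"
proof -
  have V: "V \<subseteq> K_points \<A>"
    using openin_subset[OF assms(1)] by (simp add: topspace_K_space)
  have "openin K {p\<in>K_points \<A>. indicator V p \<in> U}" if "open U" for U :: "real set"
  proof -
    have "{p\<in>K_points \<A>. indicator V p \<in> U} =
        (if 1 \<in> U then V else {}) \<union> (if 0 \<in> U then K_points \<A> - V else {})"
      using V by (auto simp: indicator_def split: if_splits)
    also have "openin K \<dots>"
      using assms by (intro openin_Un) auto
    finally show ?thesis .
  qed
  with V show ?thesis
    by (auto simp: C_space_def continuous_map_def topspace_K_space indicator_def)
qed

lemma clopen_Pt:
  assumes "x \<in> \<Union>\<A>"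
  shows "openin K {Pt x}" "openin K (K_points \<A> - {Pt x})"
proof -
  show "openin K {Pt x}" using assms by (auto simp: openin_K_iff)
  obtain A where A: "A \<in> \<A>" "x \<in> A" using assms by blast
  have "{y\<in>B. Pt y \<notin> K_points \<A> - {Pt x}} \<subseteq> {x}" if "B \<in> \<A>" for B
    using that by auto
  then have "finite {y\<in>B. Pt y \<notin> K_points \<A> - {Pt x}}" if "B \<in> \<A>" for B
    using that by (meson finite.emptyI finite.insertI finite_subset)
  then show "openin K (K_points \<A> - {Pt x})"
    unfolding openin_K_iff using A by (auto intro!: exI[of _ "{A}"])
qed

lemma clopen_hat:
  assumes "A \<in> \<A>" "finite F"
  shows "openin K (hat A - Pt ` F)" "openin K (K_points \<A> - (hat A - Pt ` F))"
proof -
  have "{x\<in>A. Pt x \<notin> hat A - Pt ` F} \<subseteq> F" by auto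
  then have "finite {x\<in>A. Pt x \<notin> hat A - Pt ` F}"
    using assms(2) finite_subset by blast
  then show "openin K (hat A - Pt ` F)"
    unfolding openin_K_iff using hat_subset[OF assms(1)] by auto
  have "finite {x\<in>B. Pt x \<notin> K_points \<A> - (hat A - Pt ` F)}" if "B \<in> \<A>" "B \<noteq> A" for B
  proof -
    have "{x\<in>B. Pt x \<notin> K_points \<A> - (hat A - Pt ` F)} \<subseteq> A \<inter> B"
      using that by auto
    then show ?thesis
      using finite_Int[OF assms(1) that(1)] that(2) finite_subset by blast
  qed
  then show "openin K (K_points \<A> - (hat A - Pt ` F))"
    unfolding openin_K_iff using assms(1) by (auto intro!: exI[of _ "{A}"])
qed

lemma hat_indicator_in_E: "A \<in> \<A> \<Longrightarrow> indicator (hat A) \<in> E"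
  using clopen_hat[of A "{}"] by (intro indicator_in_E) auto

text \<open>
  \<open>K\<close> is zero-dimensional; continuous indicator functions therefore separate points from closed
  sets, which makes evaluation at points an embedding.
\<close>

lemma clopen_nhd:
  assumes "openin K U" "p \<in> U"
  obtains V where "openin K V" "openin K (K_points \<A> - V)" "p \<in> V" "V \<subseteq> U"
proof (cases p)
  case (Pt x)
  then have "x \<in> \<Union>\<A>"
    using assms unfolding openin_K_iff by auto
  with clopen_Pt[OF this] assms Pt that show ?thesis by blast
next
  case (Ell A)
  then have A: "A \<in> \<A>" "finite {x\<in>A. Pt x \<notin> U}"
    using assms unfolding openin_K_iff by auto
  show ?thesis
    by (rule that[OF clopen_hat[OF A]]) (use Ell assms in \<open>auto simp: hat_def\<close>)
next
  case Infty
  then obtain \<F> where \<F>: "finite \<F>" "\<F> \<subseteq> \<A>" "K_points \<A> - \<Union>(hat ` \<F>) \<subseteq> U"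
    using assms unfolding openin_K_iff by auto
  define V where "V = K_points \<A> - \<Union>(hat ` \<F>)"
  have "openin K (hat A)" if "A \<in> \<F>" for A
    using clopen_hat(1)[of A "{}"] \<F>(2) that by auto
  then have "openin K (\<Union>(hat ` \<F>))"
    by blast
  moreover have "K_points \<A> - V = \<Union>(hat ` \<F>)"
    unfolding V_def using \<F>(2) hat_subset by blast
  ultimately have "openin K (K_points \<A> - V)"
    by simp
  moreover have "openin K V"
  proof -
    have "closedin K (hat A)" if "A \<in> \<F>" for A
      unfolding closedin_def topspace_K_space
      using clopen_hat(2)[of A "{}"] \<F>(2) hat_subset that by auto
    then have "closedin K (\<Union>(hat ` \<F>))"
      using \<F>(1) by (intro closedin_Union) auto
    then show ?thesis
      unfolding V_def closedin_def topspace_K_space by blast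
  qed
  ultimately show ?thesis
    using that[of V] \<F> Infty unfolding V_def by auto
qed

subsection \<open>Point evaluations\<close>

text \<open>
  Set to 0 outside \<open>E\<close>, as for every member of the dual.
\<close>

definition eval_at :: "'a kpoint \<Rightarrow> ('a kpoint \<Rightarrow> real) \<Rightarrow> real" where
  "eval_at p f = (if f \<in> E then f p else 0)"

lemma eval_at_dual: "eval_at p \<in> dual E N"
  by (rule dualI[of _ 1]) (simp_all add: eval_at_def abs_le_N)

lemma eval_at_dual_unit_ball: "eval_at p \<in> dual_unit_ball E N"
proof -
  have "dual_norm E N (eval_at p) \<le> 1"
  proof (rule dual_norm_le)
    fix f assume "f \<in> E" "N f \<le> 1"
    then show "\<bar>eval_at p f\<bar> \<le> 1"
      using abs_le_N[of f p] by (simp add: eval_at_def)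
  qed
  then show ?thesis by (simp add: dual_unit_ball_def eval_at_dual)
qed

text \<open>
  Functions $f_n$ nearly attaining the supremum \<open>Sup V\<close> of \<open>\<phi>\<close> over the part of the unit ball
  that vanishes at $\infty$ have countable support. A function \<open>g\<close> of norm at most 1 that vanishes on
  all these supports and at $\infty$ is disjoint from each $f_n$, so $f_n + g$ is still in that
  part of the ball and \<open>\<phi> g\<close> is at most the gap between $\varphi(f_n)$ and the supremum. The same
  holds for \<open>-g\<close>.
\<close>

lemma dual_countably_determined:
  assumes \<phi>: "\<phi> \<in> dual E N"
  shows "\<exists>C. countable C \<and> C \<subseteq> K_points \<A> \<and> (\<forall>f\<in>E. (\<forall>p\<in>C. f p = 0) \<longrightarrow> \<phi> f = 0)"
proof -
  define V where "V = \<phi> ` {f\<in>E. f Infty = 0 \<and> N f \<le> 1}"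
  have ne: "V \<noteq> {}"
  proof -
    have "0 \<in> {f\<in>E. f Infty = 0 \<and> N f \<le> 1}" by simp
    then show ?thesis unfolding V_def by blast
  qed
  have bdd: "bdd_above V"
  proof (rule bdd_aboveI)
    fix v assume "v \<in> V"
    then obtain f where "f \<in> E" "N f \<le> 1" "v = \<phi> f" by (auto simp: V_def)
    then show "v \<le> dual_norm E N \<phi>"
      using abs_le_dual_norm[OF \<phi>, of f] by simp
  qed
  have "\<exists>f. f \<in> E \<and> f Infty = 0 \<and> N f \<le> 1 \<and> Sup V - 1 / real (Suc n) < \<phi> f" for n
  proof -
    have "Sup V - 1 / real (Suc n) < Sup V" by simp
    then obtain v where "v \<in> V" "Sup V - 1 / real (Suc n) < v"
      using less_cSup_iff[OF ne bdd] by blast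
    then show ?thesis by (auto simp: V_def)
  qed
  then obtain f where f: "\<And>n. f n \<in> E" "\<And>n. f n Infty = 0" "\<And>n. N (f n) \<le> 1"
      "\<And>n. Sup V - 1 / real (Suc n) < \<phi> (f n)"
    by metis
  define C where "C = insert Infty (\<Union>n. {p\<in>K_points \<A>. f n p \<noteq> f n Infty})"
  have le: "\<phi> g \<le> 1 / real (Suc n)" if g: "g \<in> E" "N g \<le> 1" "\<And>p. p \<in> C \<Longrightarrow> g p = 0" for g n
  proof -
    have "\<bar>f n p + g p\<bar> \<le> 1" for p
    proof (cases "f n p = 0")
      case True
      then show ?thesis using abs_le_N[OF g(1), of p] g(2) by simp
    next
      case False
      then have "p \<in> {p\<in>K_points \<A>. f n p \<noteq> f n Infty}"
        using f(2)[of n] E_outside[OF f(1), of p n] by auto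
      then have "p \<in> C"
        unfolding C_def by blast
      then show ?thesis using g(3)[of p] abs_le_N[OF f(1), of n p] f(3)[of n] by simp
    qed
    then have "\<phi> (f n + g) \<in> V"
      using f g by (auto simp: V_def N_le_iff C_def)
    then have "\<phi> (f n + g) \<le> Sup V"
      using bdd by (rule cSup_upper)
    then show ?thesis
      using f(4)[of n] dual_linear(1)[OF \<phi> f(1)[of n] g(1)] by simp
  qed
  have le0: "\<phi> g \<le> 0" if g: "g \<in> E" "N g \<le> 1" "\<And>p. p \<in> C \<Longrightarrow> g p = 0" for g
  proof (rule ccontr)
    assume "\<not> \<phi> g \<le> 0"
    then obtain n where "1 / real (Suc n) < \<phi> g"
      using nat_approx_posE[of "\<phi> g"] by auto
    with le[OF g, of n] show False by simp
  qed
  have "\<phi> g = 0" if g: "g \<in> E" "\<forall>p\<in>C. g p = 0" for g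
  proof -
    define c where "c = 1 / (N g + 1)"
    have c: "c > 0" "c * N g \<le> 1"
      using N_ge_0[OF g(1)] by (auto simp: c_def field_simps)
    have "\<phi> (c *\<^sub>R g) \<le> 0" "\<phi> ((-c) *\<^sub>R g) \<le> 0"
      using g c by (auto intro!: le0 simp: N_scale simp del: scaleR_minus_left)
    then have "c * \<phi> g = 0"
      using dual_linear(2)[OF \<phi> g(1), of c] dual_linear(2)[OF \<phi> g(1), of "-c"] by simp
    then show ?thesis using c by simp
  qed
  moreover have "countable C"
    unfolding C_def using countable_support[OF f(1)] by (intro countable_insert countable_UN) auto
  moreover have "C \<subseteq> K_points \<A>"
    unfolding C_def by auto
  ultimately show ?thesis by (intro exI[of _ C]) simp
qed

section \<open>Monolithicity of the dual ball and of $K_{\mathcal{A}}$\<close>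

lemma continuous_map_eval_at: "continuous_map K (weak_star_topology E N) eval_at"
  unfolding weak_star_topology_def
proof (rule continuous_on_generated_topo)
  fix W assume "W \<in> {{\<phi>\<in>dual E N. \<phi> x \<in> U} | x U. x \<in> E \<and> open U}"
  then obtain f U where W: "W = {\<phi>\<in>dual E N. \<phi> f \<in> U}" "f \<in> E" "open U"
    by blast
  have "eval_at -` W \<inter> topspace K = {p\<in>topspace K. f p \<in> U}"
    using W(2) by (auto simp: W(1) eval_at_dual) (auto simp: eval_at_def)
  with W show "openin K (eval_at -` W \<inter> topspace K)"
    using openin_continuous_map_preimage[of K euclideanreal f U] by (simp add: C_space_def)
next
  have "eval_at ` topspace K \<subseteq> dual E N"
    using eval_at_dual by blast
  then show "eval_at ` topspace K \<subseteq> \<Union>{{\<phi>\<in>dual E N. \<phi> x \<in> U} | x U. x \<in> E \<and> open U}"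
    using topspace_weak_star unfolding weak_star_topology_def topology_generated_by_topspace by simp
qed

lemma eval_at_reflects_open:
  assumes "openin K U"
  obtains W where "openin (weak_star_topology E N) W"
    "\<And>p. p \<in> K_points \<A> \<Longrightarrow> eval_at p \<in> W \<longleftrightarrow> p \<in> U"
proof -
  have "\<exists>f. f \<in> E \<and> f p = 1 \<and> (\<forall>q. f q \<noteq> 0 \<longrightarrow> q \<in> U)" if p: "p \<in> U" for p
  proof -
    obtain V where V: "openin K V" "openin K (K_points \<A> - V)" "p \<in> V" "V \<subseteq> U"
      using clopen_nhd[OF assms p] by blast
    then show ?thesis
      using indicator_in_E[OF V(1,2)] by (intro exI[of _ "indicator V"]) (auto simp: indicator_def)
  qed
  then obtain f where f: "\<And>p. p \<in> U \<Longrightarrow> f p \<in> E \<and> f p p = 1 \<and> (\<forall>q. f p q \<noteq> 0 \<longrightarrow> q \<in> U)"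
    by metis
  define W where "W = (\<Union>p\<in>U. {\<phi>\<in>dual E N. \<phi> (f p) \<in> - {0}})"
  have "openin (weak_star_topology E N) W"
    unfolding W_def using f openin_weak_star[OF _ open_Compl[OF closed_singleton[of "0::real"]]]
    by (intro openin_Union) blast
  moreover have "eval_at p \<in> W \<longleftrightarrow> p \<in> U" for p
  proof
    assume "eval_at p \<in> W"
    then obtain q where q: "q \<in> U" "eval_at p (f q) \<noteq> 0" by (auto simp: W_def)
    then have "f q p \<noteq> 0" using f[OF q(1)] by (simp add: eval_at_def)
    then show "p \<in> U" using f[OF q(1)] by blast
  next
    assume p: "p \<in> U"
    then have "eval_at p (f p) \<noteq> 0" using f[OF p] by (simp add: eval_at_def)
    then show "eval_at p \<in> W" unfolding W_def using p eval_at_dual[of p] by blast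
  qed
  ultimately show ?thesis using that by blast
qed

text \<open>
  A subset \<open>S\<close> of \<open>K\<close> and its image under the evaluations have the same topology, so the image
  inherits separability from \<open>S\<close> and a countable base of the image pulls back to \<open>S\<close>.
\<close>

theorem monolithic_dual_ball_imp_monolithic:
  assumes "monolithic (subtopology (weak_star_topology E N) (dual_unit_ball E N))"
  shows "monolithic K"
  unfolding monolithic_def
proof (intro allI impI, elim conjE)
  let ?W = "weak_star_topology E N" and ?B = "dual_unit_ball E N"
  fix S assume S: "S \<subseteq> topspace K" "separable_space (subtopology K S)"
  define S' where "S' = eval_at ` S"
  have S'B: "S' \<subseteq> ?B"
    unfolding S'_def using eval_at_dual_unit_ball by blast
  have sub: "subtopology (subtopology ?W ?B) S' = subtopology ?W S'"
    using S'B by (simp add: subtopology_subtopology Int_absorb1)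
  have cont: "continuous_map (subtopology K S) (subtopology ?W S') eval_at"
    using continuous_map_from_subtopology[OF continuous_map_eval_at]
    by (auto simp: continuous_map_in_subtopology S'_def)
  have topS': "topspace (subtopology ?W S') = S'"
    using S'B by (auto simp: topspace_weak_star dual_unit_ball_def)
  have "eval_at ` topspace (subtopology K S) = topspace (subtopology ?W S')"
    unfolding topS' topspace_subtopology_subset[OF S(1)] by (simp add: S'_def)
  with S(2) cont have "separable_space (subtopology ?W S')"
    by (rule separable_space_continuous_map_image)
  then have "second_countable (subtopology ?W S')"
    using assms S'B unfolding monolithic_def sub[symmetric]
    by (metis topS' sub topspace_subtopology le_inf_iff order_refl)
  then obtain \<B> where \<B>: "countable \<B>" "\<forall>V\<in>\<B>. openin (subtopology ?W S') V"
      "\<forall>U \<phi>. openin (subtopology ?W S') U \<and> \<phi> \<in> U \<longrightarrow> (\<exists>V\<in>\<B>. \<phi> \<in> V \<and> V \<subseteq> U)"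
    unfolding second_countable_def by (elim exE conjE) (rule that)
  define pull where "pull V = {p\<in>topspace (subtopology K S). eval_at p \<in> V}" for V
  have topS: "topspace (subtopology K S) = S"
    by (rule topspace_subtopology_subset[OF S(1)])
  have "countable (pull ` \<B>)"
    using \<B>(1) by simp
  moreover have "\<forall>V\<in>pull ` \<B>. openin (subtopology K S) V"
    unfolding pull_def using \<B>(2) openin_continuous_map_preimage[OF cont] by blast
  moreover have "\<exists>V\<in>pull ` \<B>. p \<in> V \<and> V \<subseteq> U" if U: "openin (subtopology K S) U" "p \<in> U" for U p
  proof -
    obtain T where T: "openin K T" "U = T \<inter> S"
      using U(1) unfolding openin_subtopology by blast
    obtain W where W: "openin ?W W" "\<And>p. p \<in> K_points \<A> \<Longrightarrow> eval_at p \<in> W \<longleftrightarrow> p \<in> T"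
      using eval_at_reflects_open[OF T(1)] by blast
    have SK: "S \<subseteq> K_points \<A>" using S(1) by (simp add: topspace_K_space)
    have "openin (subtopology ?W S') (S' \<inter> W)"
      using W(1) by (rule openin_subtopology_Int2)
    moreover have "eval_at p \<in> S' \<inter> W"
      using U(2) T(2) W(2)[of p] SK by (auto simp: S'_def)
    ultimately obtain V where V: "V \<in> \<B>" "eval_at p \<in> V" "V \<subseteq> S' \<inter> W"
      using \<B>(3) by meson
    have "pull V \<subseteq> U"
      using V(3) W(2) SK unfolding pull_def topS T(2) by blast
    moreover have "p \<in> pull V"
      using V(2) U(2) T(2) unfolding pull_def topS by simp
    ultimately show ?thesis using V(1) by blast
  qed
  ultimately show "second_countable (subtopology K S)"
    unfolding second_countable_def by meson
qed

text \<open>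
  \<open>B\<close> is dense in the set \<open>S\<close> that arises from it by adding the points $l_A$ with \<open>A \<inter> B\<close>
  infinite. In a countable base of \<open>S\<close>, each of these points needs its own member, contained
  in \<open>hat A\<close>.
\<close>

theorem monolithic_imp_locally_small:
  assumes "monolithic K"
  shows "locally_small \<A>"
  unfolding locally_small_def
proof (intro allI impI, elim conjE)
  fix B assume B: "B \<subseteq> \<Union>\<A>" "countable B"
  define L where "L = {A\<in>\<A>. infinite (A \<inter> B)}"
  define S where "S = Pt ` B \<union> Ell ` L"
  have SK: "S \<subseteq> K_points \<A>" using B(1) unfolding S_def L_def K_points_def by blast
  have topS: "topspace (subtopology K S) = S"
    using SK by (intro topspace_subtopology_subset) (simp add: topspace_K_space)
  have "p \<in> subtopology K S closure_of (Pt ` B)" if p: "p \<in> S" for p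
    unfolding in_closure_of topS
  proof (intro conjI allI impI, rule p, elim conjE)
    fix T assume T: "p \<in> T" "openin (subtopology K S) T"
    then obtain U where U: "openin K U" "T = U \<inter> S"
      unfolding openin_subtopology by blast
    show "\<exists>y. y \<in> Pt ` B \<and> y \<in> T"
    proof (cases "p \<in> Pt ` B")
      case False
      then obtain A where A: "p = Ell A" "A \<in> \<A>" "infinite (A \<inter> B)"
        using p by (auto simp: S_def L_def)
      then have "finite {x\<in>A. Pt x \<notin> U}"
        using U T(1) unfolding openin_K_iff by blast
      then have "infinite (A \<inter> B - {x\<in>A. Pt x \<notin> U})"
        using A(3) by (rule Diff_infinite_finite)
      then obtain x where "x \<in> A \<inter> B - {x\<in>A. Pt x \<notin> U}"
        using infinite_imp_nonempty by blast
      then show ?thesis using U(2) by (auto simp: S_def)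
    qed (use T in blast)
  qed
  then have "subtopology K S closure_of (Pt ` B) = topspace (subtopology K S)"
    using closure_of_subset_topspace[of "subtopology K S" "Pt ` B"] topS by blast
  then have "separable_space (subtopology K S)"
    unfolding separable_space_def topS using B(2)
    by (intro exI[of _ "Pt ` B"]) (auto simp: S_def)
  then have "second_countable (subtopology K S)"
    using assms SK unfolding monolithic_def topspace_K_space by blast
  then obtain \<B> where \<B>: "countable \<B>"
      "\<And>U p. openin (subtopology K S) U \<Longrightarrow> p \<in> U \<Longrightarrow> \<exists>V\<in>\<B>. p \<in> V \<and> V \<subseteq> U"
    unfolding second_countable_def by meson
  have "\<exists>V\<in>\<B>. Ell A \<in> V \<and> V \<subseteq> S \<inter> hat A" if "A \<in> L" for A
  proof (rule \<B>(2))
    have "openin K (hat A)"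
      using clopen_hat(1)[of A "{}"] that by (simp add: L_def)
    then show "openin (subtopology K S) (S \<inter> hat A)"
      by (rule openin_subtopology_Int2)
    show "Ell A \<in> S \<inter> hat A" using that by (simp add: S_def)
  qed
  then obtain V where V: "\<And>A. A \<in> L \<Longrightarrow> V A \<in> \<B> \<and> Ell A \<in> V A \<and> V A \<subseteq> S \<inter> hat A"
    by metis
  have "inj_on V L"
  proof (rule inj_onI)
    fix A A' assume "A \<in> L" "A' \<in> L" "V A = V A'"
    then have "Ell A \<in> hat A'" using V[of A] V[of A'] by blast
    then show "A = A'" by simp
  qed
  moreover have "countable (V ` L)"
    using V \<B>(1) by (meson countable_subset image_subsetI)
  ultimately have "countable L"
    using countable_image_inj_on by blast
  then show "countable {A\<in>\<A>. infinite (A \<inter> B)}"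
    by (simp add: L_def)
qed

section \<open>The weak Lindelof property implies local smallness\<close>

text \<open>
  The indicator of \<open>hat A\<close> plus a function on \<open>B\<close> which, in the enumeration \<open>e\<close>, steps down from
  $1/k$ to $1/(k+1)$ just after the \<open>k\<close>-th element of \<open>A \<inter> B\<close>. A value below \<open>1/k\<close> at \<open>x\<close> thus shows
  that at least \<open>k\<close> elements of \<open>A \<inter> B\<close> precede \<open>x\<close>, and at each of them the function is at least 1.
\<close>

definition staircase :: "('a \<Rightarrow> nat) \<Rightarrow> 'a set \<Rightarrow> 'a set \<Rightarrow> 'a kpoint \<Rightarrow> real" where
  "staircase e B A p = indicator (hat A) p +
     (case p of Pt x \<Rightarrow> if x \<in> B then 1 / (1 + real (card {y\<in>A \<inter> B. e y < e x})) else 0 | _ \<Rightarrow> 0)"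

text \<open>
  The descending part tends to 0 along \<open>B\<close> because \<open>A \<inter> B\<close> is infinite, so it is a null
  function.
\<close>

lemma staircase_in_E:
  assumes e: "inj_on e B" and B: "B \<subseteq> \<Union>\<A>" and A: "A \<in> \<A>" "infinite (A \<inter> B)"
  shows "staircase e B A \<in> E"
proof -
  define c where "c = (\<lambda>p. case p of Pt x \<Rightarrow>
      if x \<in> B then 1 / (1 + real (card {y\<in>A \<inter> B. e y < e x})) else 0 | _ \<Rightarrow> 0)"
  have c_small: "finite {x. \<epsilon> \<le> \<bar>c (Pt x)\<bar>}" if "\<epsilon> > 0" for \<epsilon>
  proof -
    note fin_below = finite_inj_nat_below[OF e]
    obtain k :: nat where k: "1 / \<epsilon> < real k"
      using reals_Archimedean2 by blast
    obtain F where F: "F \<subseteq> A \<inter> B" "finite F" "card F = k"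
      using infinite_arbitrarily_large[OF A(2)] by blast
    obtain n where n: "\<And>y. y \<in> F \<Longrightarrow> e y < n"
      using F(2) finite_nat_set_iff_bounded[of "e ` F"] by auto
    have "x \<in> B \<and> e x < n" if x: "\<epsilon> \<le> \<bar>c (Pt x)\<bar>" for x
    proof -
      have xB: "x \<in> B" using x \<open>\<epsilon> > 0\<close> by (auto simp: c_def split: if_splits)
      have "e x < n"
      proof (rule ccontr)
        assume "\<not> e x < n"
        then have "F \<subseteq> {y\<in>A \<inter> B. e y < e x}" using F(1) n by force
        moreover have "finite {y\<in>A \<inter> B. e y < e x}"
          by (rule finite_subset[OF _ fin_below[of "e x"]]) auto
        ultimately have "k \<le> card {y\<in>A \<inter> B. e y < e x}"
          using F(3) card_mono by blast
        then have "1 / \<epsilon> < 1 + real (card {y\<in>A \<inter> B. e y < e x})"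
          using k by linarith
        moreover have "\<epsilon> * (1 + real (card {y\<in>A \<inter> B. e y < e x})) \<le> 1"
          using x xB by (simp add: c_def field_simps)
        ultimately show False
          using \<open>\<epsilon> > 0\<close> by (simp add: field_simps)
      qed
      with xB show ?thesis by blast
    qed
    then have "{x. \<epsilon> \<le> \<bar>c (Pt x)\<bar>} \<subseteq> {y\<in>B. e y < n}" by blast
    then show ?thesis
      using fin_below by (rule finite_subset)
  qed
  have "c \<in> E"
    unfolding C_space_iff
  proof (intro conjI ballI allI impI)
    show "c p = 0" if "p \<notin> K_points \<A>" for p
      using that B by (auto simp: c_def split: kpoint.splits)
    have Ell: "c (Ell A') = 0" "c Infty = 0" for A' by (simp_all add: c_def)
    show "finite {x\<in>A'. \<epsilon> \<le> \<bar>c (Pt x) - c (Ell A')\<bar>}" if "\<epsilon> > 0" for A' \<epsilon>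
      using c_small[OF that] by (rule finite_subset[rotated]) (auto simp: Ell)
    fix \<epsilon> :: real assume \<epsilon>: "\<epsilon> > 0"
    have "{x. \<epsilon> \<le> \<bar>c (Pt x)\<bar>} \<subseteq> \<Union>\<A>"
      using B \<epsilon> by (auto simp: c_def split: if_splits)
    then obtain \<F> where \<F>: "finite \<F>" "\<F> \<subseteq> \<A>" "{x. \<epsilon> \<le> \<bar>c (Pt x)\<bar>} \<subseteq> \<Union>\<F>"
      using finite_subset_Union[OF c_small[OF \<epsilon>]] by blast
    have "\<bar>c p - c Infty\<bar> < \<epsilon>" if "p \<in> K_points \<A> - \<Union>(hat ` \<F>)" for p
    proof (cases p)
      case (Pt x)
      then have "x \<notin> \<Union>\<F>" using that by auto
      then have "\<not> \<epsilon> \<le> \<bar>c (Pt x)\<bar>" using \<F>(3) by blast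
      then show ?thesis using Pt Ell by simp
    qed (use Ell \<epsilon> in auto)
    with \<F> show "\<exists>\<F>. finite \<F> \<and> \<F> \<subseteq> \<A> \<and> (\<forall>p\<in>K_points \<A> - \<Union>(hat ` \<F>). \<bar>c p - c Infty\<bar> < \<epsilon>)"
      by blast
  qed
  then have "indicator (hat A) + c \<in> E"
    using hat_indicator_in_E[OF A(1)] by simp
  moreover have "staircase e B A = indicator (hat A) + c"
    by (rule ext) (simp add: staircase_def c_def)
  ultimately show ?thesis by simp
qed

lemma null_function_small:
  assumes "g \<in> E" "g Infty = 0" "\<And>A. A \<in> \<A> \<Longrightarrow> g (Ell A) = 0" "\<epsilon> > 0"
  shows "finite {x. \<epsilon> \<le> \<bar>g (Pt x)\<bar>}"
proof -
  obtain \<F> where \<F>: "finite \<F>" "\<F> \<subseteq> \<A>"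
      "\<And>p. p \<in> K_points \<A> - \<Union>(hat ` \<F>) \<Longrightarrow> \<bar>g p\<bar> < \<epsilon>"
    using E_at_Infty[OF assms(1,4)] assms(2) by auto
  have "{x. \<epsilon> \<le> \<bar>g (Pt x)\<bar>} \<subseteq> (\<Union>A\<in>\<F>. {x\<in>A. \<epsilon> \<le> \<bar>g (Pt x) - g (Ell A)\<bar>})"
  proof
    fix x assume x: "x \<in> {x. \<epsilon> \<le> \<bar>g (Pt x)\<bar>}"
    then have "g (Pt x) \<noteq> 0" using assms(4) by auto
    then have "Pt x \<in> K_points \<A>"
      using E_outside[OF assms(1)] by blast
    with x \<F>(3)[of "Pt x"] obtain A where A: "A \<in> \<F>" "x \<in> A" by fastforce
    then have "g (Ell A) = 0" using assms(3) \<F>(2) by blast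
    with x A show "x \<in> (\<Union>A\<in>\<F>. {x\<in>A. \<epsilon> \<le> \<bar>g (Pt x) - g (Ell A)\<bar>})"
      by auto
  qed
  moreover have "finite (\<Union>A\<in>\<F>. {x\<in>A. \<epsilon> \<le> \<bar>g (Pt x) - g (Ell A)\<bar>})"
    using \<F>(1,2) E_at_Ell[OF assms(1) _ assms(4)] by blast
  ultimately show ?thesis by (rule finite_subset)
qed

text \<open>
  Suppose that uncountably many \<open>A\<close> meet \<open>B\<close> in an infinite set, and let \<open>g\<close> be a point of
  accumulation of their staircase functions. At each $l_A$ at most one of these functions is
  nonzero, and at $\infty$ none is, so \<open>g\<close> vanishes at all these points and is a null function on
  the isolated points. Hence the set \<open>F\<close> where its modulus is at least $1/2$ is finite, while at some
  \<open>x \<in> B\<close> the modulus is below half of $1/(|F|+1)$. A staircase function close to \<open>g\<close> at \<open>x\<close> has more than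
  \<open>|F|\<close> elements of \<open>A \<inter> B\<close> before \<open>x\<close>, where it is at least 1. One of these lies outside \<open>F\<close>,
  where \<open>g\<close> is below $1/2$. So the staircase function is not close to \<open>g\<close> at the finitely many
  predecessors of \<open>x\<close>.
\<close>

theorem weakly_Lindelof_imp_locally_small:
  assumes "Lindelof_space (weak_topology E N)"
  shows "locally_small \<A>"
  unfolding locally_small_def
proof (intro allI impI, elim conjE, rule ccontr)
  fix B assume B: "B \<subseteq> \<Union>\<A>" "countable B"
  define L where "L = {A\<in>\<A>. infinite (A \<inter> B)}"
  assume "uncountable {A\<in>\<A>. infinite (A \<inter> B)}"
  then have unc: "uncountable L" by (simp add: L_def)
  obtain e :: "'a \<Rightarrow> nat" where e: "inj_on e B"
    using B(2) unfolding countable_def by blast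
  define s where "s = staircase e B"
  have s_Ell: "s A (Ell A') = (if A' = A then 1 else 0)" "s A Infty = 0" for A A'
    by (simp_all add: s_def staircase_def indicator_def)
  have s_E: "s A \<in> E" if "A \<in> L" for A
    using staircase_in_E[OF e B(1)] that by (auto simp: s_def L_def)
  have "inj_on s L"
  proof (rule inj_onI)
    fix A A' assume "s A = s A'"
    then have "s A (Ell A) = s A' (Ell A)" by simp
    then show "A = A'" by (simp add: s_Ell split: if_splits)
  qed
  then have "uncountable (s ` L)"
    using unc countable_image_inj_on by blast
  moreover have "s ` L \<subseteq> topspace (weak_topology E N)"
    using s_E by (auto simp: topspace_weak)
  ultimately obtain g where gE: "g \<in> E"
    and acc: "\<And>U. openin (weak_topology E N) U \<Longrightarrow> g \<in> U \<Longrightarrow> uncountable (U \<inter> s ` L)"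
    using Lindelof_uncountable_accumulation[OF assms] unfolding topspace_weak by blast
  have op: "openin (weak_topology E N) {f\<in>E. f p \<in> U}" if "open U" for p U
  proof -
    have "{f\<in>E. f p \<in> U} = {f\<in>E. eval_at p f \<in> U}" by (auto simp: eval_at_def)
    then show ?thesis using openin_weak[OF eval_at_dual that, of p] by simp
  qed
  have g_Ell: "g (Ell A) = 0" for A
  proof (rule ccontr)
    assume "g (Ell A) \<noteq> 0"
    then have "uncountable ({f\<in>E. f (Ell A) \<in> - {0}} \<inter> s ` L)"
      using gE by (intro acc op) auto
    moreover have "{f\<in>E. f (Ell A) \<in> - {0}} \<inter> s ` L \<subseteq> {s A}"
      by (auto simp: s_Ell split: if_splits)
    ultimately show False
      by (meson countable_empty countable_insert countable_subset)
  qed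
  have g_Infty: "g Infty = 0"
  proof (rule ccontr)
    assume "g Infty \<noteq> 0"
    then have "uncountable ({f\<in>E. f Infty \<in> - {0}} \<inter> s ` L)"
      using gE by (intro acc op) auto
    moreover have "{f\<in>E. f Infty \<in> - {0}} \<inter> s ` L = {}"
      by (auto simp: s_Ell)
    ultimately show False by simp
  qed
  note small = null_function_small[OF gE g_Infty g_Ell]
  note fin_below = finite_inj_nat_below[OF e]
  define F where "F = {x. 1 / 2 \<le> \<bar>g (Pt x)\<bar>}"
  have finF: "finite F" unfolding F_def by (rule small) simp
  define k where "k = real (card F) + 1"
  have k: "k > 0" by (simp add: k_def)
  have "infinite B"
  proof -
    have "L \<noteq> {}" using unc by auto
    then show ?thesis by (auto simp: L_def)
  qed
  then have "infinite (B - {x. 1 / (2 * k) \<le> \<bar>g (Pt x)\<bar>})"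
    using small[of "1 / (2 * k)"] k by (intro Diff_infinite_finite) auto
  then have "B - {x. 1 / (2 * k) \<le> \<bar>g (Pt x)\<bar>} \<noteq> {}"
    by (rule infinite_imp_nonempty)
  then obtain x where "x \<in> B - {x. 1 / (2 * k) \<le> \<bar>g (Pt x)\<bar>}"
    by blast
  then have x: "x \<in> B" "\<bar>g (Pt x)\<bar> < 1 / (2 * k)"
    by simp_all
  define Y where "Y = {y\<in>B. e y < e x} - F"
  have finY: "finite Y" unfolding Y_def using fin_below by blast
  \<comment> \<open>The intersection with \<open>E\<close> keeps the second factor open when \<open>Y\<close> is empty.\<close>
  define U where "U = {f\<in>E. f (Pt x) \<in> {..<1 / k}} \<inter> (E \<inter> (\<Inter>y\<in>Y. {f\<in>E. f (Pt y) \<in> {..<1}}))"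
  have "openin (weak_topology E N) U"
  proof -
    have "openin (weak_topology E N) (E \<inter> (\<Inter>y\<in>Y. {f\<in>E. f (Pt y) \<in> {..<1}}))"
    proof -
      have "openin (weak_topology E N) ((\<Inter>y\<in>Y. {f\<in>E. f (Pt y) \<in> {..<1}}) \<inter> topspace (weak_topology E N))"
        by (rule openin_INT[OF finY op]) simp
      then show ?thesis by (simp only: topspace_weak Int_commute)
    qed
    then show ?thesis
      unfolding U_def by (rule openin_Int[OF op[OF open_lessThan]])
  qed
  moreover have "g \<in> U"
  proof -
    have "1 / (2 * k) < 1 / k" using k by (simp add: field_simps)
    then have "g (Pt x) < 1 / k" using x(2) by linarith
    moreover have "g (Pt y) < 1" if "y \<in> Y" for y
      using that by (auto simp: Y_def F_def)
    ultimately show ?thesis unfolding U_def using gE by auto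
  qed
  ultimately have "uncountable (U \<inter> s ` L)" by (rule acc)
  then have "U \<inter> s ` L \<noteq> {}" by auto
  then obtain A where A: "A \<in> L" "s A \<in> U" by blast
  have "{y\<in>A \<inter> B. e y < e x} \<subseteq> F"
  proof
    fix y assume y: "y \<in> {y\<in>A \<inter> B. e y < e x}"
    show "y \<in> F"
    proof (rule ccontr)
      assume "y \<notin> F"
      then have "y \<in> Y" using y by (simp add: Y_def)
      then have "s A (Pt y) < 1" using A(2) by (simp add: U_def)
      moreover have "s A (Pt y) \<ge> 1" using y by (simp add: s_def staircase_def)
      ultimately show False by simp
    qed
  qed
  then have "real (card {y\<in>A \<inter> B. e y < e x}) \<le> real (card F)"
    using finF card_mono by auto
  then have "1 / k \<le> 1 / (1 + real (card {y\<in>A \<inter> B. e y < e x}))"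
    unfolding k_def by (intro divide_left_mono) auto
  also have "\<dots> \<le> s A (Pt x)"
    using x(1) by (simp add: s_def staircase_def)
  finally have "1 / k \<le> s A (Pt x)" .
  moreover have "s A (Pt x) < 1 / k" using A(2) by (simp add: U_def)
  ultimately show False by simp
qed

section \<open>Simple functions\<close>

definition simple_fns :: "('a kpoint \<Rightarrow> real) set" where
  "simple_fns = {q\<in>E. finite (range q) \<and> range q \<subseteq> \<rat>}"

lemma simple_in_E: "q \<in> simple_fns \<Longrightarrow> q \<in> E"
  by (simp add: simple_fns_def)

text \<open>
  Finitely many values have a positive minimal distance. Near $l_A$ and near $\infty$ a simple function
  is therefore constant, not only nearly constant.
\<close>

lemma simple_gap:
  assumes "q \<in> simple_fns"
  obtains \<epsilon> where "\<epsilon> > 0" "\<And>p p'. \<bar>q p - q p'\<bar> < \<epsilon> \<Longrightarrow> q p = q p'"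
proof -
  define D where "D = insert 1 ((\<lambda>(a, b). \<bar>a - b\<bar>) ` (range q \<times> range q) - {0})"
  have D: "finite D" "D \<noteq> {}" "\<And>d. d \<in> D \<Longrightarrow> d > 0"
    using assms by (auto simp: D_def simple_fns_def)
  have "q p = q p'" if "\<bar>q p - q p'\<bar> < Min D" for p p'
  proof (rule ccontr)
    assume "q p \<noteq> q p'"
    then have "\<bar>q p - q p'\<bar> \<in> D" by (force simp: D_def)
    then have "Min D \<le> \<bar>q p - q p'\<bar>" using D(1) by simp
    with that show False by simp
  qed
  then show ?thesis using that[of "Min D"] D by simp
qed

lemma simple_at_Ell:
  assumes "q \<in> simple_fns" "A \<in> \<A>"
  shows "finite {x\<in>A. q (Pt x) \<noteq> q (Ell A)}"
proof -
  obtain \<epsilon> where \<epsilon>: "\<epsilon> > 0" "\<And>p p'. \<bar>q p - q p'\<bar> < \<epsilon> \<Longrightarrow> q p = q p'"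
    by (rule simple_gap[OF assms(1)]) (rule that)
  have "{x\<in>A. q (Pt x) \<noteq> q (Ell A)} \<subseteq> {x\<in>A. \<epsilon> \<le> \<bar>q (Pt x) - q (Ell A)\<bar>}"
    using \<epsilon>(2) not_le by blast
  then show ?thesis
    using E_at_Ell[OF simple_in_E[OF assms(1)] assms(2) \<epsilon>(1)] by (rule finite_subset)
qed

lemma simple_at_Infty:
  assumes "q \<in> simple_fns"
  obtains \<F> where "finite \<F>" "\<F> \<subseteq> \<A>"
    "\<And>p. p \<in> K_points \<A> \<Longrightarrow> p \<notin> \<Union>(hat ` \<F>) \<Longrightarrow> q p = q Infty"
proof -
  obtain \<epsilon> where \<epsilon>: "\<epsilon> > 0" "\<And>p p'. \<bar>q p - q p'\<bar> < \<epsilon> \<Longrightarrow> q p = q p'"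
    by (rule simple_gap[OF assms(1)]) (rule that)
  obtain \<F> where \<F>: "finite \<F>" "\<F> \<subseteq> \<A>"
      "\<forall>p\<in>K_points \<A> - \<Union>(hat ` \<F>). \<bar>q p - q Infty\<bar> < \<epsilon>"
    using E_at_Infty[OF simple_in_E[OF assms(1)] \<epsilon>(1)] by (elim exE conjE) (rule that)
  show ?thesis
  proof (rule that[OF \<F>(1,2)])
    fix p assume "p \<in> K_points \<A>" "p \<notin> \<Union>(hat ` \<F>)"
    then have "\<bar>q p - q Infty\<bar> < \<epsilon>"
      by (intro bspec[OF \<F>(3)] DiffI)
    then show "q p = q Infty" by (rule \<epsilon>(2))
  qed
qed

lemma finite_simple_exceptional:
  assumes "q \<in> simple_fns"
  shows "finite {A\<in>\<A>. q (Ell A) \<noteq> q Infty}"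
proof -
  obtain \<F> where \<F>: "finite \<F>" "\<F> \<subseteq> \<A>"
    "\<And>p. p \<in> K_points \<A> \<Longrightarrow> p \<notin> \<Union>(hat ` \<F>) \<Longrightarrow> q p = q Infty"
    by (rule simple_at_Infty[OF assms]) (rule that)
  have "{A\<in>\<A>. q (Ell A) \<noteq> q Infty} \<subseteq> \<F>"
  proof (rule subsetI, rule ccontr)
    fix A assume A: "A \<in> {A\<in>\<A>. q (Ell A) \<noteq> q Infty}" "A \<notin> \<F>"
    then have "Ell A \<in> K_points \<A>" "Ell A \<notin> \<Union>(hat ` \<F>)" by auto
    then have "q (Ell A) = q Infty" by (rule \<F>(3))
    with A show False by simp
  qed
  then show ?thesis using \<F>(1) finite_subset by blast
qed

lemma simpleI:
  assumes "\<And>p. p \<notin> K_points \<A> \<Longrightarrow> q p = 0" "finite (range q)" "range q \<subseteq> \<rat>"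
    and ell: "\<And>A. A \<in> \<A> \<Longrightarrow> finite {x\<in>A. q (Pt x) \<noteq> q (Ell A)}"
    and \<F>: "finite \<F>" "\<F> \<subseteq> \<A>"
      "\<And>p. p \<in> K_points \<A> \<Longrightarrow> p \<notin> \<Union>(hat ` \<F>) \<Longrightarrow> q p = q Infty"
  shows "q \<in> simple_fns"
proof -
  have "finite {x\<in>A. e \<le> \<bar>q (Pt x) - q (Ell A)\<bar>}" if "A \<in> \<A>" "e > 0" for A e
    by (rule finite_subset[OF _ ell[OF that(1)]]) (use that(2) in auto)
  moreover have "\<exists>\<F>. finite \<F> \<and> \<F> \<subseteq> \<A> \<and> (\<forall>p\<in>K_points \<A> - \<Union>(hat ` \<F>). \<bar>q p - q Infty\<bar> < e)"
    if "e > 0" for e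
  proof (intro exI conjI ballI)
    fix p assume "p \<in> K_points \<A> - \<Union>(hat ` \<F>)"
    then have "q p = q Infty" by (intro \<F>(3)) auto
    then show "\<bar>q p - q Infty\<bar> < e" using that by simp
  qed (rule \<F>)+
  ultimately have "q \<in> E"
    unfolding C_space_iff using assms(1) by blast
  with assms show ?thesis by (simp add: simple_fns_def)
qed

lemma simple_add:
  assumes "f \<in> simple_fns" "g \<in> simple_fns"
  shows "f + g \<in> simple_fns"
proof -
  have "range (f + g) \<subseteq> (\<lambda>(a, b). a + b) ` (range f \<times> range g)"
    by auto
  moreover have "finite ((\<lambda>(a, b). a + b) ` (range f \<times> range g))"
    using assms by (simp add: simple_fns_def)
  ultimately have "finite (range (f + g))"
    by (rule finite_subset)
  moreover have "range (f + g) \<subseteq> \<rat>"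
    using assms by (simp add: simple_fns_def image_subset_iff)
  ultimately show ?thesis using assms by (simp add: simple_fns_def)
qed

lemma simple_diff:
  assumes "f \<in> simple_fns" "g \<in> simple_fns"
  shows "f - g \<in> simple_fns"
proof -
  have "range (-1 *\<^sub>R g) = uminus ` range g" by auto
  then have "-1 *\<^sub>R g \<in> simple_fns"
    using assms(2) E_closed(4)[of g "-1"] unfolding simple_fns_def
    by (auto simp del: scaleR_minus1_left scaleR_minus_left)
  with simple_add[OF assms(1)] show ?thesis by fastforce
qed

text \<open>
  A function takes only countably many values on \<open>K\<close>, because it equals $f(\infty)$ off a countable
  set. So some grid with rational mesh \<open>d\<close> and offset \<open>t\<close> misses all of them, and rounding down to
  this grid is continuous on the range of \<open>f\<close>.
\<close>

lemma simple_dense: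
  assumes f: "f \<in> E" and "\<epsilon> > 0"
  obtains q where "q \<in> simple_fns" "N (f - q) < \<epsilon>"
proof -
  obtain d where d: "d \<in> \<rat>" "0 < d" "d < \<epsilon> / 3"
    using Rats_dense_in_real[of 0 "\<epsilon> / 3"] \<open>\<epsilon> > 0\<close> by auto
  have "f ` K_points \<A> \<subseteq> insert (f Infty) (f ` {p\<in>K_points \<A>. f p \<noteq> f Infty})"
    by auto
  then have cf: "countable (f ` K_points \<A>)"
    by (rule countable_subset) (intro countable_insert countable_image countable_support f)
  define bad where "bad = (\<lambda>(y, m). y - d * of_int m) ` (f ` K_points \<A> \<times> (UNIV :: int set))"
  have "countable bad"
    unfolding bad_def by (intro countable_image[OF countable_SIGMA] cf countableI_type)
  moreover have "uncountable {0<..<d}"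
    using d(2) uncountable_open_interval by blast
  ultimately have "{0<..<d} - bad \<noteq> {}"
    by (metis Diff_eq_empty_iff countable_subset)
  then obtain t where "t \<in> {0<..<d} - bad" by blast
  then have t: "0 < t" "t < d" "t \<notin> bad" by simp_all
  define \<rho> where "\<rho> y = d * of_int \<lfloor>(y - t) / d\<rfloor>" for y
  define W where "W = {y. (y - t) / d \<notin> \<int>}"
  have fW: "f p \<in> W" if "p \<in> K_points \<A>" for p
  proof (rule ccontr)
    assume "f p \<notin> W"
    then obtain m :: int where "(f p - t) / d = of_int m" by (auto simp: W_def elim: Ints_cases)
    then have "t = f p - d * of_int m" using d(2) by (simp add: field_simps)
    then have "t \<in> bad" unfolding bad_def using that by (intro image_eqI[of _ _ "(f p, m)"]) auto
    with t(3) show False by simp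
  qed
  have "continuous_on W (\<lambda>y. (y - t) / d)"
    by (intro continuous_intros) (use d in auto)
  then have "continuous_on W (\<lambda>y. of_int \<lfloor>(y - t) / d\<rfloor> :: real)"
    using continuous_on_compose2[OF continuous_on_of_int_floor(1)[where 'a = real and 'b = real]]
    by (auto simp: W_def)
  then have "continuous_on W \<rho>"
    unfolding \<rho>_def by (rule continuous_on_mult[OF continuous_on_const])
  then have "continuous_map (top_of_set W) euclideanreal \<rho>"
    by simp
  moreover have "continuous_map K (top_of_set W) f"
    using f fW by (auto simp: continuous_map_in_subtopology C_space_def topspace_K_space)
  ultimately have cont: "continuous_map K euclideanreal (\<rho> \<circ> f)"
    using continuous_map_compose by blast
  define q where "q p = (if p \<in> K_points \<A> then \<rho> (f p) else 0)" for p
  have "continuous_map K euclideanreal q"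
    using cont by (rule continuous_map_eq) (simp add: q_def topspace_K_space)
  then have qE: "q \<in> E"
    by (simp add: C_space_def topspace_K_space q_def)
  obtain B where B: "\<And>p. \<bar>f p\<bar> \<le> B" using E_bounded[OF f] by blast
  have "range q \<subseteq> insert 0 ((\<lambda>m. d * of_int m) ` {\<lfloor>(- B - t) / d\<rfloor>..\<lfloor>(B - t) / d\<rfloor>})"
  proof
    fix y assume "y \<in> range q"
    then obtain p where p: "y = q p" by blast
    have "- B \<le> f p" "f p \<le> B" using B[of p] by linarith+
    then have "\<lfloor>(- B - t) / d\<rfloor> \<le> \<lfloor>(f p - t) / d\<rfloor>" "\<lfloor>(f p - t) / d\<rfloor> \<le> \<lfloor>(B - t) / d\<rfloor>"
      using d(2) by (auto intro!: floor_mono divide_right_mono)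
    then show "y \<in> insert 0 ((\<lambda>m. d * of_int m) ` {\<lfloor>(- B - t) / d\<rfloor>..\<lfloor>(B - t) / d\<rfloor>})"
      by (auto simp: p q_def \<rho>_def)
  qed
  then have "finite (range q)"
    by (rule finite_subset) simp
  moreover have "range q \<subseteq> \<rat>"
    using d(1) by (auto simp: q_def \<rho>_def)
  ultimately have "q \<in> simple_fns"
    using qE by (simp add: simple_fns_def)
  moreover have "N (f - q) \<le> 2 * d"
  proof -
    have "\<bar>f p - q p\<bar> \<le> 2 * d" for p
    proof (cases "p \<in> K_points \<A>")
      case False
      then show ?thesis using E_outside[OF f] d by (simp add: q_def)
    next
      case True
      define y where "y = (f p - t) / d"
      have fp: "f p = d * y + t" using d(2) by (simp add: y_def)
      have "f p - q p = d * (y - of_int \<lfloor>y\<rfloor>) + t"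
        using True fp by (simp add: q_def \<rho>_def y_def[symmetric] algebra_simps)
      moreover have "0 \<le> d * (y - of_int \<lfloor>y\<rfloor>)" "d * (y - of_int \<lfloor>y\<rfloor>) \<le> d * 1"
        using d(2) by (intro mult_nonneg_nonneg mult_left_mono; linarith)+
      ultimately show ?thesis using t d by linarith
    qed
    then show ?thesis using f qE by (simp add: N_le_iff)
  qed
  moreover have "2 * d < \<epsilon>" using d by simp
  ultimately show ?thesis using that by force
qed

lemma countable_members_meeting:
  assumes "locally_small \<A>" "countable T" "T \<subseteq> K_points \<A>"
  shows "countable {A\<in>\<A>. infinite {x\<in>A. Pt x \<in> T}}"
proof -
  define B where "B = {x. Pt x \<in> T}"
  have "countable B"
    unfolding B_def using assms(2) by (rule countable_Pt_preimage)
  moreover have "B \<subseteq> \<Union>\<A>"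
  proof
    fix x assume "x \<in> B"
    then have "Pt x \<in> K_points \<A>" using assms(3) by (auto simp: B_def)
    then show "x \<in> \<Union>\<A>" by simp
  qed
  moreover have "{x\<in>A. Pt x \<in> T} = A \<inter> B" for A
    by (auto simp: B_def)
  ultimately show ?thesis
    using assms(1) unfolding locally_small_def by simp
qed

text \<open>
  Only the sets in \<open>M\<close>, those represented in \<open>T\<close> by their point $l_A$ or by infinitely many of their
  elements, matter for the restriction to \<open>T\<close>, and local smallness makes \<open>M\<close> countable. Starting
  from the value at $\infty$ and correcting it by the jump of \<open>q\<close> on each of the finitely many relevant
  sets \<open>hat A\<close>, one obtains a function \<open>h\<close> that agrees with \<open>q\<close> on \<open>T\<close> except at finitely many
  points; almost disjointness keeps the overlaps of the corrections finite. So all restrictions lie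
  in the rational span of countably many indicator functions.
\<close>

lemma countable_simple_restrict:
  assumes ls: "locally_small \<A>" and T: "countable T" "T \<subseteq> K_points \<A>"
  shows "countable ((\<lambda>q p. if p \<in> T then q p else 0) ` simple_fns)"
proof -
  define M where "M = {A\<in>\<A>. Ell A \<in> T \<or> infinite {x\<in>A. Pt x \<in> T}}"
  have "countable ({A. Ell A \<in> T} \<union> {A\<in>\<A>. infinite {x\<in>A. Pt x \<in> T}})"
    using countable_Ell_preimage[OF T(1)] countable_members_meeting[OF ls T] by simp
  then have cM: "countable M"
    by (rule countable_subset[rotated]) (auto simp: M_def)
  define \<Gamma> :: "('a kpoint \<Rightarrow> real) set"
    where "\<Gamma> = indicator ` (insert T ((\<lambda>A. T \<inter> hat A) ` M) \<union> (\<lambda>p. {p}) ` T)"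
  have "countable \<Gamma>"
    unfolding \<Gamma>_def using cM T(1) by (intro countable_image countable_Un countable_insert)
  then have "countable (rat_span \<Gamma>)"
    by (rule countable_rat_span)
  moreover have "(\<lambda>p. if p \<in> T then q p else 0) \<in> rat_span \<Gamma>" if q: "q \<in> simple_fns" for q
  proof -
    define v where "v = q Infty"
    have rat: "q p \<in> \<rat>" for p using q by (auto simp: simple_fns_def)
    obtain \<H> where \<H>: "finite \<H>" "\<H> \<subseteq> \<A>"
      "\<And>p. p \<in> K_points \<A> \<Longrightarrow> p \<notin> \<Union>(hat ` \<H>) \<Longrightarrow> q p = v"
      by (rule simple_at_Infty[OF q, folded v_def]) (rule that)
    define \<F> where "\<F> = {A\<in>M. q (Ell A) \<noteq> v}"
    have FH: "\<F> \<subseteq> \<H>"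
    proof (rule subsetI, rule ccontr)
      fix A assume A: "A \<in> \<F>" "A \<notin> \<H>"
      then have "Ell A \<in> K_points \<A>" "Ell A \<notin> \<Union>(hat ` \<H>)"
        by (auto simp: \<F>_def M_def)
      then have "q (Ell A) = v" by (rule \<H>(3))
      with A show False by (simp add: \<F>_def)
    qed
    then have finF: "finite \<F>" using \<H>(1) finite_subset by blast
    define h :: "'a kpoint \<Rightarrow> real"
      where "h = v *\<^sub>R indicator T + (\<Sum>A\<in>\<F>. (q (Ell A) - v) *\<^sub>R indicator (T \<inter> hat A))"
    have sum_apply: "(\<Sum>A\<in>\<F>. g A) p = (\<Sum>A\<in>\<F>. g A p)" for g :: "'a set \<Rightarrow> 'a kpoint \<Rightarrow> real" and p
      by (induction \<F> rule: infinite_finite_induct) auto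
    have h_apply: "h p = v + (\<Sum>A\<in>\<F>. (q (Ell A) - v) * indicator (hat A) p)" if "p \<in> T" for p
      using that by (simp add: h_def sum_apply indicator_def)
    have h_single: "h p = q (Ell A)" if "p \<in> T" "p \<in> hat A" "A \<in> M" "\<And>B. B \<in> \<F> \<Longrightarrow> p \<in> hat B \<Longrightarrow> B = A" for p A
    proof -
      have "(\<Sum>B\<in>\<F>. (q (Ell B) - v) * indicator (hat B) p) =
          (\<Sum>B\<in>\<F>. if B = A then q (Ell A) - v else 0)"
      proof (rule sum.cong[OF refl])
        fix B assume B: "B \<in> \<F>"
        show "(q (Ell B) - v) * indicator (hat B) p = (if B = A then q (Ell A) - v else 0)"
        proof (cases "B = A")
          case False
          then have "p \<notin> hat B" using that(4)[OF B] by blast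
          with False show ?thesis by simp
        qed (use that(2) in simp)
      qed
      also have "\<dots> = (if A \<in> \<F> then q (Ell A) - v else 0)"
        using finF by simp
      also have "\<dots> = q (Ell A) - v"
        using that(3) by (simp add: \<F>_def)
      finally show ?thesis using h_apply[OF that(1)] by simp
    qed
    define W where "W = {p\<in>T. q p \<noteq> h p}"
    have "W \<subseteq> (\<Union>A\<in>\<H>. Pt ` {x\<in>A. Pt x \<in> T \<and> q (Pt x) \<noteq> h (Pt x)})"
    proof
      fix p assume p: "p \<in> W"
      then have pT: "p \<in> T" "q p \<noteq> h p" by (auto simp: W_def)
      have "p \<noteq> Ell A" for A
      proof
        assume "p = Ell A"
        then have "A \<in> M" using pT T(2) by (auto simp: M_def)
        then have "h p = q p" using \<open>p = Ell A\<close> pT by (subst h_single[of p A]) auto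
        with pT show False by simp
      qed
      moreover have "p \<in> \<Union>(hat ` \<H>)"
      proof (rule ccontr)
        assume no: "p \<notin> \<Union>(hat ` \<H>)"
        then have "(\<Sum>A\<in>\<F>. (q (Ell A) - v) * indicator (hat A) p) = 0"
          using FH by (intro sum.neutral) (auto simp: indicator_def)
        then have "h p = v" using h_apply[OF pT(1)] by simp
        moreover have "q p = v" using \<H>(3) no pT(1) T(2) by blast
        ultimately show False using pT by simp
      qed
      ultimately show "p \<in> (\<Union>A\<in>\<H>. Pt ` {x\<in>A. Pt x \<in> T \<and> q (Pt x) \<noteq> h (Pt x)})"
        using pT by (auto simp: hat_def)
    qed
    moreover have "finite {x\<in>A. Pt x \<in> T \<and> q (Pt x) \<noteq> h (Pt x)}" if A: "A \<in> \<H>" for A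
    proof (cases "A \<in> M")
      case False
      then have "finite {x\<in>A. Pt x \<in> T}" using A \<H>(2) by (auto simp: M_def)
      then show ?thesis by (rule finite_subset[rotated]) auto
    next
      case True
      have "{x\<in>A. Pt x \<in> T \<and> q (Pt x) \<noteq> h (Pt x)} \<subseteq>
          {x\<in>A. q (Pt x) \<noteq> q (Ell A)} \<union> (\<Union>B\<in>\<F> - {A}. A \<inter> B)"
      proof
        fix x assume x: "x \<in> {x\<in>A. Pt x \<in> T \<and> q (Pt x) \<noteq> h (Pt x)}"
        show "x \<in> {x\<in>A. q (Pt x) \<noteq> q (Ell A)} \<union> (\<Union>B\<in>\<F> - {A}. A \<inter> B)"
        proof (rule ccontr)
          assume "\<not> ?thesis"
          then have "q (Pt x) = q (Ell A)" "\<And>B. B \<in> \<F> \<Longrightarrow> x \<in> B \<Longrightarrow> B = A"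
            using x by blast+
          with x h_single[of "Pt x" A] True show False by simp
        qed
      qed
      moreover have "finite {x\<in>A. q (Pt x) \<noteq> q (Ell A)}"
        using simple_at_Ell[OF q] A \<H>(2) by blast
      moreover have "finite (\<Union>B\<in>\<F> - {A}. A \<inter> B)"
        using finF finite_Int[of A] FH \<H>(2) A by blast
      ultimately show ?thesis by (meson finite_UnI finite_subset)
    qed
    ultimately have finW: "finite W"
      using \<H>(1) by (meson finite_UN finite_imageI finite_subset)
    have "(\<lambda>p. if p \<in> T then q p else 0) = h + (\<Sum>w\<in>W. (q w - h w) *\<^sub>R indicator {w})"
    proof
      fix p
      have "(\<Sum>w\<in>W. (q w - h w) *\<^sub>R indicator {w}) p = (\<Sum>w\<in>W. ((q w - h w) *\<^sub>R indicator {w}) p)"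
        by (induction W rule: infinite_finite_induct) auto
      also have "\<dots> = (\<Sum>w\<in>W. if w = p then q p - h p else 0)"
        by (intro sum.cong) (auto simp: indicator_def)
      also have "\<dots> = (if p \<in> W then q p - h p else 0)"
        using finW by simp
      finally have eq: "(\<Sum>w\<in>W. (q w - h w) *\<^sub>R indicator {w}) p = (if p \<in> W then q p - h p else 0)" .
      show "(if p \<in> T then q p else 0) = (h + (\<Sum>w\<in>W. (q w - h w) *\<^sub>R indicator {w})) p"
      proof (cases "p \<in> T")
        case True
        then show ?thesis by (simp add: eq) (simp add: W_def)
      next
        case False
        then have "h p = 0" by (simp add: h_def sum_apply)
        with False show ?thesis by (simp add: eq) (simp add: W_def)
      qed
    qed
    also have "\<dots> \<in> rat_span \<Gamma>"
    proof (intro rat_span_add rat_span_sum)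
      have "h w \<in> \<rat>" if "w \<in> T" for w
        unfolding h_apply[OF that] v_def using rat
        by (intro Rats_add Rats_sum Rats_mult Rats_diff) (auto simp: indicator_def)
      then show "(q w - h w) *\<^sub>R indicator {w} \<in> rat_span \<Gamma>" if "w \<in> W" for w
        using that rat by (intro rat_span_base) (auto simp: W_def \<Gamma>_def)
      show "h \<in> rat_span \<Gamma>"
        unfolding h_def v_def using rat
        by (intro rat_span_add rat_span_sum rat_span_base) (auto simp: \<Gamma>_def \<F>_def)
    qed
    finally show ?thesis .
  qed
  ultimately show ?thesis
    by (meson countable_subset image_subsetI)
qed

section \<open>Local smallness implies controlled separable complementation\<close>

text \<open>
  A point \<open>x\<close> outside \<open>Y\<close> that belongs to some \<open>A \<in> L\<close> is moved to $l_A$ for the first such \<open>A\<close> in an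
  enumeration \<open>ix\<close> of \<open>L\<close>, all other points outside \<open>S\<close> are moved to $\infty$. Continuity of
  \<open>f \<circ> r\<close> at $l_A$ for \<open>A \<in> L\<close> holds because only finitely many sets precede \<open>A\<close>, and each of
  them meets \<open>A\<close> in a finite set. For \<open>A \<notin> L\<close>, the image of $l_A$ is $\infty$; the set \<open>A \<inter> Y\<close> is finite
  and the points of \<open>A\<close> outside \<open>Y\<close> go to $\infty$ or to points $l_B$, each of which is hit finitely
  often, and only finitely many $l_B$ have values far from $f(\infty)$.
\<close>

lemma countable_retract:
  assumes ls: "locally_small \<A>" and Y: "countable Y" "Y \<subseteq> \<Union>\<A>"
  defines "L \<equiv> {A\<in>\<A>. infinite (A \<inter> Y)}"
  defines "S \<equiv> insert Infty (Pt ` Y \<union> Ell ` L)"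
  obtains r where "\<And>p. r p \<in> S" "\<And>p. p \<in> S \<Longrightarrow> r p = p"
    "\<And>p. p \<notin> S \<Longrightarrow> r p = Infty \<or> (\<exists>A\<in>L. \<not> A \<subseteq> Y \<and> r p = Ell A)"
    "\<And>f. f \<in> E \<Longrightarrow> (\<lambda>p. if p \<in> K_points \<A> then f (r p) else 0) \<in> E"
proof -
  have "countable L" using ls Y by (simp add: locally_small_def L_def)
  define ix where "ix = to_nat_on L"
  have ix: "inj_on ix L" unfolding ix_def using \<open>countable L\<close> by (rule inj_on_to_nat_on)
  define sel where "sel x = arg_min ix (\<lambda>A. A \<in> L \<and> x \<in> A)" for x
  have sel: "sel x \<in> L" "x \<in> sel x" "ix (sel x) \<le> ix A" if "A \<in> L" "x \<in> A" for x A
    unfolding sel_def using arg_min_nat_lemma[of "\<lambda>A. A \<in> L \<and> x \<in> A" A ix] that by auto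
  define r where "r p = (case p of
      Pt x \<Rightarrow> if x \<in> Y then Pt x else if \<exists>A\<in>L. x \<in> A then Ell (sel x) else Infty
    | Ell A \<Rightarrow> if A \<in> L then Ell A else Infty
    | Infty \<Rightarrow> Infty)" for p
  have LA: "L \<subseteq> \<A>" by (auto simp: L_def)
  have "r p \<in> S" for p
    using sel by (auto simp: r_def S_def split: kpoint.split)
  moreover have "r p = p" if "p \<in> S" for p
    using that by (auto simp: r_def S_def)
  moreover have "r p = Infty \<or> (\<exists>A\<in>L. \<not> A \<subseteq> Y \<and> r p = Ell A)" if "p \<notin> S" for p
  proof (cases p)
    case (Pt x)
    then have x: "x \<notin> Y" using that by (auto simp: S_def)
    show ?thesis
    proof (cases "\<exists>A\<in>L. x \<in> A")
      case True
      then have "sel x \<in> L" "x \<in> sel x" using sel by blast+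
      with True x Pt show ?thesis by (auto simp: r_def)
    qed (use x Pt in \<open>auto simp: r_def\<close>)
  qed (use that in \<open>auto simp: r_def S_def\<close>)
  moreover have "(\<lambda>p. if p \<in> K_points \<A> then f (r p) else 0) \<in> E" (is "?g \<in> E") if f: "f \<in> E" for f
    unfolding C_space_iff
  proof (intro conjI allI ballI impI)
    fix A and e :: real assume A: "A \<in> \<A>" and e: "e > 0"
    have g_Pt: "?g (Pt x) = f (r (Pt x))" if "x \<in> A" for x
      using that A by auto
    have g_Ell: "?g (Ell A) = f (r (Ell A))" using A by simp
    show "finite {x\<in>A. e \<le> \<bar>?g (Pt x) - ?g (Ell A)\<bar>}"
    proof (cases "A \<in> L")
      case True
      define Bs where "Bs = {B\<in>L. ix B < ix A}"
      have "finite (ix ` Bs)"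
        by (rule finite_subset[of _ "{..<ix A}"]) (auto simp: Bs_def)
      then have finBs: "finite Bs"
        by (rule finite_imageD) (rule inj_on_subset[OF ix], auto simp: Bs_def)
      have "{x\<in>A. e \<le> \<bar>?g (Pt x) - ?g (Ell A)\<bar>} \<subseteq>
          {x\<in>A. e \<le> \<bar>f (Pt x) - f (Ell A)\<bar>} \<union> (\<Union>B\<in>Bs. A \<inter> B)"
      proof
        fix x assume x: "x \<in> {x\<in>A. e \<le> \<bar>?g (Pt x) - ?g (Ell A)\<bar>}"
        then have xA: "x \<in> A" by simp
        have "r (Ell A) = Ell A" using True by (simp add: r_def)
        then have big: "e \<le> \<bar>f (r (Pt x)) - f (Ell A)\<bar>"
          using x g_Pt[OF xA] g_Ell by simp
        show "x \<in> {x\<in>A. e \<le> \<bar>f (Pt x) - f (Ell A)\<bar>} \<union> (\<Union>B\<in>Bs. A \<inter> B)"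
        proof (cases "x \<in> Y")
          case True
          then show ?thesis using xA big by (simp add: r_def)
        next
          case False
          then have "r (Pt x) = Ell (sel x)" using xA \<open>A \<in> L\<close> by (auto simp: r_def)
          with big e have "sel x \<noteq> A" by auto
          moreover have "sel x \<in> L" "x \<in> sel x" "ix (sel x) \<le> ix A"
            using sel[OF \<open>A \<in> L\<close> xA] by auto
          ultimately have "sel x \<in> Bs"
            using ix \<open>A \<in> L\<close> by (auto simp: Bs_def inj_on_def order.order_iff_strict)
          then show ?thesis using xA \<open>x \<in> sel x\<close> by blast
        qed
      qed
      moreover have "finite (\<Union>B\<in>Bs. A \<inter> B)"
      proof (rule finite_UN_I[OF finBs])
        fix B assume "B \<in> Bs"
        then show "finite (A \<inter> B)" using finite_Int[OF A] LA by (auto simp: Bs_def)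
      qed
      ultimately show ?thesis
        using E_at_Ell[OF f A e] by (meson finite_UnI finite_subset)
    next
      case False
      obtain \<F> where \<F>: "finite \<F>" "\<F> \<subseteq> \<A>"
          "\<forall>p\<in>K_points \<A> - \<Union>(hat ` \<F>). \<bar>f p - f Infty\<bar> < e"
        using E_at_Infty[OF f e] by (elim exE conjE) (rule that)
      have "{x\<in>A. e \<le> \<bar>?g (Pt x) - ?g (Ell A)\<bar>} \<subseteq> (A \<inter> Y) \<union> (\<Union>B\<in>\<F> - {A}. A \<inter> B)"
      proof
        fix x assume x: "x \<in> {x\<in>A. e \<le> \<bar>?g (Pt x) - ?g (Ell A)\<bar>}"
        then have xA: "x \<in> A" by simp
        have "r (Ell A) = Infty" using False by (simp add: r_def)
        then have big: "e \<le> \<bar>f (r (Pt x)) - f Infty\<bar>"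
          using x g_Pt[OF xA] g_Ell by simp
        show "x \<in> (A \<inter> Y) \<union> (\<Union>B\<in>\<F> - {A}. A \<inter> B)"
        proof (cases "x \<in> Y")
          case True
          then show ?thesis using xA by blast
        next
          case False
          have ex: "\<exists>B\<in>L. x \<in> B"
          proof (rule ccontr)
            assume "\<not> ?thesis"
            then have "r (Pt x) = Infty" using False by (simp add: r_def)
            with big e show False by simp
          qed
          then have s: "sel x \<in> L" "x \<in> sel x" using sel by blast+
          have "r (Pt x) = Ell (sel x)" using False ex by (simp add: r_def)
          with big have "\<not> \<bar>f (Ell (sel x)) - f Infty\<bar> < e" by simp
          moreover have "Ell (sel x) \<in> K_points \<A>" using s LA by auto
          ultimately have "Ell (sel x) \<in> \<Union>(hat ` \<F>)" using \<F>(3) by blast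
          then have "sel x \<in> \<F>" by auto
          then show ?thesis using s xA \<open>A \<notin> L\<close> by blast
        qed
      qed
      moreover have "finite (A \<inter> Y)" using False A by (simp add: L_def)
      moreover have "finite (\<Union>B\<in>\<F> - {A}. A \<inter> B)"
        using \<F>(1,2) finite_Int[OF A] by blast
      ultimately show ?thesis by (meson finite_UnI finite_subset)
    qed
  next
    fix e :: real assume e: "e > 0"
    obtain \<F> where \<F>: "finite \<F>" "\<F> \<subseteq> \<A>"
        "\<forall>p\<in>K_points \<A> - \<Union>(hat ` \<F>). \<bar>f p - f Infty\<bar> < e"
      using E_at_Infty[OF f e] by (elim exE conjE) (rule that)
    have "\<bar>?g p - ?g Infty\<bar> < e" if p: "p \<in> K_points \<A> - \<Union>(hat ` \<F>)" for p
    proof -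
      have "r p = Infty \<or> r p \<in> K_points \<A> - \<Union>(hat ` \<F>)"
      proof (cases p)
        case (Pt x)
        show ?thesis
        proof (cases "x \<in> Y \<or> \<not> (\<exists>A\<in>L. x \<in> A)")
          case True
          then show ?thesis using p Pt by (auto simp: r_def)
        next
          case False
          then have s: "sel x \<in> L" "x \<in> sel x" using sel by blast+
          then have "sel x \<notin> \<F>" using p Pt by auto
          moreover have "r p = Ell (sel x)" using False Pt by (auto simp: r_def)
          ultimately show ?thesis using s LA by auto
        qed
      qed (use p in \<open>auto simp: r_def\<close>)
      then have "\<bar>f (r p) - f Infty\<bar> < e" using \<F>(3) e by auto
      then show ?thesis using p by (simp add: r_def)
    qed
    with \<F> show "\<exists>\<F>. finite \<F> \<and> \<F> \<subseteq> \<A> \<and> (\<forall>p\<in>K_points \<A> - \<Union>(hat ` \<F>). \<bar>?g p - ?g Infty\<bar> < e)"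
      by blast
  qed simp
  ultimately show ?thesis by (rule that)
qed

text \<open>
  \<open>T\<close> collects the supports of a dense sequence of functions in \<open>F\<close> and of a dense sequence of
  functionals in \<open>G\<close>, and \<open>Y\<close> consists of the isolated points in \<open>T\<close> and of all elements of the
  sets \<open>A\<close> with $l_A$ in \<open>T\<close>. If the retraction moves a point to $l_A$, then \<open>A\<close> is not
  contained in \<open>Y\<close>, so $l_A$ is not in \<open>T\<close> and the functions of the dense sequence take the same
  value at $l_A$ as at $\infty$. Hence the projection fixes these functions, and by density all of
  \<open>F\<close>; in the same way it fixes \<open>G\<close>.
\<close>

theorem locally_small_imp_controlled_SCP:
  assumes ls: "locally_small \<A>"
  shows "controlled_SCP E N"
  unfolding controlled_SCP_def
proof (intro allI impI, elim conjE)
  fix F G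
  assume F: "F \<subseteq> E" "separable_space (subtopology (norm_topology E N) F)"
    and G: "G \<subseteq> dual E N"
      "separable_space (subtopology (norm_topology (dual E N) (dual_norm E N)) G)"
  interpret dual: normed_carrier "dual E N" "dual_norm E N"
    by (rule normed_carrier_dual)
  obtain D where D: "countable D" "D \<subseteq> F" "\<forall>f\<in>F. \<forall>e>0. \<exists>d\<in>D. N (f - d) < e"
    using F(2) unfolding separable_norm_topology_iff[OF F(1)] by (elim exE conjE) (rule that)
  obtain \<Phi> where \<Phi>: "countable \<Phi>" "\<Phi> \<subseteq> G" "\<forall>\<phi>\<in>G. \<forall>e>0. \<exists>\<psi>\<in>\<Phi>. dual_norm E N (\<phi> - \<psi>) < e"
    using G(2) unfolding dual.separable_norm_topology_iff[OF G(1)] by (elim exE conjE) (rule that)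
  have "\<exists>C. countable C \<and> C \<subseteq> K_points \<A> \<and> (\<forall>f\<in>E. (\<forall>p\<in>C. f p = 0) \<longrightarrow> \<phi> f = 0)"
    if "\<phi> \<in> \<Phi>" for \<phi>
    using that \<Phi>(2) G(1) by (intro dual_countably_determined) auto
  then obtain C where C: "\<And>\<phi>. \<phi> \<in> \<Phi> \<Longrightarrow> countable (C \<phi>)" "\<And>\<phi>. \<phi> \<in> \<Phi> \<Longrightarrow> C \<phi> \<subseteq> K_points \<A>"
      "\<And>\<phi> f. \<phi> \<in> \<Phi> \<Longrightarrow> f \<in> E \<Longrightarrow> (\<forall>p\<in>C \<phi>. f p = 0) \<Longrightarrow> \<phi> f = 0"
    by metis
  define T where "T = (\<Union>f\<in>D. {p\<in>K_points \<A>. f p \<noteq> f Infty}) \<union> (\<Union>\<phi>\<in>\<Phi>. C \<phi>)"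
  have T: "countable T" "T \<subseteq> K_points \<A>"
  proof -
    have "countable {p\<in>K_points \<A>. f p \<noteq> f Infty}" if "f \<in> D" for f
      using that D(2) F(1) countable_support by blast
    then show "countable T"
      unfolding T_def using D(1) \<Phi>(1) C(1) by (intro countable_Un countable_UN)
    show "T \<subseteq> K_points \<A>" unfolding T_def using C(2) by blast
  qed
  define Y where "Y = {x. Pt x \<in> T} \<union> \<Union>{A. Ell A \<in> T}"
  have Y: "countable Y" "Y \<subseteq> \<Union>\<A>"
  proof -
    note c = countable_Pt_preimage[OF T(1)] countable_Ell_preimage[OF T(1)]
    have AA: "A \<in> \<A>" if "Ell A \<in> T" for A
      using that T(2) by (metis K_points_simps(2) subsetD)
    have "countable (\<Union>A\<in>{A. Ell A \<in> T}. A)"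
      using AA countable_members by (intro countable_UN c(2)) auto
    with c(1) show "countable Y"
      unfolding Y_def by simp
    show "Y \<subseteq> \<Union>\<A>"
      unfolding Y_def
    proof (rule Un_least)
      show "{x. Pt x \<in> T} \<subseteq> \<Union>\<A>"
      proof
        fix x assume "x \<in> {x. Pt x \<in> T}"
        then have "Pt x \<in> K_points \<A>" using T(2) by blast
        then show "x \<in> \<Union>\<A>" by (simp only: K_points_simps)
      qed
      show "\<Union>{A. Ell A \<in> T} \<subseteq> \<Union>\<A>"
        using AA by (intro Union_mono) auto
    qed
  qed
  define L where "L = {A\<in>\<A>. infinite (A \<inter> Y)}"
  define S where "S = insert Infty (Pt ` Y \<union> Ell ` L)"
  obtain r where r: "\<And>p. r p \<in> S" "\<And>p. p \<in> S \<Longrightarrow> r p = p"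
    "\<And>p. p \<notin> S \<Longrightarrow> r p = Infty \<or> (\<exists>A\<in>L. \<not> A \<subseteq> Y \<and> r p = Ell A)"
    "\<And>f. f \<in> E \<Longrightarrow> (\<lambda>p. if p \<in> K_points \<A> then f (r p) else 0) \<in> E"
    by (rule countable_retract[OF ls Y, folded L_def, folded S_def]) (rule that)
  have SK: "S \<subseteq> K_points \<A>"
    using Y(2) unfolding S_def L_def K_points_def by blast
  have "countable L" using ls Y by (simp add: locally_small_def L_def)
  then have cS: "countable S" unfolding S_def using Y(1) by simp
  have TS: "T \<subseteq> S"
  proof
    fix p assume p: "p \<in> T"
    show "p \<in> S"
    proof (cases p)
      case (Pt x)
      then show ?thesis using p by (auto simp: S_def Y_def)
    next
      case (Ell A)
      then have "A \<in> \<A>" using p T(2) by auto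
      moreover have "A \<inter> Y = A" using p Ell by (auto simp: Y_def)
      ultimately show ?thesis using infinite_member Ell by (auto simp: S_def L_def)
    qed (simp add: S_def)
  qed
  define P where "P f = (\<lambda>p. if p \<in> K_points \<A> then f (r p) else 0)" for f :: "'a kpoint \<Rightarrow> real"
  have PE: "P f \<in> E" if "f \<in> E" for f
    using r(4)[OF that] by (simp add: P_def)
  have P_diff: "P f - P g = P (f - g)" for f g
    by (rule ext) (simp add: P_def)
  have P_norm: "N (P f) \<le> N f" if "f \<in> E" for f
    using abs_le_N[OF that] N_ge_0[OF that] PE[OF that] by (simp add: N_le_iff P_def)
  have P_idem: "P (P f) = P f" for f
    by (rule ext) (use r(1,2) SK in \<open>auto simp: P_def\<close>)
  have proj: "is_projection E N P"
    unfolding is_projection_def bounded_linear_map_def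
  proof (intro conjI ballI allI exI[of _ 1])
    show "P (f + g) = P f + P g" for f g by (rule ext) (simp add: P_def)
    show "P (c *\<^sub>R f) = c *\<^sub>R P f" for c f by (rule ext) (simp add: P_def)
  qed (use PE P_norm P_idem in auto)
  have PD: "d (r p) = d p" if d: "d \<in> D" and p: "p \<in> K_points \<A>" for d p
  proof (cases "p \<in> S")
    case True
    then show ?thesis using r(2) by simp
  next
    case False
    then have "p \<notin> T" using TS by blast
    then have "d p = d Infty" using d p unfolding T_def by blast
    moreover have "d (r p) = d Infty"
    proof (cases "r p = Infty")
      case False
      then obtain A where A: "A \<in> L" "\<not> A \<subseteq> Y" "r p = Ell A"
        using r(3)[OF \<open>p \<notin> S\<close>] by blast
      then have "Ell A \<notin> T" by (auto simp: Y_def)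
      moreover have "Ell A \<in> K_points \<A>" using A(1) by (simp add: L_def)
      ultimately show ?thesis using d A(3) unfolding T_def by auto
    qed simp
    ultimately show ?thesis by simp
  qed
  have "f \<in> P ` E" if f: "f \<in> F" for f
  proof -
    have fE: "f \<in> E" using f F(1) by blast
    have "f p = P f p" for p
    proof (cases "p \<in> K_points \<A>")
      case False
      then show ?thesis using E_outside[OF fE] by (simp add: P_def)
    next
      case True
      have "\<bar>f p - f (r p)\<bar> \<le> 0 + e" if "e > 0" for e
      proof -
        obtain d where d: "d \<in> D" "N (f - d) < e / 2"
          using D(3) f \<open>e > 0\<close> by (meson half_gt_zero)
        have "f - d \<in> E" using fE d(1) D(2) F(1) by auto
        then have "\<bar>(f - d) p\<bar> < e / 2" "\<bar>(f - d) (r p)\<bar> < e / 2"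
          using abs_le_N[of "f - d"] d(2) by (meson order_le_less_trans)+
        then have "\<bar>f p - d p\<bar> < e / 2" "\<bar>f (r p) - d (r p)\<bar> < e / 2" by simp_all
        then show ?thesis using PD[OF d(1) True] by linarith
      qed
      then have "\<bar>f p - f (r p)\<bar> \<le> 0" by (rule field_le_epsilon)
      then show ?thesis using True by (simp add: P_def)
    qed
    then have "f = P f" by blast
    then show ?thesis using fE by blast
  qed
  moreover have "\<phi> \<in> adjoint_map E P ` dual E N" if \<phi>: "\<phi> \<in> G" for \<phi>
  proof -
    have \<phi>d: "\<phi> \<in> dual E N" using \<phi> G(1) by blast
    have invariant: "\<psi> (P f) = \<psi> f" if "\<psi> \<in> \<Phi>" "f \<in> E" for \<psi> f
    proof -
      have "\<psi> \<in> dual E N" using that(1) \<Phi>(2) G(1) by blast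
      moreover have "\<psi> (f - P f) = 0"
      proof (rule C(3)[OF that(1)])
        show "f - P f \<in> E" using that PE by simp
        show "\<forall>p\<in>C \<psi>. (f - P f) p = 0"
        proof
          fix p assume "p \<in> C \<psi>"
          then have "p \<in> S" "p \<in> K_points \<A>"
            using that(1) C(2) TS unfolding T_def by blast+
          then show "(f - P f) p = 0" using r(2) by (simp add: P_def)
        qed
      qed
      ultimately show ?thesis using dual_linear(3)[of \<psi> f "P f"] that(2) PE by simp
    qed
    have "\<phi> f = \<phi> (P f)" if f: "f \<in> E" for f
    proof -
      have "\<bar>\<phi> f - \<phi> (P f)\<bar> \<le> 0 + e" if "e > 0" for e
      proof -
        define c where "c = e / (2 * (N f + 1))"
        have "c > 0" using \<open>e > 0\<close> N_ge_0[OF f] by (simp add: c_def)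
        then obtain \<psi> where \<psi>: "\<psi> \<in> \<Phi>" "dual_norm E N (\<phi> - \<psi>) < c"
          using \<Phi>(3) \<phi> by blast
        have d: "\<phi> - \<psi> \<in> dual E N"
          using \<phi>d \<psi>(1) \<Phi>(2) G(1) by (intro dual.E_closed(3)) auto
        have bound: "\<bar>(\<phi> - \<psi>) g\<bar> \<le> e / 2" if "g \<in> E" "N g \<le> N f" for g
        proof -
          have "\<bar>(\<phi> - \<psi>) g\<bar> \<le> dual_norm E N (\<phi> - \<psi>) * N g"
            by (rule dual_norm_bound[OF d that(1)])
          also have "\<dots> \<le> c * (N f + 1)"
            using \<psi>(2) that N_ge_0[OF that(1)] \<open>c > 0\<close> by (intro mult_mono) auto
          also have "\<dots> = e / 2" using N_ge_0[OF f] by (simp add: c_def field_simps)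
          finally show ?thesis .
        qed
        have "\<bar>\<phi> f - \<psi> f\<bar> \<le> e / 2" "\<bar>\<phi> (P f) - \<psi> (P f)\<bar> \<le> e / 2"
          using bound[OF f order_refl] bound[OF PE[OF f] P_norm[OF f]] by simp_all
        then show ?thesis using invariant[OF \<psi>(1) f] by linarith
      qed
      then have "\<bar>\<phi> f - \<phi> (P f)\<bar> \<le> 0" by (rule field_le_epsilon)
      then show ?thesis by simp
    qed
    then have "\<phi> = adjoint_map E P \<phi>"
      using dual_linear(5)[OF \<phi>d] by (auto simp: adjoint_map_def)
    then show ?thesis using \<phi>d by blast
  qed
  moreover have "separable_space (subtopology (norm_topology E N) (P ` E))"
  proof -
    have sub: "P ` E \<subseteq> E" using PE by blast
    define R where "R h = (\<lambda>p. if p \<in> K_points \<A> then h (r p) else 0)" for h :: "'a kpoint \<Rightarrow> real"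
    have "P q = R (\<lambda>p. if p \<in> S then q p else 0)" for q
      by (rule ext) (simp add: P_def R_def r(1))
    then have "P ` simple_fns = R ` (\<lambda>q p. if p \<in> S then q p else 0) ` simple_fns"
      unfolding image_image by (intro image_cong refl)
    then have "countable (P ` simple_fns)"
      using countable_image[OF countable_simple_restrict[OF ls cS SK], of R] by simp
    moreover have "\<exists>h\<in>P ` simple_fns. N (g - h) < e" if g: "g \<in> P ` E" and e: "e > 0" for g e
    proof -
      obtain f where f: "f \<in> E" "g = P f" using g by blast
      obtain q where q: "q \<in> simple_fns" "N (f - q) < e"
        by (rule simple_dense[OF f(1) e]) (rule that)
      have "N (g - P q) \<le> N (f - q)"
        unfolding f(2) P_diff using f(1) q(1) simple_in_E by (intro P_norm) auto
      then have "N (g - P q) < e" using q(2) by simp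
      then show ?thesis using q(1) by blast
    qed
    ultimately show ?thesis
      unfolding separable_norm_topology_iff[OF sub] using simple_in_E
      by (intro exI[of _ "P ` simple_fns"] conjI ballI allI impI) auto
  qed
  ultimately show "\<exists>P. is_projection E N P \<and> F \<subseteq> P ` E \<and> G \<subseteq> adjoint_map E P ` dual E N \<and>
      separable_space (subtopology (norm_topology E N) (P ` E))"
    using proj by (intro exI[of _ P] conjI subsetI)
qed

section \<open>Local smallness implies the weak Lindelof property\<close>

text \<open>
  Supports are taken relative to the value at $\infty$: off \<open>T\<close> these functions are constant.
\<close>

definition supp_in :: "'a kpoint set \<Rightarrow> ('a kpoint \<Rightarrow> real) set" where
  "supp_in T = {q\<in>simple_fns. \<forall>p\<in>K_points \<A> - T. q p = q Infty}"

lemma countable_supp_in: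
  assumes "locally_small \<A>" "countable T" "T \<subseteq> K_points \<A>" "Infty \<in> T"
  shows "countable (supp_in T)"
proof (rule countable_image_inj_on)
  show "inj_on (\<lambda>q p. if p \<in> T then q p else 0) (supp_in T)"
  proof (rule inj_onI)
    fix q q' assume q: "q \<in> supp_in T" "q' \<in> supp_in T"
      and eq: "(\<lambda>p. if p \<in> T then q p else 0) = (\<lambda>p. if p \<in> T then q' p else 0)"
    have on_T: "q p = q' p" if "p \<in> T" for p
      using fun_cong[OF eq, of p] that by simp
    have qE: "q \<in> E" "q' \<in> E" using q by (auto simp: supp_in_def simple_fns_def)
    show "q = q'"
    proof
      fix p
      consider "p \<in> T" | "p \<in> K_points \<A> - T" | "p \<notin> K_points \<A>" by blast
      then show "q p = q' p"
      proof cases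
        case 2
        then have "q p = q Infty" "q' p = q' Infty" using q by (auto simp: supp_in_def)
        then show ?thesis using on_T assms(4) by simp
      next
        case 3
        then show ?thesis using E_outside[OF qE(1)] E_outside[OF qE(2)] by simp
      qed (rule on_T)
    qed
  qed
  show "countable ((\<lambda>q p. if p \<in> T then q p else 0) ` supp_in T)"
    using countable_simple_restrict[OF assms(1-3)]
    by (rule countable_subset[rotated]) (auto simp: supp_in_def)
qed

definition closed_off :: "(('a kpoint \<Rightarrow> real) \<Rightarrow> 'a kpoint set) \<Rightarrow> 'a kpoint set \<Rightarrow> bool" where
  "closed_off C T \<longleftrightarrow> countable T \<and> T \<subseteq> K_points \<A> \<and> Infty \<in> T \<and>
     (\<forall>A. Ell A \<in> T \<longrightarrow> hat A \<subseteq> T) \<and> (\<forall>q\<in>supp_in T. C q \<subseteq> T)"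

text \<open>
  Iterating \<open>step\<close> countably often suffices, although \<open>supp_in\<close> refers to all simple functions
  that live on the limit \<open>T'\<close>: such a function differs from its value at $\infty$ only on finitely
  many sets \<open>hat A\<close> with $l_A$ in \<open>T'\<close> and at finitely many further points, so it already lives on
  one of the stages.
\<close>

lemma closed_off_exists:
  assumes ls: "locally_small \<A>"
    and C: "\<And>q. q \<in> simple_fns \<Longrightarrow> countable (C q)" "\<And>q. q \<in> simple_fns \<Longrightarrow> C q \<subseteq> K_points \<A>"
    and T0: "countable T0" "T0 \<subseteq> K_points \<A>"
  shows "\<exists>T. T0 \<subseteq> T \<and> closed_off C T"
proof -
  define step where "step T = T \<union> \<Union>(hat ` {A. Ell A \<in> T}) \<union> \<Union>(C ` supp_in T)" for T
  define T where "T n = (step ^^ n) (insert Infty T0)" for n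
  have T_Suc: "T (Suc n) = step (T n)" for n by (simp add: T_def)
  have T: "countable (T n) \<and> T n \<subseteq> K_points \<A> \<and> Infty \<in> T n" for n
  proof (induction n)
    case 0
    then show ?case using T0 by (simp add: T_def)
  next
    case (Suc n)
    have AA: "A \<in> \<A>" if "Ell A \<in> T n" for A
      using that Suc by (metis K_points_simps(2) subsetD)
    have "countable {A. Ell A \<in> T n}"
      using Suc by (simp add: countable_Ell_preimage)
    then have "countable (\<Union>(hat ` {A. Ell A \<in> T n}))"
      using AA countable_hat by (intro countable_UN) auto
    moreover have "countable (\<Union>(C ` supp_in (T n)))"
      using C(1) countable_supp_in[OF ls] Suc by (intro countable_UN) (auto simp: supp_in_def)
    moreover have "\<Union>(hat ` {A. Ell A \<in> T n}) \<subseteq> K_points \<A>"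
      using AA hat_subset by blast
    moreover have "\<Union>(C ` supp_in (T n)) \<subseteq> K_points \<A>"
      using C(2) by (force simp: supp_in_def)
    ultimately show ?case using Suc by (simp add: T_Suc step_def)
  qed
  have T_mono: "T m \<subseteq> T n" if "m \<le> n" for m n
    by (rule lift_Suc_mono_le[OF _ that]) (auto simp: T_Suc step_def)
  define T' where "T' = (\<Union>n. T n)"
  have hat_T': "hat A \<subseteq> T (Suc n)" if "Ell A \<in> T n" for A n
    using that by (auto simp: T_Suc step_def)
  have "C q \<subseteq> T'" if q: "q \<in> supp_in T'" for q
  proof -
    have qs: "q \<in> simple_fns" and off: "\<And>p. p \<in> K_points \<A> \<Longrightarrow> q p \<noteq> q Infty \<Longrightarrow> p \<in> T'"
      using q by (auto simp: supp_in_def)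
    obtain \<F> where \<F>: "finite \<F>" "\<F> \<subseteq> \<A>"
      "\<And>p. p \<in> K_points \<A> \<Longrightarrow> p \<notin> \<Union>(hat ` \<F>) \<Longrightarrow> q p = q Infty"
      by (rule simple_at_Infty[OF qs]) (rule that)
    have "\<exists>n. \<forall>p\<in>hat A. q p \<noteq> q Infty \<longrightarrow> p \<in> T n" if A: "A \<in> \<F>" for A
    proof (cases "q (Ell A) = q Infty")
      case False
      then have "Ell A \<in> T'" using off[of "Ell A"] A \<F>(2) by auto
      then obtain n where "Ell A \<in> T n" by (auto simp: T'_def)
      then show ?thesis using hat_T' by blast
    next
      case True
      define F where "F = {x\<in>A. q (Pt x) \<noteq> q (Ell A)}"
      have "finite F" unfolding F_def using simple_at_Ell[OF qs] A \<F>(2) by blast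
      have "\<exists>n. Pt x \<in> T n" if "x \<in> F" for x
      proof -
        have "Pt x \<in> K_points \<A>" "q (Pt x) \<noteq> q Infty"
          using that A \<F>(2) True by (auto simp: F_def)
        then have "Pt x \<in> T'" by (rule off)
        then show ?thesis by (auto simp: T'_def)
      qed
      then obtain k where k: "\<And>x. x \<in> F \<Longrightarrow> Pt x \<in> T (k x)" by metis
      have "Pt x \<in> T (sum k F)" if "x \<in> F" for x
        using k[OF that] T_mono[OF member_le_sum[OF that, of k]] \<open>finite F\<close> by auto
      then show ?thesis
        using True by (intro exI[of _ "sum k F"]) (auto simp: hat_def F_def)
    qed
    then obtain k where k: "\<And>A p. A \<in> \<F> \<Longrightarrow> p \<in> hat A \<Longrightarrow> q p \<noteq> q Infty \<Longrightarrow> p \<in> T (k A)"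
      by metis
    define n where "n = sum k \<F>"
    have "p \<in> T n" if p: "p \<in> K_points \<A>" "q p \<noteq> q Infty" for p
    proof -
      have "p \<in> \<Union>(hat ` \<F>)" using \<F>(3) p by blast
      then obtain A where A: "A \<in> \<F>" "p \<in> hat A" by blast
      have "k A \<le> n" unfolding n_def using member_le_sum[OF A(1), of k] \<F>(1) by simp
      then show ?thesis using k[OF A p(2)] T_mono by blast
    qed
    then have "q \<in> supp_in (T n)"
      using qs by (auto simp: supp_in_def)
    then have "C q \<subseteq> T (Suc n)" by (auto simp: T_Suc step_def)
    then show ?thesis by (auto simp: T'_def)
  qed
  moreover have "countable T'" unfolding T'_def using T by blast
  moreover have "T' \<subseteq> K_points \<A>" "Infty \<in> T'" unfolding T'_def using T by blast+
  moreover have "hat A \<subseteq> T'" if "Ell A \<in> T'" for A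
    using that hat_T' unfolding T'_def by blast
  ultimately have "closed_off C T'" by (simp add: closed_off_def)
  moreover have "T0 \<subseteq> T'"
    using T_def[of 0] by (auto simp: T'_def)
  ultimately show ?thesis by blast
qed

text \<open>
  If the basic neighbourhoods of \<open>p\<close> are the sets of all \<open>q\<close> that agree with \<open>p\<close> on a given
  countable set, this says that the simple functions form a Lindelof space. Cutting \<open>q\<close> off
  outside \<open>U n\<close> yields a continuous function, unless there is a new \<open>A\<close>, which accumulates in \<open>U n\<close>
  but has its point $l_A$ outside, with $q(l_A) \neq q(\infty)$. A set that is new for \<open>U n\<close> has its
  point in \<open>U (Suc n)\<close> and is not new later. As only finitely many \<open>A\<close> satisfy
  $q(l_A) \neq q(\infty)$, some stage has no obstruction.
\<close>

lemma simple_countable_agreement: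
  assumes ls: "locally_small \<A>"
    and C: "\<And>q. q \<in> simple_fns \<Longrightarrow> countable (C q)" "\<And>q. q \<in> simple_fns \<Longrightarrow> C q \<subseteq> K_points \<A>"
  obtains Q where "countable Q" "Q \<subseteq> simple_fns"
    "\<And>q. q \<in> simple_fns \<Longrightarrow> \<exists>p\<in>Q. \<forall>z\<in>C p. q z = p z"
proof -
  define new where "new T = {A\<in>\<A>. infinite {x\<in>A. Pt x \<in> T}}" for T
  have "\<exists>T'. T \<subseteq> T' \<and> Ell ` new T \<subseteq> T' \<and> closed_off C T'" if "countable T" "T \<subseteq> K_points \<A>" for T
  proof -
    have "countable (Ell ` new T)"
      unfolding new_def by (intro countable_image countable_members_meeting[OF ls that])
    moreover have "Ell ` new T \<subseteq> K_points \<A>" by (auto simp: new_def)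
    ultimately show ?thesis
      using closed_off_exists[OF ls C, where ?T0.0 = "T \<union> Ell ` new T"] that by auto
  qed
  then obtain nxt where nxt: "\<And>T. countable T \<Longrightarrow> T \<subseteq> K_points \<A> \<Longrightarrow>
      T \<subseteq> nxt T \<and> Ell ` new T \<subseteq> nxt T \<and> closed_off C (nxt T)"
    by metis
  define U where "U n = (nxt ^^ Suc n) {}" for n
  have U: "closed_off C (U n)" for n
  proof (induction n)
    case 0
    then show ?case using nxt[of "{}"] by (simp add: U_def)
  next
    case (Suc n)
    then show ?case using nxt[of "U n"] by (simp add: U_def closed_off_def)
  qed
  have U_Suc: "U n \<subseteq> U (Suc n)" "Ell ` new (U n) \<subseteq> U (Suc n)" for n
    using nxt[of "U n"] U[of n] by (auto simp: U_def closed_off_def)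
  have U_mono: "U m \<subseteq> U n" if "m \<le> n" for m n
    by (rule lift_Suc_mono_le[OF _ that]) (rule U_Suc(1))
  define Q where "Q = (\<Union>n. supp_in (U n))"
  have "countable Q"
    unfolding Q_def using U countable_supp_in[OF ls] by (auto simp: closed_off_def)
  moreover have "Q \<subseteq> simple_fns" by (auto simp: Q_def supp_in_def)
  moreover have "\<exists>p\<in>Q. \<forall>z\<in>C p. q z = p z" if q: "q \<in> simple_fns" for q
  proof -
    define \<E> where "\<E> = {A\<in>\<A>. q (Ell A) \<noteq> q Infty}"
    have fin: "finite \<E>" unfolding \<E>_def by (rule finite_simple_exceptional[OF q])
    have "\<exists>n. \<E> \<inter> {A\<in>new (U n). Ell A \<notin> U n} = {}"
    proof (rule ccontr)
      assume "\<not> ?thesis"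
      then have "\<exists>A. A \<in> \<E> \<and> A \<in> new (U n) \<and> Ell A \<notin> U n" for n by blast
      then obtain A where A: "\<And>n. A n \<in> \<E>" "\<And>n. A n \<in> new (U n)" "\<And>n. Ell (A n) \<notin> U n"
        by metis
      have "A m \<noteq> A n" if "m < n" for m n
      proof -
        have "Ell (A m) \<in> U n" using A(2)[of m] U_Suc(2)[of m] U_mono[of "Suc m" n] that by auto
        with A(3)[of n] show ?thesis by auto
      qed
      then have "inj A" by (metis injI linorder_neqE_nat)
      moreover have "finite (range A)" using A(1) fin by (meson finite_subset image_subsetI)
      ultimately show False using finite_imageD by blast
    qed
    then obtain n where n: "\<And>A. A \<in> \<E> \<Longrightarrow> Ell A \<notin> U n \<Longrightarrow> A \<notin> new (U n)" by blast
    have Un: "Infty \<in> U n" "\<And>A. Ell A \<in> U n \<Longrightarrow> hat A \<subseteq> U n" "\<And>p. p \<in> supp_in (U n) \<Longrightarrow> C p \<subseteq> U n"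
      using U[of n] by (auto simp: closed_off_def)
    define p where "p z = (if z \<in> U n then q z else if z \<in> K_points \<A> then q Infty else 0)" for z
    obtain \<F> where \<F>: "finite \<F>" "\<F> \<subseteq> \<A>"
      "\<And>z. z \<in> K_points \<A> \<Longrightarrow> z \<notin> \<Union>(hat ` \<F>) \<Longrightarrow> q z = q Infty"
      by (rule simple_at_Infty[OF q]) (rule that)
    have "p \<in> simple_fns"
    proof (rule simpleI[OF _ _ _ _ \<F>(1,2)])
      show "p z = 0" if "z \<notin> K_points \<A>" for z
        using that E_outside[OF simple_in_E[OF q]] by (simp add: p_def)
      have "range p \<subseteq> insert 0 (range q)" by (auto simp: p_def)
      moreover have "finite (insert 0 (range q))" "insert 0 (range q) \<subseteq> \<rat>"
        using q by (auto simp: simple_fns_def)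
      ultimately show "finite (range p)" "range p \<subseteq> \<rat>"
        using finite_subset order_trans by blast+
      show "p z = p Infty" if "z \<in> K_points \<A>" "z \<notin> \<Union>(hat ` \<F>)" for z
        using \<F>(3)[OF that] that(1) Un(1) by (simp add: p_def)
      fix A assume A: "A \<in> \<A>"
      show "finite {x\<in>A. p (Pt x) \<noteq> p (Ell A)}"
      proof (cases "Ell A \<in> U n")
        case True
        then have "{x\<in>A. p (Pt x) \<noteq> p (Ell A)} \<subseteq> {x\<in>A. q (Pt x) \<noteq> q (Ell A)}"
          using Un(2)[OF True] by (auto simp: p_def hat_def)
        then show ?thesis using simple_at_Ell[OF q A] finite_subset by blast
      next
        case False
        then have pl: "p (Ell A) = q Infty" using A by (simp add: p_def)
        show ?thesis
        proof (cases "A \<in> \<E>")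
          case True
          then have "finite {x\<in>A. Pt x \<in> U n}" using n[OF True False] A by (simp add: new_def)
          moreover have "{x\<in>A. p (Pt x) \<noteq> p (Ell A)} \<subseteq> {x\<in>A. Pt x \<in> U n}"
            using A by (auto simp: pl) (auto simp: p_def split: if_splits)
          ultimately show ?thesis using finite_subset by blast
        next
          case False
          then have "q (Ell A) = q Infty" using A by (simp add: \<E>_def)
          then have "{x\<in>A. p (Pt x) \<noteq> p (Ell A)} \<subseteq> {x\<in>A. q (Pt x) \<noteq> q (Ell A)}"
            using A by (auto simp: pl) (auto simp: p_def split: if_splits)
          then show ?thesis using simple_at_Ell[OF q A] finite_subset by blast
        qed
      qed
    qed
    then have pU: "p \<in> supp_in (U n)"
      using Un(1) by (auto simp: supp_in_def p_def)
    then have "p \<in> Q" by (auto simp: Q_def)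
    moreover have "\<forall>z\<in>C p. q z = p z"
      using Un(3)[OF pU] by (auto simp: p_def)
    ultimately show ?thesis by blast
  qed
  ultimately show ?thesis by (rule that)
qed

text \<open>
  A pair \<open>(q, n)\<close> is good if countably many members of the cover contain all functions within
  $2^{-n}$ of some simple function that agrees with \<open>q\<close> on a suitable countable set. By
  \<open>simple_countable_agreement\<close>, \<open>(q, n)\<close> is good if all \<open>(q', n + 1)\<close> with \<open>q'\<close> within
  $2 \cdot 2^{-n}$ of \<open>q\<close> are good. So a pair that is not good starts a sequence of such pairs
  whose first components converge uniformly to some \<open>g\<close>. But \<open>g\<close> has a weak neighbourhood inside a
  member of the cover, which is given by finitely many functionals; these see only countably
  many points, so that one member captures a late pair of the sequence. Hence all pairs
  \<open>(q, 0)\<close> are good, and another application of \<open>simple_countable_agreement\<close> gives a countable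
  subcover.
\<close>

theorem locally_small_imp_weakly_Lindelof:
  assumes ls: "locally_small \<A>"
  shows "Lindelof_space (weak_topology E N)"
  unfolding Lindelof_space_def
proof (intro allI impI, elim conjE)
  fix \<U> assume op: "\<forall>U\<in>\<U>. openin (weak_topology E N) U"
    and "\<Union>\<U> = topspace (weak_topology E N)"
  then have cov: "\<Union>\<U> = E" by (simp add: topspace_weak)
  define captures where "captures q n C \<V> \<longleftrightarrow>
      countable C \<and> C \<subseteq> K_points \<A> \<and> countable \<V> \<and> \<V> \<subseteq> \<U> \<and>
      (\<forall>f\<in>E. \<forall>q'\<in>simple_fns. (\<forall>z\<in>C. q' z = q z) \<and> N (f - q') \<le> (1/2) ^ n \<longrightarrow> f \<in> \<Union>\<V>)"
    for q n C \<V>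
  define good where "good q n \<longleftrightarrow> (\<exists>C \<V>. captures q n C \<V>)" for q n
  have approx: "\<exists>q\<in>simple_fns. N (f - q) \<le> (1/2) ^ n" if "f \<in> E" for f n
    using simple_dense[OF that, of "(1/2) ^ n"] by (metis less_imp_le zero_less_power half_gt_zero_iff zero_less_one)
  have step: "good q n" if q: "q \<in> simple_fns"
    and all: "\<And>q'. q' \<in> simple_fns \<Longrightarrow> N (q' - q) \<le> 2 * (1/2) ^ n \<Longrightarrow> good q' (Suc n)" for q n
  proof -
    \<comment> \<open>Simple functions far from \<open>q\<close> get a point that witnesses the distance, so that none of them agrees on its set with a simple function near \<open>q\<close>.\<close>
    have "\<exists>C \<V>. countable C \<and> C \<subseteq> K_points \<A> \<and>
        (if N (q' - q) \<le> 2 * (1/2) ^ n then captures q' (Suc n) C \<V>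
         else \<V> = {} \<and> (\<exists>z\<in>C. 2 * (1/2) ^ n < \<bar>q' z - q z\<bar>))" if q': "q' \<in> simple_fns" for q'
    proof (cases "N (q' - q) \<le> 2 * (1/2) ^ n")
      case True
      then show ?thesis using all[OF q' True] unfolding good_def captures_def by auto
    next
      case False
      have dE: "q' - q \<in> E" using q q' simple_in_E by simp
      with False obtain z where z: "2 * (1/2) ^ n < \<bar>q' z - q z\<bar>"
        by (auto simp: N_le_iff not_le)
      moreover have "z \<in> K_points \<A>"
      proof (rule ccontr)
        assume "z \<notin> K_points \<A>"
        then have "(q' - q) z = 0" using E_outside[OF dE] by blast
        then have "\<bar>q' z - q z\<bar> = 0" by simp
        with z show False by (simp add: not_less)
      qed
      ultimately show ?thesis using False by (intro exI[of _ "{z}"] exI[of _ "{}"]) auto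
    qed
    then obtain C \<V> where CV: "\<And>q'. q' \<in> simple_fns \<Longrightarrow> countable (C q') \<and> C q' \<subseteq> K_points \<A> \<and>
        (if N (q' - q) \<le> 2 * (1/2) ^ n then captures q' (Suc n) (C q') (\<V> q')
         else \<V> q' = {} \<and> (\<exists>z\<in>C q'. 2 * (1/2) ^ n < \<bar>q' z - q z\<bar>))"
      by metis
    obtain Q where Q: "countable Q" "Q \<subseteq> simple_fns"
      "\<And>q. q \<in> simple_fns \<Longrightarrow> \<exists>p\<in>Q. \<forall>z\<in>C p. q z = p z"
      by (rule simple_countable_agreement[OF ls, of C]) (use CV in blast, use CV in blast, rule that)
    have \<V>: "countable (\<V> p) \<and> \<V> p \<subseteq> \<U>" if "p \<in> Q" for p
    proof -
      have "p \<in> simple_fns" using that Q(2) by blast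
      note CV[OF this]
      then show ?thesis
        by (cases "N (p - q) \<le> 2 * (1/2) ^ n") (simp_all add: captures_def)
    qed
    have "captures q n (\<Union>p\<in>Q. C p) (\<Union>p\<in>Q. \<V> p)"
      unfolding captures_def
    proof (intro conjI ballI impI)
      show "countable (\<Union>p\<in>Q. C p)" "countable (\<Union>p\<in>Q. \<V> p)"
        using Q(1,2) CV \<V> by (auto intro!: countable_UN)
      show "(\<Union>p\<in>Q. C p) \<subseteq> K_points \<A>" using CV Q(2) by blast
      show "(\<Union>p\<in>Q. \<V> p) \<subseteq> \<U>" using \<V> by blast
      fix f q' assume f: "f \<in> E" and q': "q' \<in> simple_fns"
        and *: "(\<forall>z\<in>\<Union>p\<in>Q. C p. q' z = q z) \<and> N (f - q') \<le> (1/2) ^ n"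
      obtain r where r: "r \<in> simple_fns" "N (f - r) \<le> (1/2) ^ Suc n"
        using approx[OF f] by blast
      have inE: "r \<in> E" "q \<in> E" "q' \<in> E" using r q q' simple_in_E by auto
      \<comment> \<open>Translating the approximation \<open>r\<close> of \<open>f\<close> by \<open>q - q'\<close> brings it near \<open>q\<close> without changing it on the sets \<open>C p\<close>.\<close>
      define s where "s = r - q' + q"
      have s: "s \<in> simple_fns"
        unfolding s_def using r q q' by (intro simple_add simple_diff)
      have "N (s - q) = N (r - q')" by (simp add: s_def)
      also have "\<dots> \<le> N (r - f) + N (f - q')"
        using inE f by (intro N_triangle)
      also have "\<dots> \<le> (1/2) ^ Suc n + (1/2) ^ n"
        using r(2) * N_minus_commute[OF f inE(1)] by (intro add_mono) auto
      also have "\<dots> \<le> 2 * (1/2) ^ n" by simp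
      finally have s_near: "N (s - q) \<le> 2 * (1/2) ^ n" .
      obtain p where p: "p \<in> Q" "\<forall>z\<in>C p. s z = p z" using Q(3)[OF s] by blast
      have ps: "p \<in> simple_fns" using p(1) Q(2) by blast
      have near: "N (p - q) \<le> 2 * (1/2) ^ n"
      proof (rule ccontr)
        assume "\<not> ?thesis"
        then obtain z where z: "z \<in> C p" "2 * (1/2) ^ n < \<bar>p z - q z\<bar>"
          using CV[OF ps] by auto
        have "s - q \<in> E" using s inE simple_in_E by simp
        then have "\<bar>(s - q) z\<bar> \<le> N (s - q)" by (rule abs_le_N)
        then show False using z p(2) s_near by auto
      qed
      then have cap: "captures p (Suc n) (C p) (\<V> p)" using CV[OF ps] by simp
      have "\<forall>z\<in>C p. r z = p z"
      proof
        fix z assume z: "z \<in> C p"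
        then have "q' z = q z" using * p(1) by blast
        moreover have "s z = p z" using p(2) z by blast
        ultimately show "r z = p z" by (simp add: s_def)
      qed
      then have "f \<in> \<Union>(\<V> p)"
        using cap f r unfolding captures_def by blast
      then show "f \<in> \<Union>(\<Union>p\<in>Q. \<V> p)" using p(1) by blast
    qed
    then show ?thesis unfolding good_def by blast
  qed
  have all_good: "good q 0" if q: "q \<in> simple_fns" for q
  proof (rule ccontr)
    assume bad: "\<not> good q 0"
    have "\<exists>s. \<forall>n. (s n \<in> simple_fns \<and> \<not> good (s n) n) \<and> N (s (Suc n) - s n) \<le> 2 * (1/2) ^ n"
    proof (rule dependent_nat_choice)
      show "\<exists>q. q \<in> simple_fns \<and> \<not> good q 0" using q bad by blast
      show "\<exists>y. (y \<in> simple_fns \<and> \<not> good y (Suc n)) \<and> N (y - x) \<le> 2 * (1/2) ^ n"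
        if "x \<in> simple_fns \<and> \<not> good x n" for x n
        using step[of x n] that by blast
    qed
    then obtain s where s: "\<And>n. s n \<in> simple_fns" "\<And>n. \<not> good (s n) n"
        "\<And>n. N (s (Suc n) - s n) \<le> 2 * (1/2) ^ n"
      by blast
    have sE: "s n \<in> E" for n using s(1) simple_in_E by blast
    have step_pt: "\<bar>s (Suc n) p - s n p\<bar> \<le> 2 * (1/2) ^ n" for n p
      using abs_le_N[of "s (Suc n) - s n" p] sE s(3)[of n] by simp
    \<comment> \<open>Subtracting the geometric tail makes the bound additive in \<open>k\<close>, so that induction goes through.\<close>
    have cauchy: "\<bar>s (n + k) p - s n p\<bar> \<le> 4 * (1/2) ^ n - 4 * (1/2) ^ (n + k)" for n k p
    proof (induction k)
      case (Suc k)
      then show ?case using step_pt[of "n + k" p] by simp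
    qed simp
    have lim: "\<exists>l. (\<lambda>n. s n p) \<longlonglongrightarrow> l" for p
    proof -
      have "Cauchy (\<lambda>n. s n p)"
      proof (rule CauchyI')
        fix e :: real assume "e > 0"
        then obtain M where M: "(1/2) ^ M < e / 4"
          using real_arch_pow_inv[of "e / 4" "1/2"] by auto
        have "dist (s m p) (s n p) < e" if "M \<le> m" "m < n" for m n
        proof -
          have "\<bar>s n p - s m p\<bar> \<le> 4 * (1/2) ^ m"
          proof -
            have "(0::real) \<le> (1/2) ^ n" by simp
            moreover have "\<bar>s n p - s m p\<bar> \<le> 4 * (1/2) ^ m - 4 * (1/2) ^ n"
              using cauchy[of m "n - m" p] that by simp
            ultimately show ?thesis by linarith
          qed
          also have "\<dots> \<le> 4 * (1/2) ^ M"
            using that by (simp add: power_decreasing)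
          finally show ?thesis using M by (simp add: dist_real_def abs_minus_commute)
        qed
        then show "\<exists>M. \<forall>m\<ge>M. \<forall>n>m. dist (s m p) (s n p) < e" by blast
      qed
      then show ?thesis using Cauchy_convergent convergent_def by blast
    qed
    then obtain g where g: "\<And>p. (\<lambda>n. s n p) \<longlonglongrightarrow> g p" by metis
    have near: "\<bar>g p - s n p\<bar> \<le> 4 * (1/2) ^ n" for p n
    proof (rule LIMSEQ_le_const2)
      show "(\<lambda>m. \<bar>s m p - s n p\<bar>) \<longlonglongrightarrow> \<bar>g p - s n p\<bar>"
        by (intro tendsto_intros g)
      have "\<bar>s m p - s n p\<bar> \<le> 4 * (1/2) ^ n" if "m \<ge> n" for m
      proof -
        have "(0::real) \<le> (1/2) ^ m" by simp
        moreover have "\<bar>s m p - s n p\<bar> \<le> 4 * (1/2) ^ n - 4 * (1/2) ^ m"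
          using cauchy[of n "m - n" p] that by simp
        ultimately show ?thesis by linarith
      qed
      then show "\<exists>M. \<forall>m\<ge>M. \<bar>s m p - s n p\<bar> \<le> 4 * (1/2) ^ n" by blast
    qed
    have gE: "g \<in> E"
    proof (rule uniform_limit_in_E)
      fix e :: real assume "e > 0"
      then obtain M where M: "(1/2) ^ M < e / 4"
        using real_arch_pow_inv[of "e / 4" "1/2"] by auto
      then have "\<bar>g p - s M p\<bar> < e" for p using near[of p M] by linarith
      then show "\<exists>f\<in>E. \<forall>p. \<bar>g p - f p\<bar> < e" using sE by blast
    qed
    have gN: "N (s n - g) \<le> 4 * (1/2) ^ n" for n
      using near sE gE by (simp add: N_le_iff abs_minus_commute)
    obtain U where U: "U \<in> \<U>" "g \<in> U" using cov gE by blast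
    then have "openin (weak_topology E N) U" using op by blast
    then obtain \<Phi> \<delta> where \<Phi>: "finite \<Phi>" "\<Phi> \<subseteq> dual E N" "\<delta> > 0"
      "\<And>y. y \<in> E \<Longrightarrow> \<forall>\<phi>\<in>\<Phi>. \<bar>\<phi> y - \<phi> g\<bar> < \<delta> \<Longrightarrow> y \<in> U"
      by (rule weak_nhd[OF _ U(2)]) (rule that)
    have "\<exists>C. countable C \<and> C \<subseteq> K_points \<A> \<and> (\<forall>f\<in>E. (\<forall>p\<in>C. f p = 0) \<longrightarrow> \<phi> f = 0)"
      if "\<phi> \<in> \<Phi>" for \<phi>
      using that \<Phi>(2) by (intro dual_countably_determined) auto
    then obtain C where C: "\<And>\<phi>. \<phi> \<in> \<Phi> \<Longrightarrow> countable (C \<phi>)" "\<And>\<phi>. \<phi> \<in> \<Phi> \<Longrightarrow> C \<phi> \<subseteq> K_points \<A>"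
        "\<And>\<phi> f. \<phi> \<in> \<Phi> \<Longrightarrow> f \<in> E \<Longrightarrow> (\<forall>p\<in>C \<phi>. f p = 0) \<Longrightarrow> \<phi> f = 0"
      by metis
    define M where "M = (\<Sum>\<phi>\<in>\<Phi>. dual_norm E N \<phi>) + 1"
    have dn: "dual_norm E N \<phi> \<le> M" if "\<phi> \<in> \<Phi>" for \<phi>
    proof -
      have "dual_norm E N \<phi> \<le> (\<Sum>\<phi>\<in>\<Phi>. dual_norm E N \<phi>)"
        using \<Phi>(1,2) dual_norm_ge_0 by (intro member_le_sum[OF that]) auto
      then show ?thesis by (simp add: M_def)
    qed
    have M: "M > 0"
      unfolding M_def using \<Phi>(2) dual_norm_ge_0 by (intro add_nonneg_pos sum_nonneg) auto
    obtain n where n: "(1/2) ^ n < \<delta> / (5 * M)"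
      using real_arch_pow_inv[of "\<delta> / (5 * M)" "1/2"] M \<Phi>(3) by auto
    have "captures (s n) n (\<Union>\<phi>\<in>\<Phi>. C \<phi>) {U}"
      unfolding captures_def
    proof (intro conjI ballI impI)
      show "countable (\<Union>\<phi>\<in>\<Phi>. C \<phi>)"
        using \<Phi>(1) C(1) by (intro countable_UN) (auto simp: countable_finite)
      show "(\<Union>\<phi>\<in>\<Phi>. C \<phi>) \<subseteq> K_points \<A>" using C(2) by blast
      fix f q' assume f: "f \<in> E" and q': "q' \<in> simple_fns"
        and *: "(\<forall>z\<in>\<Union>\<phi>\<in>\<Phi>. C \<phi>. q' z = s n z) \<and> N (f - q') \<le> (1/2) ^ n"
      have q'E: "q' \<in> E" using q' by (rule simple_in_E)
      have "f \<in> U"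
      proof (rule \<Phi>(4)[OF f], rule ballI)
        fix \<phi> assume \<phi>: "\<phi> \<in> \<Phi>"
        then have \<phi>d: "\<phi> \<in> dual E N" using \<Phi>(2) by blast
        have bound: "\<bar>\<phi> h\<bar> \<le> M * c" if "h \<in> E" "N h \<le> c" for h c
        proof -
          have "\<bar>\<phi> h\<bar> \<le> dual_norm E N \<phi> * N h" using dual_norm_bound[OF \<phi>d that(1)] .
          also have "\<dots> \<le> M * c"
            using dn[OF \<phi>] that M N_ge_0[OF that(1)] by (intro mult_mono) auto
          finally show ?thesis .
        qed
        have "\<phi> (q' - s n) = 0"
          using q'E sE * \<phi> by (intro C(3)[OF \<phi>]) auto
        then have "\<phi> f - \<phi> g = \<phi> (f - q') + \<phi> (s n - g)"
          using f q'E sE gE by (simp add: dual_linear(3)[OF \<phi>d])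
        moreover have "\<bar>\<phi> (f - q')\<bar> \<le> M * (1/2) ^ n"
          using f q'E * by (intro bound) auto
        moreover have "\<bar>\<phi> (s n - g)\<bar> \<le> M * (4 * (1/2) ^ n)"
          using sE gE gN by (intro bound) auto
        ultimately have "\<bar>\<phi> f - \<phi> g\<bar> \<le> 5 * M * (1/2) ^ n" by (simp add: algebra_simps)
        also have "\<dots> < \<delta>" using n M by (simp add: field_simps)
        finally show "\<bar>\<phi> f - \<phi> g\<bar> < \<delta>" .
      qed
      then show "f \<in> \<Union>{U}" by simp
    qed (use U in auto)
    then show False using s(2)[of n] unfolding good_def by blast
  qed
  then obtain C \<V> where CV: "\<And>q. q \<in> simple_fns \<Longrightarrow> captures q 0 (C q) (\<V> q)"
    unfolding good_def by metis
  obtain Q where Q: "countable Q" "Q \<subseteq> simple_fns"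
    "\<And>q. q \<in> simple_fns \<Longrightarrow> \<exists>p\<in>Q. \<forall>z\<in>C p. q z = p z"
  proof (rule simple_countable_agreement[OF ls, of C])
    show "countable (C q)" "C q \<subseteq> K_points \<A>" if "q \<in> simple_fns" for q
      using CV[OF that] by (simp_all add: captures_def)
  qed (rule that)
  define \<W> where "\<W> = (\<Union>p\<in>Q. \<V> p)"
  have \<V>: "countable (\<V> p) \<and> \<V> p \<subseteq> \<U>" if "p \<in> Q" for p
  proof -
    have "captures p 0 (C p) (\<V> p)" using CV that Q(2) by blast
    then show ?thesis by (simp add: captures_def)
  qed
  have "f \<in> \<Union>\<W>" if f: "f \<in> E" for f
  proof -
    obtain q where q: "q \<in> simple_fns" "N (f - q) \<le> (1/2) ^ 0"
      using approx[OF f] by blast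
    obtain p where p: "p \<in> Q" "\<forall>z\<in>C p. q z = p z" using Q(3)[OF q(1)] by blast
    have "captures p 0 (C p) (\<V> p)"
      using CV p(1) Q(2) by blast
    then have "\<forall>f\<in>E. \<forall>q'\<in>simple_fns. (\<forall>z\<in>C p. q' z = p z) \<and> N (f - q') \<le> (1/2) ^ 0 \<longrightarrow> f \<in> \<Union>(\<V> p)"
      unfolding captures_def by (elim conjE)
    from bspec[OF bspec[OF this f] q(1)] p(2) q(2) have "f \<in> \<Union>(\<V> p)"
      by simp
    then show ?thesis using p(1) by (auto simp: \<W>_def)
  qed
  moreover have "countable \<W>" unfolding \<W>_def using Q(1) \<V> by (intro countable_UN) auto
  moreover have "\<W> \<subseteq> \<U>" unfolding \<W>_def using \<V> by blast
  ultimately show "\<exists>\<V>. countable \<V> \<and> \<V> \<subseteq> \<U> \<and> \<Union>\<V> = topspace (weak_topology E N)"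
    using cov by (intro exI[of _ \<W>]) (auto simp: topspace_weak)
qed

end

theorem theorem1p4:
  fixes \<A> :: "'a set set"
  assumes "almost_disjoint \<A>"
    and "\<forall>A\<in>\<A>. countable A"
  defines "K \<equiv> K_space \<A>"
  defines "E \<equiv> C_space K"
  defines "N \<equiv> sup_norm K"
  shows "(locally_small \<A> \<longleftrightarrow> monolithic K) \<and>
         (locally_small \<A> \<longleftrightarrow> controlled_SCP E N) \<and>
         (locally_small \<A> \<longleftrightarrow> Lindelof_space (weak_topology E N)) \<and>
         (locally_small \<A> \<longleftrightarrow>
            monolithic (subtopology (weak_star_topology E N) (dual_unit_ball E N)))"
proof -
  interpret ad_family \<A>
    using assms(1,2) by unfold_locales
  show ?thesis
    unfolding E_def N_def K_def
    using locally_small_imp_controlled_SCP controlled_SCP_imp_monolithic_dual_ball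
      monolithic_dual_ball_imp_monolithic monolithic_imp_locally_small
      locally_small_imp_weakly_Lindelof weakly_Lindelof_imp_locally_small
    by blast
qed

end
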